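(* Let $a\in H^\infty$ be outer. The following are equivalent: (i) $\mathscr{M}(a)$ is a closed subspace of $\mathscr{M}(\overline{a})$. (ii) $T_{a/\overline{a}}H^2$ is a closed subspace of $H^2$. (iii) $T_{a/\overline{a}}$ is left invertible. (iv) $T_{\overline{a}/a}$ is surjective.
   Context: $H^2$ is the Hardy space of the open unit disk with $\langle f,g\rangle_{H^2}=\int_{\mathbb{T}}f\overline{g}\,dm$ ($m$ normalized Lebesgue measure on the unit circle $\mathbb{T}$), $H^\infty$ the bounded analytic functions on the disk. For $\varphi\in L^\infty(\mathbb{T})$, $T_\varphi f=P_+(\varphi f)$ on $H^2$, with $P_+:L^2\to H^2$ the orthogonal projection. For $a$ outer, $T_{\overline{a}}$ is injective; $\mathscr{M}(\overline{a}):=T_{\overline{a}}H^2$ is a Hilbert space with $\langle T_{\overline{a}}f,T_{\overline{a}}g\rangle_{\overline{a}}:=\langle f,g\rangle_{H^2}$, and $\mathscr{M}(a):=aH^2$, which is contained in $\mathscr{M}(\overline{a})$. In (i), "closed" refers to the norm of $\mathscr{M}(\overline{a})$. *)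

theory Defs
  imports "HOL-Analysis.Analysis"
begin

text \<open>
  Normalized Lebesgue measure \<open>m\<close> on the unit circle. Its underlying space is the circle itself, so
  values of integrands off the circle play no role.
\<close>

definition circle_measure :: "complex measure" where
  "circle_measure =
     distr (uniform_measure lborel {0..2 * pi}) (restrict_space borel (sphere 0 1)) cis"

text \<open>Boundary function: the radial limit, which is only meaningful where that limit exists.\<close>

definition boundary :: "(complex \<Rightarrow> complex) \<Rightarrow> complex \<Rightarrow> complex" where
  "boundary f \<zeta> = Lim (at_left (1 :: real)) (\<lambda>r. f (of_real r * \<zeta>))"

text \<open>
  Functions on the disk are functions on the whole plane. Elements of \<open>H2\<close> are normalized to vanish
  off the open disk, so that equality of functions is equality on the disk. For \<open>Hinf\<close> no such
  normalization is made; only values on the disk are ever used.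
\<close>

definition H2 :: "(complex \<Rightarrow> complex) set" where
  "H2 = {f. f holomorphic_on ball 0 1 \<and> (\<forall>z. z \<notin> ball 0 1 \<longrightarrow> f z = 0) \<and>
     bdd_above ((\<lambda>r :: real. \<integral>\<zeta>. (cmod (f (of_real r * \<zeta>)))\<^sup>2 \<partial>circle_measure) ` {0..<1})}"

definition Hinf :: "(complex \<Rightarrow> complex) set" where
  "Hinf = {f. f holomorphic_on ball 0 1 \<and> bounded (f ` ball 0 1)}"

definition L2_inner :: "(complex \<Rightarrow> complex) \<Rightarrow> (complex \<Rightarrow> complex) \<Rightarrow> complex" where
  "L2_inner F G = (\<integral>\<zeta>. F \<zeta> * cnj (G \<zeta>) \<partial>circle_measure)"

definition H2_inner :: "(complex \<Rightarrow> complex) \<Rightarrow> (complex \<Rightarrow> complex) \<Rightarrow> complex" where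
  "H2_inner f g = L2_inner (boundary f) (boundary g)"

definition H2_norm :: "(complex \<Rightarrow> complex) \<Rightarrow> real" where
  "H2_norm f = sqrt (Re (H2_inner f f))"

definition outer :: "(complex \<Rightarrow> complex) \<Rightarrow> bool" where
  "outer a \<longleftrightarrow> (\<exists>c \<phi>. cmod c = 1 \<and>
     \<phi> \<in> borel_measurable circle_measure \<and> (\<forall>\<zeta>\<in>sphere 0 1. (0 :: real) < \<phi> \<zeta>) \<and>
     integrable circle_measure (\<lambda>\<zeta>. ln (\<phi> \<zeta>)) \<and>
     (\<forall>z\<in>ball 0 1. a z =
        c * exp (\<integral>\<zeta>. (\<zeta> + z) / (\<zeta> - z) * of_real (ln (\<phi> \<zeta>)) \<partial>circle_measure)))"

text \<open>
  Orthogonal projection of \<open>L\<^sup>2\<close> onto \<open>H\<^sup>2\<close>: the unique \<open>g\<close> in \<open>H2\<close> with \<open>F - g\<close> orthogonal to \<open>H2\<close>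
  (for \<open>F\<close> in \<open>L\<^sup>2\<close> of the circle).
\<close>

definition P_plus :: "(complex \<Rightarrow> complex) \<Rightarrow> complex \<Rightarrow> complex" where
  "P_plus F = (THE g. g \<in> H2 \<and> (\<forall>h\<in>H2. L2_inner (\<lambda>\<zeta>. F \<zeta> - boundary g \<zeta>) (boundary h) = 0))"

text \<open>The symbol \<open>\<phi>\<close> is a function on the circle.\<close>

definition Toeplitz :: "(complex \<Rightarrow> complex) \<Rightarrow> (complex \<Rightarrow> complex) \<Rightarrow> complex \<Rightarrow> complex" where
  "Toeplitz \<phi> f = P_plus (\<lambda>\<zeta>. \<phi> \<zeta> * boundary f \<zeta>)"

abbreviation T_conj :: "(complex \<Rightarrow> complex) \<Rightarrow> (complex \<Rightarrow> complex) \<Rightarrow> complex \<Rightarrow> complex" where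
  "T_conj a \<equiv> Toeplitz (\<lambda>\<zeta>. cnj (boundary a \<zeta>))"

definition M_an :: "(complex \<Rightarrow> complex) \<Rightarrow> (complex \<Rightarrow> complex) set" where
  "M_an a = (\<lambda>f z. a z * f z) ` H2"

definition M_co :: "(complex \<Rightarrow> complex) \<Rightarrow> (complex \<Rightarrow> complex) set" where
  "M_co a = T_conj a ` H2"

text \<open>
  The range inner product, transported from \<open>H2\<close>; for outer \<open>a\<close> the preimages are unique.
\<close>

definition M_co_inner ::
  "(complex \<Rightarrow> complex) \<Rightarrow> (complex \<Rightarrow> complex) \<Rightarrow> (complex \<Rightarrow> complex) \<Rightarrow> complex" where
  "M_co_inner a F G = H2_inner (inv_into H2 (T_conj a) F) (inv_into H2 (T_conj a) G)"

definition M_co_norm :: "(complex \<Rightarrow> complex) \<Rightarrow> (complex \<Rightarrow> complex) \<Rightarrow> real" where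
  "M_co_norm a F = sqrt (Re (M_co_inner a F F))"

definition closed_subspace ::
  "(complex \<Rightarrow> complex) set \<Rightarrow> ((complex \<Rightarrow> complex) \<Rightarrow> real) \<Rightarrow> (complex \<Rightarrow> complex) set \<Rightarrow> bool" where
  "closed_subspace X nrm M \<longleftrightarrow>
     M \<subseteq> X \<and> (\<lambda>z. 0) \<in> M \<and>
     (\<forall>f\<in>M. \<forall>g\<in>M. (\<lambda>z. f z + g z) \<in> M) \<and> (\<forall>c. \<forall>f\<in>M. (\<lambda>z. c * f z) \<in> M) \<and>
     closedin (Metric_space.mtopology X (\<lambda>f g. nrm (\<lambda>z. f z - g z))) M"

definition bounded_operator_H2 ::
  "((complex \<Rightarrow> complex) \<Rightarrow> complex \<Rightarrow> complex) \<Rightarrow> bool" where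
  "bounded_operator_H2 S \<longleftrightarrow>
     S ` H2 \<subseteq> H2 \<and>
     (\<forall>f\<in>H2. \<forall>g\<in>H2. S (\<lambda>z. f z + g z) = (\<lambda>z. S f z + S g z)) \<and>
     (\<forall>c. \<forall>f\<in>H2. S (\<lambda>z. c * f z) = (\<lambda>z. c * S f z)) \<and>
     (\<exists>K. \<forall>f\<in>H2. H2_norm (S f) \<le> K * H2_norm f)"

text \<open>Left invertibility is meant in the algebra of bounded operators on \<open>H2\<close>.\<close>

definition left_invertible_H2 ::
  "((complex \<Rightarrow> complex) \<Rightarrow> complex \<Rightarrow> complex) \<Rightarrow> bool" where
  "left_invertible_H2 T \<longleftrightarrow> (\<exists>S. bounded_operator_H2 S \<and> (\<forall>f\<in>H2. S (T f) = f))"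

end

theory Submission
  imports Defs "HOL-Probability.Probability_Measure" "HOL-Complex_Analysis.Complex_Analysis"
begin

text \<open>
  Write \<open>U\<close> for the Toeplitz operator with symbol \<open>a / cnj a\<close>; its adjoint has symbol \<open>cnj a / a\<close>.
  Composing \<open>T_conj a\<close> with \<open>U\<close> gives multiplication by \<open>a\<close>, and \<open>T_conj a\<close> maps \<open>H2\<close> isometrically
  onto \<open>M_co a\<close>; hence (i) is the image of (ii) under an isometry, and \<open>U\<close> is injective. For an
  injective bounded operator on a Hilbert space, closed range, boundedness from below, left
  invertibility and surjectivity of the adjoint are equivalent; the only deep ingredient is that
  weakly bounded sets are bounded.

  Boundary values come from Fatou's theorem: Parseval's identity makes the dilations of a function
  in \<open>H2\<close> Cauchy in mean square, and a weak-type maximal inequality (Vitali covering) upgrades this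
  to radial convergence almost everywhere. Outer functions enter through bounded analytic functions
  \<open>h n\<close> with \<open>cmod (a z * h n z) \<le> 1\<close> and \<open>a 0 * h n 0\<close> tending to a unimodular constant \<open>c\<close>. This
  forces \<open>a * h n\<close> to tend to \<open>c\<close> in mean square on the circle, so the boundary function of \<open>a\<close> is
  nonzero almost everywhere and the multiples of \<open>a\<close> are dense in \<open>H2\<close>.
\<close>


section \<open>Hilbert spaces\<close>

text \<open>Two features of the definitions shape the proof. Boundary functions are radial limits
  with one fixed default value where no limit exists, so sums and products of functions pass to the
  boundary only almost everywhere. Toeplitz images are therefore identified by pairing them with
  every function in \<open>H2\<close>, where null sets disappear inside integrals, and never by
  formulas on the circle. Moreover, the class \<open>real_inner\<close> knows real scalars only. So
  \<open>H2\<close> becomes a real Hilbert space under the real part of its inner product, and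
  complex information is put back where it matters: for the projection by testing with
  \<open>- \<i> * h\<close>, for the left inverse by uniqueness of least-squares solutions.

  Mean-square convergence of dilations gives a limit on the circle but says nothing about a single
  radius; control of the supremum over all radii is what turns it into a pointwise statement. The
  constants in that control are crude on purpose: they only multiply an error that tends to
  0.\<close>

lemma closed_subspace_projection:
  fixes S :: "'a::{real_inner,banach} set"
  assumes "subspace S" "closed S"
  obtains p where "p \<in> S" "\<And>y. y \<in> S \<Longrightarrow> (x - p) \<bullet> y = 0"
proof -
  have S0: "S \<noteq> {}" using subspace_0[OF assms(1)] by auto
  define d where "d = infdist x S"
  have d0: "d \<ge> 0" unfolding d_def by (rule infdist_nonneg)
  have dle: "d \<le> norm (x - y)" if "y \<in> S" for y
    unfolding d_def using infdist_le[OF that, of x] by (simp add: dist_norm)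
  have "\<exists>y\<in>S. norm (x - y) < d + 1 / Suc n" for n
  proof -
    have "infdist x S < d + 1 / Suc n" unfolding d_def by simp
    then have "Inf (dist x ` S) < d + 1 / Suc n" using S0 by (simp add: infdist_def)
    from cInf_lessD[OF _ this] S0 show ?thesis by (auto simp: dist_norm)
  qed
  then obtain s where s: "\<And>n. s n \<in> S" "\<And>n. norm (x - s n) < d + 1 / Suc n"
    by metis
  \<comment> \<open>The midpoint of \<open>s m\<close> and \<open>s n\<close> lies in
    \<open>S\<close>, so its distance from \<open>x\<close> is at least \<open>d\<close>, and the
    parallelogram law bounds the gap. The factor \<open>2 * d + 1\<close> absorbs the square of
    \<open>1 / Suc N\<close>, which is at most \<open>1 / Suc N\<close>.\<close>
  have sq: "(norm (s m - s n))\<^sup>2 \<le> 4 * ((2 * d + 1) * (1 / Suc N))" if "m \<ge> N" "n \<ge> N" for m n N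
  proof -
    have b: "(norm (x - s k))\<^sup>2 \<le> d\<^sup>2 + (2*d+1) * (1 / Suc N)" if "k \<ge> N" for k
    proof -
      have le: "1 / real (Suc k) \<le> 1 / Suc N" using that by (simp add: frac_le)
      have "norm (x - s k) \<le> d + 1 / Suc N" using s(2)[of k] le by linarith
      then have "(norm (x - s k))\<^sup>2 \<le> (d + 1 / Suc N)\<^sup>2" by (intro power_mono) auto
      also have "\<dots> = d\<^sup>2 + 2 * d * (1 / Suc N) + (1 / Suc N) * (1 / Suc N)"
        by (simp add: power2_eq_square algebra_simps)
      also have "\<dots> \<le> d\<^sup>2 + 2 * d * (1 / Suc N) + 1 * (1 / Suc N)"
        by (intro add_left_mono mult_right_mono) auto
      finally show ?thesis by (simp add: algebra_simps)
    qed
    have "(1/2) *\<^sub>R (s m + s n) \<in> S"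
      using assms(1) s(1) by (simp add: subspace_add subspace_scale)
    from dle[OF this] have "d\<^sup>2 \<le> (norm (x - (1/2) *\<^sub>R (s m + s n)))\<^sup>2"
      using d0 by (intro power_mono) auto
    moreover have "(norm (s m - s n))\<^sup>2 = 2 * (norm (x - s m))\<^sup>2 + 2 * (norm (x - s n))\<^sup>2
        - 4 * (norm (x - (1/2) *\<^sub>R (s m + s n)))\<^sup>2"
      by (simp add: power2_norm_eq_inner inner_diff_left inner_diff_right inner_add_left
          inner_add_right inner_commute algebra_simps)
    ultimately show ?thesis using b[OF that(1)] b[OF that(2)] by linarith
  qed
  have "Cauchy s"
  proof (rule metric_CauchyI)
    fix e :: real assume e: "e > 0"
    obtain N where N: "4 * (2 * d + 1) / e\<^sup>2 < real N" using reals_Archimedean2 by blast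
    have "4 * (2 * d + 1) / e\<^sup>2 < real (Suc N)" using N by simp
    then have "4 * (2 * d + 1) < real (Suc N) * e\<^sup>2"
      using e by (subst (asm) pos_divide_less_eq) auto
    then have lt: "4 * ((2 * d + 1) * (1 / Suc N)) < e\<^sup>2"
      by (simp add: pos_divide_less_eq mult.commute del: of_nat_Suc)
    show "\<exists>M. \<forall>m\<ge>M. \<forall>n\<ge>M. dist (s m) (s n) < e"
    proof (intro exI allI impI)
      fix m n assume "m \<ge> N" "n \<ge> N"
      from sq[OF this] lt have "(norm (s m - s n))\<^sup>2 < e\<^sup>2" by linarith
      then show "dist (s m) (s n) < e" using e by (simp add: dist_norm power_less_imp_less_base)
    qed
  qed
  then obtain p where p: "s \<longlonglongrightarrow> p" using Cauchy_convergent convergent_def by blast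
  have pS: "p \<in> S" using assms(2) s(1) p closed_sequentially by blast
  have np: "norm (x - p) \<le> d"
  proof (rule LIMSEQ_le)
    show "(\<lambda>n. norm (x - s n)) \<longlonglongrightarrow> norm (x - p)" by (intro tendsto_intros p)
    show "(\<lambda>n. d + 1 / Suc n) \<longlonglongrightarrow> d"
      using tendsto_add[OF tendsto_const lim_inverse_n', of d] LIMSEQ_Suc by fastforce
    show "\<exists>N. \<forall>n\<ge>N. norm (x - s n) \<le> d + 1 / Suc n" using s(2) less_imp_le by blast
  qed
  have "(x - p) \<bullet> y = 0" if y: "y \<in> S" for y
  proof (cases "y = 0")
    case False
    \<comment> \<open>Minimizer over \<open>t\<close> of the norm of
      \<open>x - p - t *\<^sub>R y\<close>; a nonzero inner product with \<open>y\<close> would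
      bring a point of \<open>S\<close> closer to \<open>x\<close> than \<open>p\<close>.\<close>
    define t where "t = ((x - p) \<bullet> y) / (y \<bullet> y)"
    have "p + t *\<^sub>R y \<in> S" using assms(1) pS y by (simp add: subspace_add subspace_scale)
    from dle[OF this] np have "norm (x - p) \<le> norm (x - (p + t *\<^sub>R y))" by linarith
    then have "(x - p) \<bullet> (x - p) \<le> (x - p - t *\<^sub>R y) \<bullet> (x - p - t *\<^sub>R y)"
      by (simp add: norm_le diff_diff_eq)
    also have "\<dots> = (x - p) \<bullet> (x - p) - 2 * t * ((x - p) \<bullet> y) + t * t * (y \<bullet> y)"
      by (simp add: inner_diff_left inner_diff_right inner_commute algebra_simps)
    also have "t * t * (y \<bullet> y) = t * ((x - p) \<bullet> y)" using False by (simp add: t_def)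
    finally have "t * ((x - p) \<bullet> y) \<le> 0" by linarith
    then have "((x - p) \<bullet> y)\<^sup>2 / (y \<bullet> y) \<le> 0" by (simp add: t_def power2_eq_square)
    then have "((x - p) \<bullet> y)\<^sup>2 \<le> 0" using False
      by (simp add: divide_le_0_iff inner_gt_zero_iff) (smt (verit) inner_gt_zero_iff)
    then show ?thesis by simp
  qed auto
  with pS that show ?thesis by blast
qed

text \<open>For nonzero \<open>\<phi>\<close> the kernel is a closed hyperplane; the residual
  \<open>u\<close> of a vector outside it is orthogonal to it and, suitably scaled, represents
  \<open>\<phi>\<close>.\<close>

lemma riesz_representation:
  fixes \<phi> :: "'a::{real_inner,banach} \<Rightarrow> real"
  assumes "bounded_linear \<phi>"
  obtains w where "\<And>x. \<phi> x = w \<bullet> x"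
proof (cases "\<forall>x. \<phi> x = 0")
  case True
  then show ?thesis using that[of 0] by simp
next
  case False
  then obtain z where z: "\<phi> z \<noteq> 0" by blast
  interpret bounded_linear \<phi> by fact
  have sub: "subspace {x. \<phi> x = 0}" unfolding subspace_def by (simp add: add scaleR zero)
  have clo: "closed {x. \<phi> x = 0}"
    using closed_Collect_eq[of \<phi> "\<lambda>_. 0"] linear_continuous_on[OF assms, of UNIV] by simp
  obtain p where p: "\<phi> p = 0" "\<And>y. \<phi> y = 0 \<Longrightarrow> (z - p) \<bullet> y = 0"
    by (rule closed_subspace_projection[OF sub clo, of z]) simp
  define u where "u = z - p"
  have u: "\<phi> u \<noteq> 0" "u \<noteq> 0"
  proof -
    show "\<phi> u \<noteq> 0" using z p(1) by (simp add: u_def diff)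
    then show "u \<noteq> 0" using zero by auto
  qed
  have "\<phi> x = ((\<phi> u / (u \<bullet> u)) *\<^sub>R u) \<bullet> x" for x
  proof -
    have "u \<bullet> (x - (\<phi> x / \<phi> u) *\<^sub>R u) = 0"
      using u by (intro p(2)[folded u_def]) (simp add: diff scaleR)
    then have "u \<bullet> x = (\<phi> x / \<phi> u) * (u \<bullet> u)" by (simp add: inner_diff_right)
    then show ?thesis using u by (simp add: inner_gt_zero_iff)
  qed
  then show ?thesis using that by blast
qed

text \<open>Gliding hump: each step moves by a third of the previous step, in the direction that keeps
  the current functional large, so the limit still sees every one of the unbounded functionals.\<close>

lemma weakly_bounded_imp_bounded:
  fixes X :: "'a::{real_inner,banach} set"
  assumes wb: "\<And>g. \<exists>K. \<forall>x\<in>X. \<bar>x \<bullet> g\<bar> \<le> K"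
  shows "bounded X"
proof (rule ccontr)
  assume "\<not> bounded X"
  \<comment> \<open>The growth \<open>4 ^ n\<close> beats the shrinking steps
    \<open>(1/3) ^ n\<close>: the product still diverges like \<open>(4/3) ^ n\<close>.\<close>
  then have "\<exists>x\<in>X. norm x > 4 ^ n" for n :: nat
    unfolding bounded_iff by (meson not_le)
  then obtain x where xX: "\<And>n. x n \<in> X" and xn: "\<And>n::nat. norm (x n) > 4 ^ n" by metis
  have x0: "norm (x n) > 0" for n using xn[of n] by (smt (verit) zero_le_power)
  have "\<exists>y'. norm (y' - y) \<le> (1/3) ^ n \<and> \<bar>x n \<bullet> y'\<bar> \<ge> (1/3) ^ n * norm (x n)" for y n
  proof -
    define v where "v = ((1/3) ^ n / norm (x n)) *\<^sub>R x n"
    have v: "x n \<bullet> v = (1/3) ^ n * norm (x n)" "norm v = (1/3) ^ n"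
      using x0[of n] by (auto simp: v_def norm_eq_sqrt_inner[symmetric] power2_norm_eq_inner[symmetric]
          power2_eq_square field_simps)
    \<comment> \<open>The two inner products differ by \<open>2 * (x n \<bullet> v)\<close>, so they
      cannot both be smaller than \<open>x n \<bullet> v\<close> in absolute value.\<close>
    have "\<bar>x n \<bullet> (y + v)\<bar> \<ge> x n \<bullet> v \<or> \<bar>x n \<bullet> (y - v)\<bar> \<ge> x n \<bullet> v"
      by (simp add: inner_add_right inner_diff_right) linarith
    then show ?thesis
      using v by (elim disjE) (rule exI[of _ "y + v"], simp, rule exI[of _ "y - v"], simp)
  qed
  note ex = this
  define F where "F n y = (SOME y'. norm (y' - y) \<le> (1/3) ^ n \<and> \<bar>x n \<bullet> y'\<bar> \<ge> (1/3) ^ n * norm (x n))"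
    for n y
  have F: "norm (F n y - y) \<le> (1/3) ^ n" "\<bar>x n \<bullet> F n y\<bar> \<ge> (1/3) ^ n * norm (x n)" for n y
    using someI_ex[OF ex[of y n]] unfolding F_def by blast+
  define y where "y = rec_nat 0 (\<lambda>n. F n)"
  have y0: "y 0 = 0" by (simp add: y_def)
  have ys: "y (Suc n) = F n (y n)" for n by (simp add: y_def)
  have step: "norm (y (Suc n) - y n) \<le> (1/3) ^ n" for n using F(1) ys by metis
  have sm: "summable (\<lambda>n. norm (y (Suc n) - y n))"
    by (rule summable_comparison_test'[of "\<lambda>n. (1/3::real) ^ n" 0]) (use step in auto)
  have "(\<lambda>n. \<Sum>k<n. y (Suc k) - y k) \<longlonglongrightarrow> (\<Sum>k. y (Suc k) - y k)"
    using summable_norm_cancel[OF sm] summable_LIMSEQ by blast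
  then have lim: "y \<longlonglongrightarrow> (\<Sum>k. y (Suc k) - y k)"
    by (simp only: sum_lessThan_telescope) (simp add: y0)
  define g where "g = (\<Sum>k. y (Suc k) - y k)"
  \<comment> \<open>All steps after \<open>y (Suc n)\<close> add up to at most
    \<open>(1/3) ^ n / 2\<close>, so they destroy no more than half of the value gained at step
    \<open>n\<close>.\<close>
  have yg: "norm (g - y (Suc n)) \<le> (1/3) ^ n / 2" for n
  proof -
    have "(\<lambda>m. y (m + Suc n)) \<longlonglongrightarrow> g" using lim unfolding g_def by (rule LIMSEQ_ignore_initial_segment)
    then have l: "(\<lambda>m. norm (y (m + Suc n) - y (Suc n))) \<longlonglongrightarrow> norm (g - y (Suc n))"
      by (intro tendsto_intros)
    have "norm (y (m + Suc n) - y (Suc n)) \<le> (1/3) ^ n / 2 - (1/3) ^ (m + n) / 2" for m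
    proof (induction m)
      case (Suc m)
      have "norm (y (Suc m + Suc n) - y (Suc n)) \<le>
        norm (y (Suc (m + Suc n)) - y (m + Suc n)) + norm (y (m + Suc n) - y (Suc n))"
        using norm_triangle_ineq[of "y (Suc (m + Suc n)) - y (m + Suc n)" "y (m + Suc n) - y (Suc n)"]
        by simp
      also have "\<dots> \<le> (1/3) ^ (m + Suc n) + ((1/3) ^ n / 2 - (1/3) ^ (m + n) / 2)"
        by (rule add_mono[OF step Suc.IH])
      also have "\<dots> = (1/3) ^ n / 2 - (1/3) ^ (Suc m + n) / 2" by (simp add: field_simps)
      finally show ?case .
    qed simp
    then have "norm (y (m + Suc n) - y (Suc n)) \<le> (1/3) ^ n / 2" for m
      by (smt (verit) divide_nonneg_nonneg zero_le_power)
    then show ?thesis using l LIMSEQ_le_const2 by blast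
  qed
  have big: "\<bar>x n \<bullet> g\<bar> \<ge> (4/3) ^ n / 2" for n
  proof -
    have "x n \<bullet> g = x n \<bullet> y (Suc n) + x n \<bullet> (g - y (Suc n))" by (simp add: inner_diff_right)
    moreover have "\<bar>x n \<bullet> (g - y (Suc n))\<bar> \<le> norm (x n) * ((1/3) ^ n / 2)"
      using Cauchy_Schwarz_ineq2[of "x n" "g - y (Suc n)"] mult_left_mono[OF yg[of n], of "norm (x n)"]
      by simp
    moreover have "\<bar>x n \<bullet> y (Suc n)\<bar> \<ge> (1/3) ^ n * norm (x n)" using F(2) ys by metis
    ultimately have "\<bar>x n \<bullet> g\<bar> \<ge> (1/3) ^ n / 2 * norm (x n)"
      by (simp only: mult.commute[of "norm (x n)"] times_divide_eq_left times_divide_eq_right)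
    moreover have "(1/3) ^ n / 2 * norm (x n) \<ge> (1/3) ^ n / 2 * 4 ^ n"
      using xn[of n] by (intro mult_left_mono) auto
    moreover have "(1/3) ^ n / 2 * 4 ^ n = (4/3 :: real) ^ n / 2"
      by (simp add: power_divide)
    ultimately show ?thesis by linarith
  qed
  obtain K where K: "\<forall>z\<in>X. \<bar>z \<bullet> g\<bar> \<le> K" using wb by blast
  obtain n where "2 * K < (4/3 :: real) ^ n" using real_arch_pow[of "4/3" "2*K"] by auto
  then show False using K xX[of n] big[of n] by fastforce
qed

lemma closure_of_subspace:
  fixes S :: "'a::real_normed_vector set"
  assumes "subspace S"
  shows "subspace (closure S)"
  unfolding subspace_def
proof (intro conjI ballI allI)
  show "0 \<in> closure S" using subspace_0[OF assms] closure_subset by blast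
  show "x + y \<in> closure S" if "x \<in> closure S" "y \<in> closure S" for x y
  proof -
    obtain f g where "\<And>n. f n \<in> S" "f \<longlonglongrightarrow> x" "\<And>n. g n \<in> S" "g \<longlonglongrightarrow> y"
      using \<open>x \<in> closure S\<close> \<open>y \<in> closure S\<close> unfolding closure_sequential by blast
    then show ?thesis
      unfolding closure_sequential
      by (intro exI[of _ "\<lambda>n. f n + g n"]) (auto intro: tendsto_add subspace_add[OF assms])
  qed
  show "c *\<^sub>R x \<in> closure S" if x: "x \<in> closure S" for c x
  proof -
    obtain f where "\<And>n. f n \<in> S" "f \<longlonglongrightarrow> x" using x unfolding closure_sequential by blast
    then show ?thesis
      unfolding closure_sequential
      by (intro exI[of _ "\<lambda>n. c *\<^sub>R f n"]) (auto intro: tendsto_scaleR subspace_scale[OF assms])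
  qed
qed

section \<open>Closed range, lower bounds, left inverses and surjective adjoints\<close>

text \<open>Duality takes the place of the open mapping theorem. If \<open>P g = U f\<close>, then
  \<open>P w \<bullet> g = f \<bullet> V w\<close>, so the projections \<open>P w\<close> with
  \<open>norm (V w) \<le> 1\<close> are weakly bounded, hence bounded. This gives \<open>\<bar>f
  \<bullet> V w\<bar> \<le> C * norm (U f) * norm (V w)\<close>. Injectivity of \<open>U\<close>
  makes the range of \<open>V\<close> dense, so \<open>V w\<close> may be replaced by
  \<open>f\<close>.\<close>

lemma closed_range_imp_bounded_below:
  fixes U V :: "'a::{real_inner,banach} \<Rightarrow> 'a"
  assumes U: "bounded_linear U" and V: "bounded_linear V"
    and adj: "\<And>x y. U x \<bullet> y = x \<bullet> V y" and inj: "inj U" and cl: "closed (range U)"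
  obtains C where "C > 0" "\<And>x. norm x \<le> C * norm (U x)"
proof -
  interpret U: bounded_linear U by fact
  interpret V: bounded_linear V by fact
  have sub: "subspace (range U)" using U.linear subspace_UNIV linear_subspace_image by blast
  have "\<exists>p. p \<in> range U \<and> (\<forall>z. (w - p) \<bullet> U z = 0)" for w
    using closed_subspace_projection[OF sub cl, of w] by (metis rangeI)
  then obtain P where P: "\<And>w. P w \<in> range U" "\<And>w z. (w - P w) \<bullet> U z = 0" by metis
  have "bounded (P ` {w. norm (V w) \<le> 1})"
  proof (rule weakly_bounded_imp_bounded)
    fix g
    obtain f where f: "P g = U f" using P(1) by blast
    have "\<bar>P w \<bullet> g\<bar> \<le> norm f" if w: "norm (V w) \<le> 1" for w
    proof -
      obtain k where k: "P w = U k" using P(1) by blast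
      have "P w \<bullet> g = P w \<bullet> P g" using P(2)[of g k] by (simp add: k inner_diff_left inner_commute[of "U k"])
      also have "\<dots> = w \<bullet> U f" using P(2)[of w f] by (simp add: f inner_diff_left)
      also have "\<dots> = f \<bullet> V w" by (metis adj inner_commute)
      also have "\<bar>\<dots>\<bar> \<le> norm f * norm (V w)" by (rule Cauchy_Schwarz_ineq2)
      also have "\<dots> \<le> norm f" using w by (simp add: mult_left_le)
      finally show ?thesis .
    qed
    then show "\<exists>K. \<forall>x\<in>P ` {w. norm (V w) \<le> 1}. \<bar>x \<bullet> g\<bar> \<le> K" by auto
  qed
  then obtain C where C: "C > 0" "\<And>w. norm (V w) \<le> 1 \<Longrightarrow> norm (P w) \<le> C"
    unfolding bounded_pos by auto
  have key: "\<bar>f \<bullet> V w\<bar> \<le> C * norm (U f) * norm (V w)" for f w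
  proof -
    have UP: "U f \<bullet> w = U f \<bullet> P w" for w using P(2)[of w f] by (simp add: inner_diff_left inner_commute[of "U f"])
    show ?thesis
    proof (cases "V w = 0")
      case False
      define w' where "w' = (1 / norm (V w)) *\<^sub>R w"
      have "norm (V w') \<le> 1" using False by (simp add: w'_def V.scaleR)
      from C(2)[OF this] have "\<bar>U f \<bullet> w'\<bar> \<le> norm (U f) * C"
        using Cauchy_Schwarz_ineq2[of "U f" "P w'"] mult_left_mono[OF _ norm_ge_zero, of "norm (P w')" C "U f"]
        unfolding UP[of w'] by linarith
      moreover have "f \<bullet> V w = norm (V w) * (U f \<bullet> w')" using False by (simp add: w'_def adj)
      ultimately have "\<bar>f \<bullet> V w\<bar> \<le> norm (V w) * (norm (U f) * C)"
        by (simp only: abs_mult abs_norm_cancel) (intro mult_left_mono; simp)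
      then show ?thesis by (simp only: mult_ac)
    qed simp
  qed
  define R where "R = closure (range V)"
  have subR: "subspace R" unfolding R_def
    by (intro closure_of_subspace linear_subspace_image V.linear subspace_UNIV)
  \<comment> \<open>A vector \<open>v\<close> orthogonal to the range of \<open>V\<close> is killed
    by \<open>U\<close>, since \<open>U v \<bullet> U v = v \<bullet> V (U v)\<close>.\<close>
  have RU: "R = UNIV"
  proof (rule ccontr)
    assume "R \<noteq> UNIV"
    then obtain x where x: "x \<notin> R" by blast
    obtain p where p: "p \<in> R" "\<And>y. y \<in> R \<Longrightarrow> (x - p) \<bullet> y = 0"
      using closed_subspace_projection[OF subR, of x] unfolding R_def by (metis closed_closure)
    have "U (x - p) \<bullet> U (x - p) = 0"
      unfolding adj[of "x - p"] using closure_subset[of "range V"] by (intro p(2)) (auto simp: R_def)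
    then have "U (x - p) = U 0" by (simp add: U.zero)
    then have "x - p = 0" using inj by (simp only: inj_eq)
    then show False using x p by simp
  qed
  have "norm f \<le> C * norm (U f)" for f
  proof -
    have "range V \<subseteq> {v. \<bar>f \<bullet> v\<bar> \<le> C * norm (U f) * norm v}" using key by auto
    moreover have "closed {v. \<bar>f \<bullet> v\<bar> \<le> C * norm (U f) * norm v}"
      by (intro closed_Collect_le continuous_intros)
    ultimately have "R \<subseteq> {v. \<bar>f \<bullet> v\<bar> \<le> C * norm (U f) * norm v}"
      unfolding R_def by (rule closure_minimal)
    then have "\<bar>f \<bullet> v\<bar> \<le> C * norm (U f) * norm v" for v unfolding RU by blast
    from this[of f] have "norm f * norm f \<le> (C * norm (U f)) * norm f"
      by (simp add: power2_norm_eq_inner[symmetric] power2_eq_square)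
    then show ?thesis using C(1) by (cases "f = 0") auto
  qed
  with C(1) that show ?thesis by blast
qed

text \<open>If \<open>g = V w\<close>, then \<open>x \<bullet> g = U x \<bullet> w\<close> is at
  most \<open>norm w\<close> on the preimage of the unit ball under \<open>U\<close>. Surjectivity
  provides such a \<open>w\<close> for every \<open>g\<close>, so this preimage is weakly bounded,
  hence bounded.\<close>

lemma surj_adjoint_imp_bounded_below:
  fixes U V :: "'a::{real_inner,banach} \<Rightarrow> 'a"
  assumes U: "bounded_linear U"
    and adj: "\<And>x y. U x \<bullet> y = x \<bullet> V y" and surj: "surj V"
  obtains C where "C > 0" "\<And>x. norm x \<le> C * norm (U x)"
proof -
  interpret U: bounded_linear U by fact
  have "bounded {x. norm (U x) \<le> 1}"
  proof (rule weakly_bounded_imp_bounded)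
    fix g
    obtain w where w: "g = V w" using surj by (metis surjD)
    have "\<bar>x \<bullet> g\<bar> \<le> norm w" if "norm (U x) \<le> 1" for x
    proof -
      have "\<bar>x \<bullet> g\<bar> \<le> norm (U x) * norm w"
        unfolding w adj[symmetric] by (rule Cauchy_Schwarz_ineq2)
      also have "\<dots> \<le> norm w" using that by (simp add: mult_left_le_one_le)
      finally show ?thesis .
    qed
    then show "\<exists>K. \<forall>x\<in>{x. norm (U x) \<le> 1}. \<bar>x \<bullet> g\<bar> \<le> K" by blast
  qed
  then obtain C where C: "C > 0" "\<And>x. norm (U x) \<le> 1 \<Longrightarrow> norm x \<le> C"
    unfolding bounded_pos by auto
  \<comment> \<open>A nonzero kernel vector could be scaled to length \<open>C + 1\<close> without
    leaving the preimage of the unit ball.\<close>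
  have U0: "x = 0" if "U x = 0" for x
  proof (rule ccontr)
    assume x: "x \<noteq> 0"
    have "norm (((C + 1) / norm x) *\<^sub>R x) \<le> C" using that by (intro C(2)) (simp add: U.scaleR)
    then show False using x C(1) by simp
  qed
  have "norm x \<le> C * norm (U x)" for x
  proof (cases "U x = 0")
    case False
    have "norm ((1 / norm (U x)) *\<^sub>R x) \<le> C" using False by (intro C(2)) (simp add: U.scaleR)
    then show ?thesis using False by (simp add: field_simps)
  qed (use U0 in simp)
  with C(1) that show ?thesis by blast
qed

lemma bounded_below_imp_closed_range:
  fixes U :: "'a::{real_inner,banach} \<Rightarrow> 'a"
  assumes U: "bounded_linear U" and C: "C > 0" "\<And>x. norm x \<le> C * norm (U x)"
  shows "closed (range U)"
  using C by (intro complete_imp_closed complete_isometric_image[of "1 / C"] U complete_UNIV)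
    (auto simp: field_simps)

text \<open>\<open>S y\<close> is the least-squares solution of \<open>U x = y\<close>:
  \<open>U (S y)\<close> is the orthogonal projection of \<open>y\<close> onto the range. The
  orthogonality relation is exported because it determines \<open>S y\<close>, which later yields
  complex linearity of \<open>S\<close>.\<close>

lemma bounded_below_imp_left_inverse:
  fixes U :: "'a::{real_inner,banach} \<Rightarrow> 'a"
  assumes U: "bounded_linear U" and C: "C > 0" "\<And>x. norm x \<le> C * norm (U x)"
  obtains S where "bounded_linear S" "\<And>x. S (U x) = x"
    "\<And>y z. (y - U (S y)) \<bullet> U z = 0"
proof -
  interpret U: bounded_linear U by fact
  have sub: "subspace (range U)" using U.linear subspace_UNIV linear_subspace_image by blast
  have cl: "closed (range U)" by (rule bounded_below_imp_closed_range[OF U C])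
  have "\<exists>x. \<forall>z. (y - U x) \<bullet> U z = 0" for y
    using closed_subspace_projection[OF sub cl, of y] by (metis imageE rangeI)
  then obtain S where S: "\<And>y z. (y - U (S y)) \<bullet> U z = 0" by metis
  have uniq: "S y = x" if x: "\<And>z. (y - U x) \<bullet> U z = 0" for y x
  proof -
    have "U (S y - x) \<bullet> U (S y - x) = 0"
      using S[of y "S y - x"] x[of "S y - x"] by (simp add: U.diff inner_diff_left)
    then show ?thesis using C(2)[of "S y - x"] by simp
  qed
  have SU: "S (U x) = x" for x by (rule uniq) simp
  have "bounded_linear S"
  proof (rule bounded_linear_intro)
    show "S (x + y) = S x + S y" for x y
    proof (rule uniq)
      show "(x + y - U (S x + S y)) \<bullet> U z = 0" for z
        using S[of x z] S[of y z] by (simp add: U.add inner_diff_left inner_add_left)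
    qed
    show "S (r *\<^sub>R x) = r *\<^sub>R S x" for r x
    proof (rule uniq)
      show "(r *\<^sub>R x - U (r *\<^sub>R S x)) \<bullet> U z = 0" for z
        using S[of x z] by (simp add: U.scaleR inner_diff_left)
    qed
    show "norm (S y) \<le> norm y * C" for y
    proof -
      have "U (S y) \<bullet> U (S y) = y \<bullet> U (S y)" using S[of y "S y"] by (simp add: inner_diff_left)
      then have "norm (U (S y)) * norm (U (S y)) \<le> norm y * norm (U (S y))"
        using norm_cauchy_schwarz[of y "U (S y)"]
        by (simp add: power2_norm_eq_inner[symmetric] power2_eq_square)
      then have "norm (U (S y)) \<le> norm y" by (cases "U (S y) = 0") auto
      then show ?thesis using C(2)[of "S y"] C(1)
        by (smt (verit) mult.commute mult_left_mono)
    qed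
  qed
  then show ?thesis using SU S by (rule that)
qed

text \<open>The vector \<open>w\<close> representing \<open>x \<mapsto> g \<bullet> S x\<close>
  solves \<open>V w = g\<close>, because \<open>x \<bullet> V w = U x \<bullet> w = g \<bullet> S (U
  x) = g \<bullet> x\<close>.\<close>

lemma left_inverse_imp_surj_adjoint:
  fixes U V S :: "'a::{real_inner,banach} \<Rightarrow> 'a"
  assumes S: "bounded_linear S" "\<And>x. S (U x) = x"
    and adj: "\<And>x y. U x \<bullet> y = x \<bullet> V y"
  shows "surj V"
proof -
  have "\<exists>w. V w = g" for g
  proof -
    have "bounded_linear (\<lambda>x. g \<bullet> S x)"
      using bounded_linear_compose[OF bounded_linear_inner_right S(1)] by blast
    then obtain w where w: "\<And>x. g \<bullet> S x = w \<bullet> x" using riesz_representation by blast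
    have "x \<bullet> (V w - g) = 0" for x
      using w[of "U x"] adj[of x w] by (simp add: S(2) inner_diff_right inner_commute)
    from this[of "V w - g"] show ?thesis by auto
  qed
  then show ?thesis unfolding surj_def by metis
qed

section \<open>Fourier and Poisson formulas on the circle\<close>

lemma space_circle_measure [simp]: "space circle_measure = sphere 0 1"
  by (simp add: circle_measure_def space_restrict_space)

lemma sets_circle_measure [measurable_cong]:
  "sets circle_measure = sets (restrict_space borel (sphere 0 1))"
  by (simp add: circle_measure_def)

lemma cis_measurable_circle:
  "cis \<in> measurable (uniform_measure lborel {0..2*pi}) (restrict_space borel (sphere 0 1))"
proof (rule measurable_restrict_space2)
  have "cis \<in> borel_measurable borel"
    by (auto intro!: borel_measurable_continuous_onI continuous_intros)
  then show "cis \<in> borel_measurable (uniform_measure lborel {0..2*pi})"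
    by (simp cong: measurable_cong_sets add: sets_circle_measure)
qed auto

lemma sets_circle_measure_iff: "A \<in> sets circle_measure \<longleftrightarrow> A \<in> sets borel \<and> A \<subseteq> sphere 0 1"
  unfolding sets_circle_measure
  by (subst sets_restrict_space_iff) auto

lemma emeasure_circle_measure:
  assumes "A \<in> sets circle_measure"
  shows "emeasure circle_measure A = emeasure lborel ({0..2*pi} \<inter> cis -` A) / ennreal (2 * pi)"
proof -
  have cb: "cis \<in> borel_measurable borel"
    by (auto intro!: borel_measurable_continuous_onI continuous_intros)
  have "A \<in> sets borel" using assms sets_circle_measure_iff by blast
  from measurable_sets[OF cb this] have "cis -` A \<in> sets borel" by simp
  then show ?thesis
    unfolding circle_measure_def using assms
    by (subst emeasure_distr[OF cis_measurable_circle]) (simp_all add: sets_circle_measure)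
qed

lemma prob_space_circle_measure: "prob_space circle_measure"
  unfolding circle_measure_def
  by (intro prob_space.prob_space_distr cis_measurable_circle prob_space_uniform_measure) auto

interpretation circle: prob_space circle_measure
  by (rule prob_space_circle_measure)

lemma borel_measurable_circle:
  "f \<in> borel_measurable borel \<Longrightarrow> f \<in> borel_measurable circle_measure"
  by (simp add: measurable_restrict_space1 sets_circle_measure cong: measurable_cong_sets)

lemma borel_measurable_circle_id [measurable]: "(\<lambda>\<zeta>. \<zeta>) \<in> borel_measurable circle_measure"
  by (rule borel_measurable_circle) simp

lemma borel_measurable_circle_continuous:
  fixes f :: "complex \<Rightarrow> 'a::topological_space"
  assumes "continuous_on (sphere 0 1) f"
  shows "f \<in> borel_measurable circle_measure"
  using borel_measurable_continuous_on_restrict[OF assms]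
  by (simp cong: measurable_cong_sets add: sets_circle_measure)

lemma integrable_circle_bounded:
  fixes f :: "complex \<Rightarrow> 'a::{banach,second_countable_topology}"
  assumes "f \<in> borel_measurable circle_measure" "\<And>\<zeta>. cmod \<zeta> = 1 \<Longrightarrow> norm (f \<zeta>) \<le> B"
  shows "integrable circle_measure f"
  using assms by (intro circle.integrable_const_bound[of _ B] AE_I2) auto

lemma integrable_circle_continuous:
  fixes f :: "complex \<Rightarrow> 'a::{banach,second_countable_topology}"
  assumes "continuous_on (sphere 0 1) f"
  shows "integrable circle_measure f"
proof -
  have "compact (f ` sphere 0 1)" using assms by (intro compact_continuous_image) auto
  then have "bounded (f ` sphere 0 1)" by (rule compact_imp_bounded)
  then obtain B where "\<forall>x\<in>f ` sphere 0 1. norm x \<le> B" unfolding bounded_iff ..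
  then show ?thesis
    using borel_measurable_circle_continuous[OF assms]
    by (intro integrable_circle_bounded[of f B]) auto
qed

lemma integral_circle_measure:
  fixes f :: "complex \<Rightarrow> 'a::{banach,second_countable_topology}"
  assumes "f \<in> borel_measurable circle_measure"
  shows "integral\<^sup>L circle_measure f = (1 / (2*pi)) *\<^sub>R (\<integral>t. indicator {0..2*pi} t *\<^sub>R f (cis t) \<partial>lborel)"
proof -
  have fm: "f \<in> borel_measurable (restrict_space borel (sphere 0 1))"
    using assms by (simp cong: measurable_cong_sets add: sets_circle_measure)
  have um: "uniform_measure lborel {0..2*pi} =
      density lborel (\<lambda>t. ennreal (indicator {0..2*pi} t / (2 * pi)))"
    unfolding uniform_measure_def
    by (intro density_cong AE_I2)
       (auto simp: divide_ennreal[symmetric] split: split_indicator)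
  have fc: "(\<lambda>t. f (cis t)) \<in> borel_measurable lborel"
    using measurable_compose[OF cis_measurable_circle fm] by simp
  have "integral\<^sup>L circle_measure f = (\<integral>t. f (cis t) \<partial>uniform_measure lborel {0..2*pi})"
    unfolding circle_measure_def by (rule integral_distr[OF cis_measurable_circle fm])
  also have "\<dots> = (\<integral>t. (indicator {0..2*pi} t / (2 * pi)) *\<^sub>R f (cis t) \<partial>lborel)"
    unfolding um using fc by (intro integral_density) auto
  also have "\<dots> = (\<integral>t. (1 / (2*pi)) *\<^sub>R (indicator {0..2*pi} t *\<^sub>R f (cis t)) \<partial>lborel)"
    by (intro Bochner_Integration.integral_cong) auto
  also have "\<dots> = (1 / (2*pi)) *\<^sub>R (\<integral>t. indicator {0..2*pi} t *\<^sub>R f (cis t) \<partial>lborel)"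
    by (rule integral_scaleR_right)
  finally show ?thesis .
qed

lemma integral_circle_powi:
  fixes k :: int
  shows "(\<integral>\<zeta>. \<zeta> powi k \<partial>circle_measure) = (if k = 0 then 1 else 0)"
proof (cases "k = 0")
  case True
  then show ?thesis using circle.prob_space by simp
next
  case False
  have m: "(\<lambda>\<zeta>::complex. \<zeta> powi k) \<in> borel_measurable circle_measure"
    by (intro borel_measurable_circle_continuous continuous_intros) auto
  have "(\<integral>t. indicator {0..2*pi} t *\<^sub>R cis t powi k \<partial>lborel)
      = (\<integral>t. indicator {0..2*pi} t *\<^sub>R cis (of_int k * t) \<partial>lborel)"
    by (simp add: cis_power_int)
  also have "\<dots> = cis (of_int k * (2*pi)) / (\<i> * of_int k) - cis (of_int k * 0) / (\<i> * of_int k)"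
  proof (rule integral_FTC_atLeastAtMost)
    show "((\<lambda>t. cis (of_int k * t) / (\<i> * of_int k)) has_vector_derivative cis (of_int k * x))
        (at x within {0..2*pi})" for x
    proof -
      have "((\<lambda>t. exp (\<i> * of_int k * of_real t) / (\<i> * of_int k)) has_vector_derivative
          exp (\<i> * of_int k * of_real x)) (at x within {0..2*pi})"
        using False by (intro has_vector_derivative_real_field) (auto intro!: derivative_eq_intros)
      then show ?thesis by (simp add: cis_conv_exp mult_ac)
    qed
    show "continuous_on {0..2*pi} (\<lambda>x. cis (of_int k * x))" by (intro continuous_intros)
  qed simp
  also have "\<dots> = 0"
  proof -
    have "cis (of_int k * (2*pi)) = 1"
      using cis_multiple_2pi[of "of_int k"] by (simp add: mult.commute)
    then show ?thesis by simp
  qed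
  finally show ?thesis using False integral_circle_measure[OF m] by simp
qed

lemma cnj_eq_powi:
  assumes "cmod \<zeta> = 1"
  shows "cnj \<zeta> ^ j = \<zeta> powi (- int j)"
proof -
  have "\<zeta> * cnj \<zeta> = 1" using assms by (simp add: complex_norm_square[symmetric])
  then have "cnj \<zeta> = inverse \<zeta>" by (simp add: inverse_unique)
  then show ?thesis by (simp add: power_int_minus power_inverse)
qed

lemma integral_circle_monomials:
  "(\<integral>\<zeta>. \<zeta> ^ k * cnj \<zeta> ^ j \<partial>circle_measure) = (if k = j then 1 else 0)"
proof -
  have "(\<integral>\<zeta>. \<zeta> ^ k * cnj \<zeta> ^ j \<partial>circle_measure) = (\<integral>\<zeta>. \<zeta> powi (int k - int j) \<partial>circle_measure)"
  proof (rule Bochner_Integration.integral_cong)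
    fix \<zeta> assume "\<zeta> \<in> space circle_measure"
    then have "cmod \<zeta> = 1" "\<zeta> \<noteq> 0" by auto
    then show "\<zeta> ^ k * cnj \<zeta> ^ j = \<zeta> powi (int k - int j)"
      using power_int_add[of \<zeta> "int k" "- int j"] by (simp add: cnj_eq_powi)
  qed simp
  then show ?thesis by (simp add: integral_circle_powi)
qed

text \<open>Common source of the coefficient formula, Parseval's identity and the Cauchy formula. On
  the circle the terms are dominated by \<open>cmod (a n) * cmod (g \<zeta>)\<close>, so sum and
  integral may be exchanged. Mere integrability of \<open>g\<close> lets the Herglotz integral be
  treated in the same way.\<close>

lemma circle_series_integral:
  fixes a :: "nat \<Rightarrow> complex"
  assumes f: "\<And>\<zeta>. cmod \<zeta> = 1 \<Longrightarrow> (\<lambda>n. a n * \<zeta> ^ n) sums f \<zeta>"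
    and a: "summable (\<lambda>n. cmod (a n))" and g: "integrable circle_measure g"
  shows "(\<lambda>n. a n * (\<integral>\<zeta>. \<zeta> ^ n * g \<zeta> \<partial>circle_measure)) sums (\<integral>\<zeta>. f \<zeta> * g \<zeta> \<partial>circle_measure)"
proof -
  have gm [measurable]: "g \<in> borel_measurable circle_measure" using g by auto
  have ig: "integrable circle_measure (\<lambda>\<zeta>. a n * \<zeta> ^ n * g \<zeta>)" for n
    by (intro Bochner_Integration.integrable_bound[OF integrable_mult_right[OF g, of "a n"]] AE_I2)
      (auto simp: norm_mult norm_power)
  have no: "(\<integral>\<zeta>. cmod (a n * \<zeta> ^ n * g \<zeta>) \<partial>circle_measure) = cmod (a n) * (\<integral>\<zeta>. cmod (g \<zeta>) \<partial>circle_measure)" for n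
  proof -
    have "(\<integral>\<zeta>. cmod (a n * \<zeta> ^ n * g \<zeta>) \<partial>circle_measure) = (\<integral>\<zeta>. cmod (a n) * cmod (g \<zeta>) \<partial>circle_measure)"
      by (intro Bochner_Integration.integral_cong) (auto simp: norm_mult norm_power)
    then show ?thesis by simp
  qed
  have "(\<lambda>n. \<integral>\<zeta>. a n * \<zeta> ^ n * g \<zeta> \<partial>circle_measure) sums
      (\<integral>\<zeta>. (\<Sum>n. a n * \<zeta> ^ n * g \<zeta>) \<partial>circle_measure)"
  proof (rule sums_integral[OF ig])
    show "AE \<zeta> in circle_measure. summable (\<lambda>n. cmod (a n * \<zeta> ^ n * g \<zeta>))"
      using a by (intro AE_I2) (auto simp: norm_mult norm_power intro: summable_mult2)
    show "summable (\<lambda>n. \<integral>\<zeta>. cmod (a n * \<zeta> ^ n * g \<zeta>) \<partial>circle_measure)"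
      unfolding no using a by (rule summable_mult2)
  qed
  moreover have "(\<integral>\<zeta>. (\<Sum>n. a n * \<zeta> ^ n * g \<zeta>) \<partial>circle_measure) = (\<integral>\<zeta>. f \<zeta> * g \<zeta> \<partial>circle_measure)"
    using f by (intro Bochner_Integration.integral_cong) (auto intro!: sums_unique[symmetric] sums_mult2)
  ultimately show ?thesis by (simp add: mult.assoc)
qed

lemma circle_coefficient:
  assumes f: "\<And>\<zeta>. cmod \<zeta> = 1 \<Longrightarrow> (\<lambda>n. a n * \<zeta> ^ n) sums f \<zeta>"
    and a: "summable (\<lambda>n. cmod (a n))"
  shows "(\<integral>\<zeta>. f \<zeta> * cnj \<zeta> ^ j \<partial>circle_measure) = a j"
proof -
  have "integrable circle_measure (\<lambda>\<zeta>. cnj \<zeta> ^ j)"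
    by (intro integrable_circle_continuous continuous_intros)
  from circle_series_integral[OF f a this]
  have "(\<lambda>n. if n = j then a n else 0) sums (\<integral>\<zeta>. f \<zeta> * cnj \<zeta> ^ j \<partial>circle_measure)"
    by (simp add: integral_circle_monomials if_distrib cong: if_cong)
  moreover have "(\<lambda>n. if n = j then a n else 0) sums a j" using sums_single[of j a] by simp
  ultimately show ?thesis by (rule sums_unique2)
qed

text \<open>Only \<open>f\<close> is expanded; the integrals of powers against the conjugate of
  \<open>h\<close> are the conjugated coefficients of \<open>h\<close>.\<close>

lemma circle_parseval:
  assumes f: "\<And>\<zeta>. cmod \<zeta> = 1 \<Longrightarrow> (\<lambda>n. a n * \<zeta> ^ n) sums f \<zeta>"
    and a: "summable (\<lambda>n. cmod (a n))"
    and h: "\<And>\<zeta>. cmod \<zeta> = 1 \<Longrightarrow> (\<lambda>n. b n * \<zeta> ^ n) sums h \<zeta>"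
    and b: "summable (\<lambda>n. cmod (b n))" and hm: "integrable circle_measure h"
  shows "(\<lambda>n. a n * cnj (b n)) sums (\<integral>\<zeta>. f \<zeta> * cnj (h \<zeta>) \<partial>circle_measure)"
proof -
  have "(\<integral>\<zeta>. \<zeta> ^ n * cnj (h \<zeta>) \<partial>circle_measure) = cnj (b n)" for n
  proof -
    have "(\<integral>\<zeta>. \<zeta> ^ n * cnj (h \<zeta>) \<partial>circle_measure) = (\<integral>\<zeta>. cnj (h \<zeta> * cnj \<zeta> ^ n) \<partial>circle_measure)"
      by (simp add: mult.commute)
    also have "\<dots> = cnj (b n)" by (simp only: Bochner_Integration.integral_cnj circle_coefficient[OF h b])
    finally show ?thesis .
  qed
  then show ?thesis using circle_series_integral[OF f a, of "\<lambda>\<zeta>. cnj (h \<zeta>)"] hm by simp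
qed

section \<open>Cauchy and Poisson formulas from power series\<close>

lemma holomorphic_power_series_circle:
  assumes f: "f holomorphic_on ball 0 R" and R: "1 < R"
  obtains a where "\<And>z. cmod z \<le> 1 \<Longrightarrow> (\<lambda>n. a n * z ^ n) sums f z" "summable (\<lambda>n. cmod (a n))"
proof -
  define a where "a n = (deriv ^^ n) f 0 / fact n" for n
  have s: "(\<lambda>n. a n * z ^ n) sums f z" if "z \<in> ball 0 R" for z
    using holomorphic_power_series[OF f that] by (simp add: a_def)
  \<comment> \<open>Convergence at a point of modulus above 1 forces absolute convergence on the
    closed unit disk.\<close>
  obtain r where r: "1 < r" "r < R" using R dense by blast
  have "summable (\<lambda>n. a n * of_real r ^ n)" using s[of "of_real r"] r sums_summable by auto
  from powser_insidea[OF this, of 1] r have "summable (\<lambda>n. cmod (a n))" by simp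
  moreover have "(\<lambda>n. a n * z ^ n) sums f z" if "cmod z \<le> 1" for z using that R by (intro s) auto
  ultimately show ?thesis using that by blast
qed

text \<open>Parseval's identity for \<open>f\<close> and the kernel
  \<open>1 / (1 - cnj z * \<zeta>)\<close>, whose coefficients are \<open>cnj z ^ n\<close>, returns
  the power series of \<open>f\<close> at \<open>z\<close>.\<close>

lemma cauchy_formula_circle:
  assumes f: "f holomorphic_on ball 0 R" and R: "1 < R" and z: "cmod z < 1"
  shows "(\<integral>\<zeta>. f \<zeta> / (1 - z * cnj \<zeta>) \<partial>circle_measure) = f z"
proof -
  obtain a where a: "\<And>z. cmod z \<le> 1 \<Longrightarrow> (\<lambda>n. a n * z ^ n) sums f z" "summable (\<lambda>n. cmod (a n))"
    using holomorphic_power_series_circle[OF f R] by blast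
  have fi: "integrable circle_measure f"
    using R by (intro integrable_circle_continuous holomorphic_on_imp_continuous_on
        holomorphic_on_subset[OF f]) auto
  have k: "(\<lambda>n. cnj z ^ n * \<zeta> ^ n) sums (1 / (1 - cnj z * \<zeta>))" if "cmod \<zeta> = 1" for \<zeta>
    using geometric_sums[of "cnj z * \<zeta>"] z that by (simp add: norm_mult power_mult_distrib)
  have ks: "summable (\<lambda>n. cmod (cnj z ^ n))" using z by (simp add: norm_power)
  have ki: "integrable circle_measure (\<lambda>\<zeta>. 1 / (1 - cnj z * \<zeta>))"
  proof (intro integrable_circle_continuous continuous_intros ballI)
    fix x :: complex assume x: "x \<in> sphere 0 1"
    have "cmod (cnj z * x) < 1" using x z by (simp add: norm_mult)
    then show "1 - cnj z * x \<noteq> 0" by auto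
  qed
  have "(\<lambda>n. a n * cnj (cnj z ^ n)) sums (\<integral>\<zeta>. f \<zeta> * cnj (1 / (1 - cnj z * \<zeta>)) \<partial>circle_measure)"
    using a by (intro circle_parseval[OF _ _ k ks ki]) auto
  then have "(\<lambda>n. a n * z ^ n) sums (\<integral>\<zeta>. f \<zeta> / (1 - z * cnj \<zeta>) \<partial>circle_measure)" by simp
  moreover have "(\<lambda>n. a n * z ^ n) sums f z" using a z by simp
  ultimately show ?thesis by (rule sums_unique2[symmetric, THEN sym])
qed

lemma one_minus_cnj_mult_nonzero:
  assumes "cmod z < 1" "cmod w \<le> 1" shows "1 - cnj z * w \<noteq> 0" "1 - z * cnj w \<noteq> 0"
proof -
  have "cmod z * cmod w \<le> cmod z" using assms by (simp add: mult_left_le)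
  then have "cmod (cnj z * w) < 1" "cmod (z * cnj w) < 1" using assms by (simp_all add: norm_mult)
  then show "1 - cnj z * w \<noteq> 0" "1 - z * cnj w \<noteq> 0" by auto
qed

text \<open>The Poisson formula is the Cauchy formula for \<open>w \<mapsto> f w / (1 - cnj z * w)\<close>.\<close>

lemma poisson_formula_circle:
  assumes f: "f holomorphic_on ball 0 R" and R: "1 < R" and z: "cmod z < 1"
  shows "f z = (\<integral>\<zeta>. f \<zeta> * of_real ((1 - (cmod z)\<^sup>2) / (cmod (1 - cnj z * \<zeta>))\<^sup>2) \<partial>circle_measure)"
proof -
  \<comment> \<open>The function \<open>F\<close> defined next has a possible pole at
    \<open>1 / cnj z\<close>; the radius is reduced so that this point stays outside the disk while
    the closed unit disk stays inside.\<close>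
  obtain R' where R': "1 < R'" "R' \<le> R" "cmod z * R' < 1"
  proof (cases "z = 0")
    case True
    then show ?thesis using that[of R] R by simp
  next
    case False
    then have "1 < min R (1 / cmod z)" using z R by simp
    then obtain r where "1 < r" "r < min R (1 / cmod z)" using dense by blast
    then show ?thesis using that[of r] False by (simp add: field_simps)
  qed
  define F where "F w = f w / (1 - cnj z * w)" for w
  have "1 - cnj z * w \<noteq> 0" if "w \<in> ball 0 R'" for w
  proof -
    have "cmod (cnj z * w) \<le> cmod z * R'"
      using that by (simp add: norm_mult mult_left_mono)
    then have "cmod (cnj z * w) < 1" using R'(3) by linarith
    then show ?thesis by auto
  qed
  then have "F holomorphic_on ball 0 R'"
    unfolding F_def using R' by (intro holomorphic_intros holomorphic_on_subset[OF f]) auto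
  from cauchy_formula_circle[OF this R'(1) z]
  have "f z / (1 - cnj z * z) = (\<integral>\<zeta>. F \<zeta> / (1 - z * cnj \<zeta>) \<partial>circle_measure)"
    by (simp add: F_def)
  moreover have "1 - cnj z * z = of_real (1 - (cmod z)\<^sup>2)"
    by (simp add: complex_norm_square[symmetric] mult.commute)
  moreover have "1 - cnj z * z \<noteq> 0" using one_minus_cnj_mult_nonzero[OF z, of z] z by simp
  ultimately have "f z = of_real (1 - (cmod z)\<^sup>2) * (\<integral>\<zeta>. F \<zeta> / (1 - z * cnj \<zeta>) \<partial>circle_measure)"
    by (simp add: field_simps)
  also have "\<dots> = (\<integral>\<zeta>. of_real (1 - (cmod z)\<^sup>2) * (F \<zeta> / (1 - z * cnj \<zeta>)) \<partial>circle_measure)"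
    by (rule integral_mult_right_zero[symmetric])
  also have "\<dots> = (\<integral>\<zeta>. f \<zeta> * of_real ((1 - (cmod z)\<^sup>2) / (cmod (1 - cnj z * \<zeta>))\<^sup>2) \<partial>circle_measure)"
  proof (intro Bochner_Integration.integral_cong refl)
    fix \<zeta>
    have "complex_of_real ((cmod (1 - cnj z * \<zeta>))\<^sup>2) = (1 - cnj z * \<zeta>) * (1 - z * cnj \<zeta>)"
      by (subst complex_norm_square) simp
    then show "of_real (1 - (cmod z)\<^sup>2) * (F \<zeta> / (1 - z * cnj \<zeta>)) =
        f \<zeta> * of_real ((1 - (cmod z)\<^sup>2) / (cmod (1 - cnj z * \<zeta>))\<^sup>2)"
      unfolding F_def of_real_divide by simp
  qed
  finally show ?thesis .
qed

section \<open>The maximal inequality\<close>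

text \<open>Up to \<open>pi / 3\<close> the derivative \<open>cos\<close> is at least
  \<open>1 / 2\<close>. Beyond it \<open>sin\<close> is at least \<open>1 / 2\<close>, while
  \<open>x / 4 \<le> pi / 8 < 1 / 2\<close>.\<close>

lemma sin_ge_quarter:
  assumes "0 \<le> x" "x \<le> pi / 2"
  shows "x / 4 \<le> sin x"
proof (cases "x \<le> pi / 3")
  case True
  have "sin 0 - 0 / 4 \<le> sin x - x / 4"
  proof (rule DERIV_nonneg_imp_nondecreasing[OF assms(1)])
    fix y assume y: "0 \<le> y" "y \<le> x"
    have "cos (pi / 3) \<le> cos y" using y True by (intro cos_monotone_0_pi_le) auto
    then have "0 \<le> cos y - 1 / 4" by (simp add: cos_60)
    moreover have "((\<lambda>x. sin x - x / 4) has_real_derivative cos y - 1 / 4) (at y)"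
      by (auto intro!: derivative_eq_intros)
    ultimately show "\<exists>D. ((\<lambda>x. sin x - x / 4) has_real_derivative D) (at y) \<and> 0 \<le> D" by blast
  qed
  then show ?thesis by simp
next
  case False
  have "1 / 2 \<le> sqrt 3 / 2" by simp
  also have "\<dots> = sin (pi / 3)" by (simp add: sin_60)
  also have "\<dots> \<le> sin x" using False assms by (intro sin_monotone_2pi_le) auto
  finally show ?thesis using assms(2) pi_less_4 by linarith
qed

text \<open>The chord has length \<open>2 * sin (\<bar>t\<bar> / 2)\<close>. Comparing chords with
  arcs lets Euclidean balls of the plane stand for arcs, the form in which the covering lemma is
  applied.\<close>

lemma cis_chord_ge:
  assumes "\<bar>t\<bar> \<le> pi"
  shows "\<bar>t\<bar> / 4 \<le> cmod (cis t - 1)"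
proof -
  have eq: "(cmod (cis t - 1))\<^sup>2 = (2 * sin (\<bar>t\<bar> / 2))\<^sup>2"
  proof -
    have "(cmod (cis t - 1))\<^sup>2 = (cos t - 1)\<^sup>2 + (sin t)\<^sup>2"
      by (simp add: cmod_power2)
    also have "\<dots> = 2 - 2 * cos t"
      using sin_cos_squared_add[of t] by (simp add: power2_eq_square algebra_simps)
    also have "cos t = cos \<bar>t\<bar>" by simp
    also have "cos \<bar>t\<bar> = 1 - 2 * (sin (\<bar>t\<bar> / 2))\<^sup>2"
      using cos_double_sin[of "\<bar>t\<bar> / 2"] by simp
    finally show ?thesis by (simp add: power_mult_distrib)
  qed
  have "\<bar>t\<bar> / 2 / 4 \<le> sin (\<bar>t\<bar> / 2)" using assms by (intro sin_ge_quarter) auto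
  then have "\<bar>t\<bar> / 4 \<le> 2 * sin (\<bar>t\<bar> / 2)" by simp
  also have "\<dots> \<le> cmod (cis t - 1)" by (rule power2_le_imp_le) (simp_all add: eq)
  finally show ?thesis .
qed

lemma emeasure_circle_cball:
  assumes z: "cmod z = 1" and h: "h > 0"
  shows "emeasure circle_measure (cball z h \<inter> sphere 0 1) \<le> ennreal (6 * h)"
proof -
  obtain u where u: "0 \<le> u" "u < 2 * pi" "z = cis u"
    using z complex_unimodular_polar[of z] by (auto simp: cis.code complex_eq_iff)
  have A: "cball z h \<inter> sphere 0 1 \<in> sets circle_measure"
    unfolding sets_circle_measure_iff by auto
  \<comment> \<open>The two outer intervals account for arcs that wrap around the cut at
    \<open>0\<close> and \<open>2 * pi\<close>. Each interval has length \<open>8 * h\<close>,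
    whence the \<open>24 * h\<close> below.\<close>
  have sub: "{0..2*pi} \<inter> cis -` (cball z h \<inter> sphere 0 1) \<subseteq>
      {u - 4*h..u + 4*h} \<union> {u + 2*pi - 4*h..u + 2*pi + 4*h} \<union> {u - 2*pi - 4*h..u - 2*pi + 4*h}"
  proof
    fix t assume "t \<in> {0..2*pi} \<inter> cis -` (cball z h \<inter> sphere 0 1)"
    then have t: "0 \<le> t" "t \<le> 2*pi" "cmod (cis u - cis t) \<le> h" using u by (auto simp: dist_norm)
    have ch: "\<bar>v\<bar> \<le> 4 * h" if v: "\<bar>v\<bar> \<le> pi" "cis v = cis (t - u)" for v
    proof -
      have "cmod (cis v - 1) = cmod (cis u * (cis v - 1))" by (simp add: norm_mult)
      also have "cis u * (cis v - 1) = cis t - cis u"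
        unfolding v(2) by (simp add: algebra_simps cis_mult)
      finally have "cmod (cis v - 1) \<le> h" using t(3) by (simp add: norm_minus_commute)
      with cis_chord_ge[OF v(1)] show ?thesis by linarith
    qed
    have per: "cis (t - u + 2*pi) = cis (t - u)" "cis (t - u - 2*pi) = cis (t - u)"
      by (simp_all add: complex_eq_iff cos_diff sin_diff cos_add sin_add)
    consider "\<bar>t - u\<bar> \<le> pi" | "t - u > pi" | "t - u < - pi" by linarith
    then show "t \<in> {u - 4*h..u + 4*h} \<union> {u + 2*pi - 4*h..u + 2*pi + 4*h} \<union> {u - 2*pi - 4*h..u - 2*pi + 4*h}"
    proof cases
      case 1
      then have "\<bar>t - u\<bar> \<le> 4 * h" by (intro ch) auto
      then show ?thesis by (auto simp: abs_le_iff)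
    next
      case 2
      then have "\<bar>t - u - 2*pi\<bar> \<le> 4 * h" using t u per by (intro ch) auto
      then show ?thesis by (auto simp: abs_le_iff)
    next
      case 3
      then have "\<bar>t - u + 2*pi\<bar> \<le> 4 * h" using t u per by (intro ch) auto
      then show ?thesis by (auto simp: abs_le_iff)
    qed
  qed
  have "emeasure lborel ({0..2*pi} \<inter> cis -` (cball z h \<inter> sphere 0 1)) \<le> emeasure lborel
      ({u - 4*h..u + 4*h} \<union> {u + 2*pi - 4*h..u + 2*pi + 4*h} \<union> {u - 2*pi - 4*h..u - 2*pi + 4*h})"
    using sub by (intro emeasure_mono) auto
  also have "\<dots> \<le> emeasure lborel {u - 4*h..u + 4*h} +
      emeasure lborel {u + 2*pi - 4*h..u + 2*pi + 4*h} + emeasure lborel {u - 2*pi - 4*h..u - 2*pi + 4*h}"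
    by (intro order_trans[OF emeasure_subadditive] add_mono order_refl) auto
  also have "\<dots> = ennreal (24 * h)"
    using h by (simp add: ennreal_plus[symmetric] del: ennreal_plus)
  finally have "emeasure circle_measure (cball z h \<inter> sphere 0 1) \<le> ennreal (24 * h) / ennreal (2 * pi)"
    unfolding emeasure_circle_measure[OF A] by (rule divide_right_mono_ennreal)
  also have "\<dots> = ennreal (24 * h / (2 * pi))" using h by (simp add: divide_ennreal)
  also have "\<dots> \<le> ennreal (6 * h)"
  proof (rule ennreal_leI)
    have "24 * h \<le> 6 * h * (2 * 2)" by simp
    also have "\<dots> \<le> 6 * h * (2 * pi)" using h pi_ge_two by (intro mult_left_mono) auto
    finally show "24 * h / (2 * pi) \<le> 6 * h" by (simp add: divide_le_eq)
  qed
  finally show ?thesis .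
qed

lemma borel_measurable_circle_indicator [measurable]:
  fixes A :: "complex set"
  assumes "A \<in> sets borel"
  shows "(indicator A :: complex \<Rightarrow> real) \<in> borel_measurable circle_measure"
  using assms by (intro borel_measurable_circle borel_measurable_indicator)

text \<open>Weak-type estimate with factor \<open>30 = 6 * 5\<close>: the covering lemma enlarges
  radii by 5, and a ball of radius \<open>r\<close> centred on the circle has measure at most
  \<open>6 * r\<close>.\<close>

lemma circle_maximal_inequality:
  fixes g :: "complex \<Rightarrow> real"
  assumes g: "integrable circle_measure g" "\<And>\<zeta>. g \<zeta> \<ge> 0" and l: "l > 0"
    and S: "S \<in> sets circle_measure"
    and big: "\<And>\<zeta>. \<zeta> \<in> S \<Longrightarrow> \<exists>h>0. (\<integral>w. g w * indicator (cball \<zeta> h) w \<partial>circle_measure) > l * h"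
  shows "l * measure circle_measure S \<le> 30 * (\<integral>w. g w \<partial>circle_measure)"
proof -
  have gm [measurable]: "g \<in> borel_measurable circle_measure" using g(1) by auto
  define I where "I = (\<integral>w. g w \<partial>circle_measure)"
  have I0: "I \<ge> 0" unfolding I_def using g(2) by (intro Bochner_Integration.integral_nonneg) auto
  have Ssp: "S \<subseteq> sphere 0 1" using S sets_circle_measure_iff by blast
  have D: "cball \<zeta> h \<inter> sphere 0 1 \<in> sets circle_measure" for \<zeta> h
    unfolding sets_circle_measure_iff by auto
  \<comment> \<open>The measure with density \<open>g\<close>; its countable additivity over the
    disjoint balls bounds their total mass by the integral of \<open>g\<close>.\<close>
  define N where "N = density circle_measure (\<lambda>w. ennreal (g w))"
  have emN: "emeasure N (cball \<zeta> h \<inter> sphere 0 1) = ennreal (\<integral>w. g w * indicator (cball \<zeta> h) w \<partial>circle_measure)" for \<zeta> h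
  proof -
    have "integrable circle_measure (\<lambda>w. g w * indicator (cball \<zeta> h \<inter> sphere 0 1) w)"
      using D g(1) by (intro integrable_real_mult_indicator)
    moreover have "(\<integral>w. g w * indicator (cball \<zeta> h \<inter> sphere 0 1) w \<partial>circle_measure)
        = (\<integral>w. g w * indicator (cball \<zeta> h) w \<partial>circle_measure)"
      by (intro Bochner_Integration.integral_cong) (auto split: split_indicator)
    moreover have "emeasure N (cball \<zeta> h \<inter> sphere 0 1) =
        (\<integral>\<^sup>+w. ennreal (g w * indicator (cball \<zeta> h \<inter> sphere 0 1) w) \<partial>circle_measure)"
      unfolding N_def using D
      by (subst emeasure_density) (auto intro!: nn_integral_cong split: split_indicator)
    ultimately show ?thesis using g(2) by (subst (asm) nn_integral_eq_integral) auto
  qed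
  have Nsp: "emeasure N (space N) = ennreal I"
  proof -
    have "emeasure N (space N) = (\<integral>\<^sup>+w. ennreal (g w) * indicator (space circle_measure) w \<partial>circle_measure)"
      unfolding N_def space_density by (intro emeasure_density sets.top) measurable
    also have "\<dots> = (\<integral>\<^sup>+w. ennreal (g w) \<partial>circle_measure)" by (intro nn_integral_cong) auto
    also have "\<dots> = ennreal I" unfolding I_def using g by (intro nn_integral_eq_integral) auto
    finally show ?thesis .
  qed
  obtain h where h: "\<And>\<zeta>. \<zeta> \<in> S \<Longrightarrow> h \<zeta> > 0"
      "\<And>\<zeta>. \<zeta> \<in> S \<Longrightarrow> l * h \<zeta> < (\<integral>w. g w * indicator (cball \<zeta> (h \<zeta>)) w \<partial>circle_measure)"
    using big by metis
  \<comment> \<open>Vitali's lemma asks for a common bound on the radii; \<open>I / l\<close> works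
    because no ball carries more than the total mass \<open>I\<close>.\<close>
  have hB: "0 < h \<zeta> \<and> h \<zeta> \<le> I / l" if z: "\<zeta> \<in> S" for \<zeta>
  proof -
    have "ennreal (l * h \<zeta>) \<le> emeasure N (cball \<zeta> (h \<zeta>) \<inter> sphere 0 1)"
      unfolding emN using h(2)[OF z] by (intro ennreal_leI) auto
    also have "\<dots> \<le> emeasure N (space N)" by (rule emeasure_space)
    also have "\<dots> = ennreal I" by (rule Nsp)
    finally have "l * h \<zeta> \<le> I" using I0 by simp
    then show ?thesis using h(1)[OF z] l by (simp add: pos_le_divide_eq mult.commute)
  qed
  have cov: "S \<subseteq> (\<Union>\<zeta>\<in>S. cball \<zeta> (h \<zeta>))" using hB by force
  obtain C where C: "countable C" "C \<subseteq> S"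
      "pairwise (\<lambda>i j. disjnt (cball i (h i)) (cball j (h j))) C"
      "S \<subseteq> (\<Union>i\<in>C. cball i (5 * h i))"
    by (rule Vitali_covering_lemma_cballs[OF cov hB], assumption) (rule that)
  \<comment> \<open>The countable set \<open>C\<close> of centres is indexed by natural numbers. A
    fibre of \<open>to_nat_on C\<close> is empty or a single centre, so \<open>X n\<close> is empty
    or one arc, and \<open>Y n\<close> is its enlargement.\<close>
  define X where "X n = (\<Union>i\<in>{i\<in>C. to_nat_on C i = n}. cball i (h i) \<inter> sphere 0 1)" for n
  define Y where "Y n = (\<Union>i\<in>{i\<in>C. to_nat_on C i = n}. cball i (5 * h i) \<inter> sphere 0 1)" for n
  have fib: "{i\<in>C. to_nat_on C i = n} = {} \<or> (\<exists>i\<in>C. {i\<in>C. to_nat_on C i = n} = {i})" for n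
  proof (cases "{i\<in>C. to_nat_on C i = n} = {}")
    case False
    then obtain i where i: "i \<in> C" "to_nat_on C i = n" by blast
    then have "{i\<in>C. to_nat_on C i = n} = {i}"
      using inj_on_to_nat_on[OF C(1)] by (auto dest: inj_onD)
    with i show ?thesis by blast
  qed simp
  have XY: "X n \<in> sets circle_measure" "Y n \<in> sets circle_measure"
      "emeasure circle_measure (Y n) \<le> ennreal (30 / l) * emeasure N (X n)" for n
  proof -
    have "X n \<in> sets circle_measure \<and> Y n \<in> sets circle_measure \<and>
      emeasure circle_measure (Y n) \<le> ennreal (30 / l) * emeasure N (X n)"
      using fib[of n]
    proof (elim disjE bexE)
      assume "{i\<in>C. to_nat_on C i = n} = {}"
      then have "X n = {}" "Y n = {}" by (simp_all only: X_def Y_def UN_empty)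
      then show ?thesis by simp
    next
      fix i assume i: "i \<in> C" "{i\<in>C. to_nat_on C i = n} = {i}"
      have iS: "i \<in> S" using i C by auto
      have XYi: "X n = cball i (h i) \<inter> sphere 0 1" "Y n = cball i (5 * h i) \<inter> sphere 0 1"
        unfolding X_def Y_def i(2) by auto
      have "emeasure circle_measure (Y n) \<le> ennreal (6 * (5 * h i))"
        unfolding XYi using iS Ssp h(1)[OF iS] by (intro emeasure_circle_cball) auto
      also have "\<dots> \<le> ennreal (30 / l * (\<integral>w. g w * indicator (cball i (h i)) w \<partial>circle_measure))"
        using h(2)[OF iS] l by (intro ennreal_leI) (simp add: field_simps)
      also have "\<dots> = ennreal (30 / l) * emeasure N (X n)"
        unfolding XYi emN using l by (intro ennreal_mult') auto
      finally show ?thesis using D XYi by auto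
    qed
    then show "X n \<in> sets circle_measure" "Y n \<in> sets circle_measure"
      "emeasure circle_measure (Y n) \<le> ennreal (30 / l) * emeasure N (X n)" by auto
  qed
  have disj: "disjoint_family X"
    unfolding disjoint_family_on_def
  proof (intro ballI impI)
    fix m n :: nat assume mn: "m \<noteq> n"
    show "X m \<inter> X n = {}"
    proof (rule ccontr)
      assume "X m \<inter> X n \<noteq> {}"
      then obtain x where "x \<in> X m" "x \<in> X n" by blast
      then obtain i j where x: "i \<in> C" "j \<in> C" "to_nat_on C i = m" "to_nat_on C j = n"
          "x \<in> cball i (h i)" "x \<in> cball j (h j)"
        unfolding X_def by blast
      then have "i \<noteq> j" using mn by auto
      with C(3) x(1,2) have "disjnt (cball i (h i)) (cball j (h j))" by (auto simp: pairwise_def)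
      with x(5,6) show False by (auto simp: disjnt_def)
    qed
  qed
  have "emeasure circle_measure S \<le> emeasure circle_measure (\<Union>n. Y n)"
  proof (rule emeasure_mono)
    show "S \<subseteq> (\<Union>n. Y n)"
    proof
      fix x assume x: "x \<in> S"
      then obtain i where "i \<in> C" "x \<in> cball i (5 * h i)" using C(4) by blast
      then have "x \<in> Y (to_nat_on C i)" using x Ssp by (auto simp: Y_def)
      then show "x \<in> (\<Union>n. Y n)" by blast
    qed
  qed (use XY(2) in auto)
  also have "\<dots> \<le> (\<Sum>n. emeasure circle_measure (Y n))"
    using XY(2) by (intro emeasure_subadditive_countably) auto
  also have "\<dots> \<le> (\<Sum>n. ennreal (30 / l) * emeasure N (X n))"
    using XY(3) by (intro suminf_le) auto
  also have "\<dots> = ennreal (30 / l) * (\<Sum>n. emeasure N (X n))" by simp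
  also have "(\<Sum>n. emeasure N (X n)) = emeasure N (\<Union>n. X n)"
    using XY(1) disj by (intro suminf_emeasure) (auto simp: N_def)
  also have "ennreal (30 / l) * \<dots> \<le> ennreal (30 / l) * emeasure N (space N)"
    by (intro mult_left_mono emeasure_space) auto
  also have "emeasure N (space N) = ennreal I" by (rule Nsp)
  also have "ennreal (30 / l) * ennreal I = ennreal (30 / l * I)"
    using l I0 by (intro ennreal_mult[symmetric]) auto
  finally have "measure circle_measure S \<le> 30 / l * I"
    using l I0 by (simp add: circle.emeasure_eq_measure)
  then show ?thesis using l by (simp add: I_def field_simps)
qed

text \<open>At distance about \<open>2 ^ k * (1 - s)\<close> from \<open>\<zeta>\<close> the kernel
  is of order \<open>1 / (4 ^ k * (1 - s))\<close>, so a sum over concentric balls dominates it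
  pointwise. The condition on \<open>K\<close> makes the largest ball contain the whole circle,
  whose diameter is 2.\<close>

lemma poisson_kernel_le_dyadic:
  assumes z: "cmod \<zeta> = 1" and w: "cmod w = 1" and s: "0 \<le> s" "s < 1"
    and K: "2 ^ K * (1 - s) \<ge> 2"
  shows "(1 - (cmod (of_real s * \<zeta>))\<^sup>2) / (cmod (1 - cnj (of_real s * \<zeta>) * w))\<^sup>2
    \<le> (\<Sum>k\<le>K. 32 / (4 ^ k * (1 - s)) * indicator (cball \<zeta> (2 ^ k * (1 - s))) w)"
proof -
  define d where "d = 1 - s"
  have d: "d > 0" "s = 1 - d" using s by (auto simp: d_def)
  define q where "q = cmod (1 - cnj (of_real s * \<zeta>) * w)"
  have zz: "\<zeta> * cnj \<zeta> = 1" using z by (simp add: complex_norm_square[symmetric])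
  have q: "q = cmod (\<zeta> - of_real s * w)"
  proof -
    have "\<zeta> * (1 - cnj (of_real s * \<zeta>) * w) = \<zeta> - of_real s * w * (\<zeta> * cnj \<zeta>)"
      by (simp add: algebra_simps)
    then have "cmod (\<zeta> - of_real s * w) = cmod (\<zeta> * (1 - cnj (of_real s * \<zeta>) * w))"
      by (simp add: zz)
    then show ?thesis using z by (simp add: q_def norm_mult)
  qed
  have qd: "q \<ge> d"
    unfolding q using norm_triangle_ineq2[of \<zeta> "of_real s * w"] z w s by (simp add: norm_mult d_def)
  have dq: "cmod (\<zeta> - w) \<le> 2 * q"
  proof -
    have "cmod (\<zeta> - w) \<le> cmod (\<zeta> - of_real s * w) + cmod (of_real s * w - w)"
      using norm_triangle_ineq[of "\<zeta> - of_real s * w" "of_real s * w - w"] by simp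
    also have "of_real s * w - w = - of_real d * w" by (simp add: d_def algebra_simps)
    also have "cmod (- of_real d * w) = d" using w d by (simp add: norm_mult)
    finally show ?thesis using qd q by linarith
  qed
  have num: "1 - (cmod (of_real s * \<zeta>))\<^sup>2 \<le> 2 * d"
  proof -
    have "1 - s\<^sup>2 = (1 + s) * d" by (simp add: d_def power2_eq_square algebra_simps)
    also have "\<dots> \<le> 2 * d" using s d by (intro mult_right_mono) auto
    finally show ?thesis using z by (simp add: norm_mult)
  qed
  have lek: "cmod (\<zeta> - w) \<le> 2 ^ K * d"
    using norm_triangle_ineq4[of \<zeta> w] z w K by (simp add: d_def)
  \<comment> \<open>The smallest dyadic ball containing \<open>w\<close>. For
    \<open>k = Suc j\<close> minimality gives
    \<open>2 ^ j * d < cmod (\<zeta> - w) \<le> 2 * q\<close>, so \<open>2 * d / q\<^sup>2\<close>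
    is at most \<open>8 / (4 ^ j * d) = 32 / (4 ^ k * d)\<close>.\<close>
  define k where "k = (LEAST k. cmod (\<zeta> - w) \<le> 2 ^ k * d)"
  have k1: "cmod (\<zeta> - w) \<le> 2 ^ k * d" unfolding k_def using lek by (rule LeastI)
  have kK: "k \<le> K" unfolding k_def using lek by (rule Least_le)
  have "2 * d / q\<^sup>2 \<le> 32 / (4 ^ k * d)"
  proof (cases k)
    case 0
    have "d * d \<le> q * q" using qd d by (intro mult_mono) auto
    moreover have "0 \<le> q * q" by simp
    ultimately have "d * d \<le> 16 * (q * q)" by linarith
    then show ?thesis using 0 d qd by (simp add: field_simps power2_eq_square)
  next
    case (Suc j)
    have "\<not> cmod (\<zeta> - w) \<le> 2 ^ j * d" 
      using not_less_Least[of j "\<lambda>k. cmod (\<zeta> - w) \<le> 2 ^ k * d"] Suc unfolding k_def by auto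
    then have "2 ^ j * d \<le> 2 * q" using dq by linarith
    then have "(2 ^ j * d) * (2 ^ j * d) \<le> (2 * q) * (2 * q)"
      using d qd by (intro mult_mono[of "2 ^ j * d" "2 * q" "2 ^ j * d" "2 * q"]) simp_all
    moreover have "(4::real) ^ j = 2 ^ j * 2 ^ j" by (simp add: power_mult_distrib[symmetric])
    ultimately have "4 ^ j * (d * d) \<le> 4 * (q * q)" by (simp add: mult_ac)
    then show ?thesis using Suc d qd by (simp add: field_simps power2_eq_square)
  qed
  moreover have "(1 - (cmod (of_real s * \<zeta>))\<^sup>2) / q\<^sup>2 \<le> 2 * d / q\<^sup>2"
    using num by (intro divide_right_mono) auto
  moreover have "32 / (4 ^ k * d) \<le> (\<Sum>k\<le>K. 32 / (4 ^ k * d) * indicator (cball \<zeta> (2 ^ k * d)) w)"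
  proof -
    have "32 / (4 ^ k * d) = (\<Sum>k\<in>{k}. 32 / (4 ^ k * d) * indicator (cball \<zeta> (2 ^ k * d)) w)"
      using k1 by (simp add: dist_norm)
    also have "\<dots> \<le> (\<Sum>k\<le>K. 32 / (4 ^ k * d) * indicator (cball \<zeta> (2 ^ k * d)) w)"
      using kK d by (intro sum_mono2) auto
    finally show ?thesis .
  qed
  ultimately show ?thesis unfolding q_def d_def by linarith
qed

text \<open>With \<open>d = 1 - s\<close>, the \<open>k\<close>th ball contributes at most
  \<open>32 / (4 ^ k * d) * (l * (2 ^ k * d)) = 32 * l / 2 ^ k\<close>, and the geometric series
  sums to at most \<open>64 * l\<close>.\<close>

lemma poisson_le_maximal:
  fixes g :: "complex \<Rightarrow> real"
  assumes g: "integrable circle_measure g" "\<And>\<zeta>. g \<zeta> \<ge> 0"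
    and z: "cmod \<zeta> = 1" and s: "0 \<le> s" "s < 1"
    and small: "\<And>h. h > 0 \<Longrightarrow> (\<integral>w. g w * indicator (cball \<zeta> h) w \<partial>circle_measure) \<le> l * h"
  shows "(\<integral>w. g w * ((1 - (cmod (of_real s * \<zeta>))\<^sup>2) / (cmod (1 - cnj (of_real s * \<zeta>) * w))\<^sup>2) \<partial>circle_measure)
    \<le> 64 * l"
proof -
  have gm [measurable]: "g \<in> borel_measurable circle_measure" using g(1) by auto
  define d where "d = 1 - s"
  have d: "d > 0" using s by (auto simp: d_def)
  obtain K where "2 / d < 2 ^ K" using real_arch_pow[of 2 "2 / d"] by auto
  then have K: "2 \<le> 2 ^ K * (1 - s)" using d by (simp add: d_def field_simps)
  have l0: "l \<ge> 0"
  proof -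
    have "0 \<le> (\<integral>w. g w * indicator (cball \<zeta> 1) w \<partial>circle_measure)"
      using g(2) by (intro Bochner_Integration.integral_nonneg) auto
    then show ?thesis using small[of 1] by simp
  qed
  have ig: "integrable circle_measure (\<lambda>w. g w * indicator (cball \<zeta> h) w)" for h
    by (rule Bochner_Integration.integrable_bound[OF g(1)]) (auto split: split_indicator)
  have "(\<integral>w. g w * ((1 - (cmod (of_real s * \<zeta>))\<^sup>2) / (cmod (1 - cnj (of_real s * \<zeta>) * w))\<^sup>2) \<partial>circle_measure)
    \<le> (\<integral>w. (\<Sum>k\<le>K. 32 / (4 ^ k * d) * (g w * indicator (cball \<zeta> (2 ^ k * d)) w)) \<partial>circle_measure)"
  proof (rule integral_mono')
    show "integrable circle_measure (\<lambda>w. \<Sum>k\<le>K. 32 / (4 ^ k * d) * (g w * indicator (cball \<zeta> (2 ^ k * d)) w))"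
      by (intro Bochner_Integration.integrable_sum integrable_mult_right ig)
    fix w assume "w \<in> space circle_measure"
    then have w: "cmod w = 1" by simp
    show "g w * ((1 - (cmod (of_real s * \<zeta>))\<^sup>2) / (cmod (1 - cnj (of_real s * \<zeta>) * w))\<^sup>2)
      \<le> (\<Sum>k\<le>K. 32 / (4 ^ k * d) * (g w * indicator (cball \<zeta> (2 ^ k * d)) w))"
      using mult_left_mono[OF poisson_kernel_le_dyadic[OF z w s K] g(2)[of w]]
      by (simp add: sum_distrib_left d_def mult_ac)
    show "0 \<le> (\<Sum>k\<le>K. 32 / (4 ^ k * d) * (g w * indicator (cball \<zeta> (2 ^ k * d)) w))"
      using g(2) d by (intro sum_nonneg) auto
  qed
  also have "\<dots> = (\<Sum>k\<le>K. 32 / (4 ^ k * d) * (\<integral>w. g w * indicator (cball \<zeta> (2 ^ k * d)) w \<partial>circle_measure))"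
    using ig by (subst Bochner_Integration.integral_sum) auto
  also have "\<dots> \<le> (\<Sum>k\<le>K. 32 / (4 ^ k * d) * (l * (2 ^ k * d)))"
    using d by (intro sum_mono mult_left_mono small) auto
  also have "\<dots> = 32 * l * (\<Sum>k\<le>K. (1/2) ^ k)"
    unfolding sum_distrib_left
  proof (rule sum.cong)
    fix k
    have "(4::real) ^ k = 2 ^ k * 2 ^ k" by (simp add: power_mult_distrib[symmetric])
    then show "32 / (4 ^ k * d) * (l * (2 ^ k * d)) = 32 * l * (1/2) ^ k"
      using d by (simp add: power_divide)
  qed simp
  also have "\<dots> \<le> 32 * l * 2"
  proof (intro mult_left_mono)
    have "(\<Sum>k\<le>K. (1/2::real) ^ k) \<le> (\<Sum>k. (1/2) ^ k)"
      by (intro sum_le_suminf summable_geometric) auto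
    then show "(\<Sum>k\<le>K. (1/2::real) ^ k) \<le> 2" by (simp add: suminf_geometric)
  qed (use l0 in auto)
  finally show ?thesis by simp
qed

section \<open>Dilations and the radial maximal function\<close>

lemma holomorphic_dilation:
  assumes "f holomorphic_on ball 0 1" "0 < r"
  shows "(\<lambda>z. f (of_real r * z)) holomorphic_on ball 0 (1 / r)"
proof (rule holomorphic_on_compose_gen[OF _ assms(1), unfolded o_def])
  show "(*) (of_real r) ` ball 0 (1 / r) \<subseteq> ball (0::complex) 1"
    using assms(2) by (auto simp: norm_mult field_simps)
qed (intro holomorphic_intros)

lemma continuous_on_dilation:
  assumes "f holomorphic_on ball 0 1" "0 \<le> r" "r < 1"
  shows "continuous_on (sphere 0 1) (\<lambda>z. f (of_real r * z))"
  by (intro continuous_on_compose2[OF holomorphic_on_imp_continuous_on[OF assms(1)]] continuous_intros)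
     (use assms in \<open>auto simp: norm_mult\<close>)

lemma borel_measurable_dilation:
  assumes "f holomorphic_on ball 0 1" "0 \<le> r" "r < 1"
  shows "(\<lambda>z. f (of_real r * z)) \<in> borel_measurable circle_measure"
  using continuous_on_dilation[OF assms] by (rule borel_measurable_circle_continuous)

text \<open>The union over all radii is uncountable, but for each radius the superlevel set is
  relatively open in the circle, and so is the union.\<close>

lemma radial_superlevel_measurable:
  assumes "f holomorphic_on ball 0 1" "b \<le> 1"
  shows "{\<zeta>\<in>sphere 0 1. \<exists>s\<in>{0..<b}. l < cmod (f (of_real s * \<zeta>))} \<in> sets circle_measure"
proof -
  have "openin (top_of_set (sphere 0 1)) (\<Union>s\<in>{0..<b}. sphere 0 1 \<inter> (\<lambda>\<zeta>. cmod (f (of_real s * \<zeta>))) -` {l<..})"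
  proof (intro openin_Union ballI, elim imageE)
    fix U s assume s: "s \<in> {0..<b}" and U: "U = sphere 0 1 \<inter> (\<lambda>\<zeta>. cmod (f (of_real s * \<zeta>))) -` {l<..}"
    show "openin (top_of_set (sphere 0 1)) U"
      unfolding U using s assms
      by (intro continuous_openin_preimage_gen continuous_on_norm continuous_on_dilation) auto
  qed
  moreover have "(\<Union>s\<in>{0..<b}. sphere 0 1 \<inter> (\<lambda>\<zeta>. cmod (f (of_real s * \<zeta>))) -` {l<..}) =
      {\<zeta>\<in>sphere 0 1. \<exists>s\<in>{0..<b}. l < cmod (f (of_real s * \<zeta>))}" by auto
  ultimately obtain T where "open T" "{\<zeta>\<in>sphere 0 1. \<exists>s\<in>{0..<b}. l < cmod (f (of_real s * \<zeta>))} = sphere 0 1 \<inter> T"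
    by (auto simp: openin_open)
  then show ?thesis unfolding sets_circle_measure_iff by auto
qed

lemma radial_maximal_inequality:
  assumes f: "f holomorphic_on ball 0 R" and R: "1 < R" and l: "l > 0"
  shows "l * measure circle_measure {\<zeta>\<in>sphere 0 1. \<exists>s\<in>{0..<1}. l < cmod (f (of_real s * \<zeta>))}
    \<le> 1920 * (\<integral>\<zeta>. cmod (f \<zeta>) \<partial>circle_measure)"
proof -
  define S where "S = {\<zeta>\<in>sphere 0 1. \<exists>s\<in>{0..<1}. l < cmod (f (of_real s * \<zeta>))}"
  have f1: "f holomorphic_on ball 0 1" by (rule holomorphic_on_subset[OF f]) (use R in auto)
  have cf: "continuous_on (sphere 0 1) f"
    using R by (intro holomorphic_on_imp_continuous_on holomorphic_on_subset[OF f]) auto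
  have fi: "integrable circle_measure (\<lambda>\<zeta>. cmod (f \<zeta>))"
    by (intro integrable_circle_continuous continuous_intros cf)
  \<comment> \<open>If every ball around \<open>\<zeta>\<close> had mass at most
    \<open>(l / 64) * h\<close>, the Poisson integral would be at most \<open>l\<close> along the
    whole radius. Hence the level \<open>l / 64\<close>, and \<open>1920 = 64 * 30\<close>.\<close>
  have "(l / 64) * measure circle_measure S \<le> 30 * (\<integral>\<zeta>. cmod (f \<zeta>) \<partial>circle_measure)"
  proof (rule circle_maximal_inequality[OF fi])
    show "S \<in> sets circle_measure" unfolding S_def by (rule radial_superlevel_measurable[OF f1]) simp
    fix \<zeta> assume "\<zeta> \<in> S"
    then obtain s where z: "cmod \<zeta> = 1" and s: "0 \<le> s" "s < 1" and big: "l < cmod (f (of_real s * \<zeta>))"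
      unfolding S_def by auto
    show "\<exists>h>0. (l / 64) * h < (\<integral>w. cmod (f w) * indicator (cball \<zeta> h) w \<partial>circle_measure)"
    proof (rule ccontr)
      assume "\<not> ?thesis"
      then have small: "(\<integral>w. cmod (f w) * indicator (cball \<zeta> h) w \<partial>circle_measure) \<le> (l / 64) * h" if "h > 0" for h
        using that by (meson not_less)
      have sz: "cmod (of_real s * \<zeta>) < 1" using s z by (simp add: norm_mult)
      have "cmod (f (of_real s * \<zeta>)) \<le> (\<integral>w. cmod (f w * of_real ((1 - (cmod (of_real s * \<zeta>))\<^sup>2) /
          (cmod (1 - cnj (of_real s * \<zeta>) * w))\<^sup>2)) \<partial>circle_measure)"
        unfolding poisson_formula_circle[OF f R sz] by (rule integral_norm_bound)
      also have "\<dots> = (\<integral>w. cmod (f w) * ((1 - (cmod (of_real s * \<zeta>))\<^sup>2) /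
          (cmod (1 - cnj (of_real s * \<zeta>) * w))\<^sup>2) \<partial>circle_measure)"
      proof -
        have "0 \<le> 1 - (cmod (of_real s * \<zeta>))\<^sup>2" using sz by (simp add: power_le_one less_imp_le)
        then have "\<bar>(1 - (cmod (of_real s * \<zeta>))\<^sup>2) / (cmod (1 - cnj (of_real s * \<zeta>) * w))\<^sup>2\<bar>
           = (1 - (cmod (of_real s * \<zeta>))\<^sup>2) / (cmod (1 - cnj (of_real s * \<zeta>) * w))\<^sup>2" for w by simp
        then show ?thesis by (simp only: norm_mult norm_of_real)
      qed
      also have "\<dots> \<le> 64 * (l / 64)"
        by (rule poisson_le_maximal[OF fi _ z s small]) simp_all
      finally show False using big by simp
    qed
  qed (use l in auto)
  then show ?thesis unfolding S_def by simp
qed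

definition circle_mean :: "(complex \<Rightarrow> complex) \<Rightarrow> real \<Rightarrow> real" where
  "circle_mean f r = (\<integral>\<zeta>. (cmod (f (of_real r * \<zeta>)))\<^sup>2 \<partial>circle_measure)"

text \<open>The \<open>c n\<close> are the squared moduli of the Taylor coefficients. The
  correlation of two dilations is a series in the single product \<open>r * s\<close> with
  nonnegative coefficients, hence increasing in that product.\<close>

lemma circle_mean_series:
  assumes f: "f holomorphic_on ball 0 1"
  obtains c where "\<And>n. 0 \<le> c n" "\<And>r s. \<lbrakk>0 \<le> r; r < 1; 0 \<le> s; s < 1\<rbrakk> \<Longrightarrow>
    (\<lambda>n. complex_of_real (c n * (r * s) ^ n)) sums
      (\<integral>\<zeta>. f (of_real r * \<zeta>) * cnj (f (of_real s * \<zeta>)) \<partial>circle_measure)"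
proof -
  define a where "a n = (deriv ^^ n) f 0 / fact n" for n
  have sm: "(\<lambda>n. a n * z ^ n) sums f z" if "cmod z < 1" for z
    using holomorphic_power_series[OF f, of z] that by (simp add: a_def)
  have abs: "summable (\<lambda>n. cmod (a n * of_real r ^ n))" if r: "0 \<le> r" "r < 1" for r
  proof -
    obtain r' where r': "r < r'" "r' < 1" using dense r by blast
    have "summable (\<lambda>n. a n * of_real r' ^ n)" using sm[of "of_real r'"] r r' sums_summable by auto
    then have "summable (\<lambda>n. cmod (a n * of_real r ^ n))"
      by (rule powser_insidea) (use r r' in auto)
    then show ?thesis .
  qed
  have ser: "(\<lambda>n. a n * of_real r ^ n * \<zeta> ^ n) sums f (of_real r * \<zeta>)"
    if "0 \<le> r" "r < 1" "cmod \<zeta> = 1" for r \<zeta>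
    using sm[of "of_real r * \<zeta>"] that by (simp add: norm_mult power_mult_distrib mult.assoc)
  show ?thesis
  proof (rule that[of "\<lambda>n. (cmod (a n))\<^sup>2"])
    fix r s :: real assume rs: "0 \<le> r" "r < 1" "0 \<le> s" "s < 1"
    have "(\<lambda>n. a n * of_real r ^ n * cnj (a n * of_real s ^ n)) sums
        (\<integral>\<zeta>. f (of_real r * \<zeta>) * cnj (f (of_real s * \<zeta>)) \<partial>circle_measure)"
      by (rule circle_parseval[OF ser abs ser abs])
         (use rs in \<open>auto intro!: integrable_circle_continuous continuous_on_dilation f\<close>)
    moreover have "a n * of_real r ^ n * cnj (a n * of_real s ^ n) =
        complex_of_real ((cmod (a n))\<^sup>2 * (r * s) ^ n)" for n
    proof -
      have "a n * of_real r ^ n * cnj (a n * of_real s ^ n) = (a n * cnj (a n)) * of_real ((r * s) ^ n)"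
        by (simp add: power_mult_distrib)
      then show ?thesis by (simp add: complex_norm_square[symmetric])
    qed
    ultimately show "(\<lambda>n. complex_of_real ((cmod (a n))\<^sup>2 * (r * s) ^ n)) sums
        (\<integral>\<zeta>. f (of_real r * \<zeta>) * cnj (f (of_real s * \<zeta>)) \<partial>circle_measure)" by simp
  qed simp
qed

text \<open>For the second part, expand the square: the cross term is the correlation of radii
  \<open>r\<close> and \<open>s\<close>, whose real part is at least that of \<open>r\<close> with
  itself, that is, \<open>circle_mean f r\<close>. Thus bounded means force the dilations to be
  Cauchy in mean square.\<close>

lemma circle_mean_mono:
  assumes f: "f holomorphic_on ball 0 1" and rs: "0 \<le> r" "r \<le> s" "s < 1"
  shows "circle_mean f r \<le> circle_mean f s"
    and "(\<integral>\<zeta>. (cmod (f (of_real s * \<zeta>) - f (of_real r * \<zeta>)))\<^sup>2 \<partial>circle_measure)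
      \<le> circle_mean f s - circle_mean f r"
proof -
  obtain c where c: "\<And>n. 0 \<le> c n" "\<And>r s. \<lbrakk>0 \<le> r; r < 1; 0 \<le> s; s < 1\<rbrakk> \<Longrightarrow>
    (\<lambda>n. complex_of_real (c n * (r * s) ^ n)) sums
      (\<integral>\<zeta>. f (of_real r * \<zeta>) * cnj (f (of_real s * \<zeta>)) \<partial>circle_measure)"
    using circle_mean_series[OF f] by blast
  define p where "p r s = (\<integral>\<zeta>. f (of_real r * \<zeta>) * cnj (f (of_real s * \<zeta>)) \<partial>circle_measure)" for r s
  have rp: "(\<lambda>n. c n * (r * s) ^ n) sums Re (p r s)" if "0 \<le> r" "r < 1" "0 \<le> s" "s < 1" for r s
    using sums_Re[OF c(2)[OF that]] unfolding p_def by simp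
  have mp: "circle_mean f r = Re (p r r)" if "0 \<le> r" "r < 1" for r
  proof -
    have "integrable circle_measure (\<lambda>\<zeta>. f (of_real r * \<zeta>) * cnj (f (of_real r * \<zeta>)))"
      using that by (intro integrable_circle_continuous continuous_intros continuous_on_dilation f)
    then have "Re (p r r) = (\<integral>\<zeta>. Re (f (of_real r * \<zeta>) * cnj (f (of_real r * \<zeta>))) \<partial>circle_measure)"
      unfolding p_def by (rule integral_Re[symmetric])
    then show ?thesis by (simp only: circle_mean_def complex_norm_square[symmetric] Re_complex_of_real)
  qed
  have pm: "Re (p r' s') \<le> Re (p r'' s'')"
    if "0 \<le> r'" "r' < 1" "0 \<le> s'" "s' < 1" "0 \<le> r''" "r'' < 1" "0 \<le> s''" "s'' < 1" "r' * s' \<le> r'' * s''"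
    for r' s' r'' s''
    by (rule sums_le[OF _ rp rp]) (use that c(1) in \<open>auto intro!: mult_left_mono power_mono\<close>)
  have r1: "r < 1" "0 \<le> s" using rs by auto
  show "circle_mean f r \<le> circle_mean f s"
    using rs r1 by (simp add: mp) (intro pm; simp add: mult_mono)
  have "(\<integral>\<zeta>. (cmod (f (of_real s * \<zeta>) - f (of_real r * \<zeta>)))\<^sup>2 \<partial>circle_measure) =
    (\<integral>\<zeta>. (cmod (f (of_real s * \<zeta>)))\<^sup>2 + (cmod (f (of_real r * \<zeta>)))\<^sup>2
        - 2 * Re (f (of_real r * \<zeta>) * cnj (f (of_real s * \<zeta>))) \<partial>circle_measure)"
    by (intro Bochner_Integration.integral_cong refl, unfold cmod_power2)
       (simp add: power2_eq_square algebra_simps)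
  also have "\<dots> = circle_mean f s + circle_mean f r - 2 * Re (p r s)"
  proof -
    have i1: "integrable circle_measure (\<lambda>\<zeta>. (cmod (f (of_real s * \<zeta>)))\<^sup>2)"
        "integrable circle_measure (\<lambda>\<zeta>. (cmod (f (of_real r * \<zeta>)))\<^sup>2)"
        "integrable circle_measure (\<lambda>\<zeta>. f (of_real r * \<zeta>) * cnj (f (of_real s * \<zeta>)))"
      using rs r1 by (intro integrable_circle_continuous continuous_intros continuous_on_dilation f; simp)+
    define C where "C \<zeta> = Re (f (of_real r * \<zeta>) * cnj (f (of_real s * \<zeta>)))" for \<zeta>
    have "integrable circle_measure C" unfolding C_def using i1(3) by (rule integrable_Re)
    moreover have "Re (p r s) = (\<integral>\<zeta>. C \<zeta> \<partial>circle_measure)"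
      unfolding p_def C_def using i1(3) by (rule integral_Re[symmetric])
    ultimately show ?thesis
      unfolding C_def[symmetric] circle_mean_def using i1(1,2) by simp
  qed
  also have "\<dots> \<le> circle_mean f s - circle_mean f r"
  proof -
    have "Re (p r r) \<le> Re (p r s)" using rs r1 by (intro pm) (auto intro: mult_left_mono)
    then show ?thesis using mp[of r] rs r1 by simp
  qed
  finally show "(\<integral>\<zeta>. (cmod (f (of_real s * \<zeta>) - f (of_real r * \<zeta>)))\<^sup>2 \<partial>circle_measure)
      \<le> circle_mean f s - circle_mean f r" .
qed

text \<open>The dilation by \<open>b < 1\<close> is holomorphic beyond the closed disk, so
  \<open>radial_maximal_inequality\<close> applies to it; then \<open>b\<close> tends to 1. The
  first absolute moment is bounded by the root of the second because a variance is
  nonnegative.\<close>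

lemma radial_maximal_inequality_L2:
  assumes f: "f holomorphic_on ball 0 1" and l: "l > 0"
    and B: "\<And>r. \<lbrakk>0 \<le> r; r < 1\<rbrakk> \<Longrightarrow> circle_mean f r \<le> B"
  shows "l * measure circle_measure {\<zeta>\<in>sphere 0 1. \<exists>s\<in>{0..<1}. l < cmod (f (of_real s * \<zeta>))}
    \<le> 1920 * sqrt B"
proof -
  define S where "S b = {\<zeta>\<in>sphere 0 1. \<exists>s\<in>{0..<b}. l < cmod (f (of_real s * \<zeta>))}" for b
  have Sm: "S b \<in> sets circle_measure" if "b \<le> 1" for b
    unfolding S_def by (rule radial_superlevel_measurable[OF f that])
  have bd: "l * measure circle_measure (S b) \<le> 1920 * sqrt B" if b: "0 < b" "b < 1" for b
  proof -
    define F where "F z = f (of_real b * z)" for z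
    have F: "F holomorphic_on ball 0 (1 / b)" unfolding F_def by (rule holomorphic_dilation[OF f b(1)])
    have cF: "continuous_on (sphere 0 1) F" unfolding F_def using b by (intro continuous_on_dilation f) auto
    have "S b \<subseteq> {\<zeta>\<in>sphere 0 1. \<exists>s\<in>{0..<1}. l < cmod (F (of_real s * \<zeta>))}"
    proof
      fix \<zeta> assume "\<zeta> \<in> S b"
      then obtain s where s: "\<zeta> \<in> sphere 0 1" "0 \<le> s" "s < b" "l < cmod (f (of_real s * \<zeta>))"
        unfolding S_def by auto
      then show "\<zeta> \<in> {\<zeta>\<in>sphere 0 1. \<exists>s\<in>{0..<1}. l < cmod (F (of_real s * \<zeta>))}"
        using b by (auto simp: F_def intro!: bexI[of _ "s / b"])
    qed
    moreover have "1 \<le> 1 / b" using b by simp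
    then have "F holomorphic_on ball 0 1" by (intro holomorphic_on_subset[OF F] subset_ball)
    ultimately have "measure circle_measure (S b) \<le>
        measure circle_measure {\<zeta>\<in>sphere 0 1. \<exists>s\<in>{0..<1}. l < cmod (F (of_real s * \<zeta>))}"
      by (intro circle.finite_measure_mono radial_superlevel_measurable) auto
    then have "l * measure circle_measure (S b) \<le>
        l * measure circle_measure {\<zeta>\<in>sphere 0 1. \<exists>s\<in>{0..<1}. l < cmod (F (of_real s * \<zeta>))}"
      using l by simp
    also have "\<dots> \<le> 1920 * (\<integral>\<zeta>. cmod (F \<zeta>) \<partial>circle_measure)"
      using b by (intro radial_maximal_inequality[OF F _ l]) auto
    also have "(\<integral>\<zeta>. cmod (F \<zeta>) \<partial>circle_measure) \<le> sqrt B"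
    proof (rule real_le_rsqrt)
      have "(\<integral>\<zeta>. cmod (F \<zeta>) \<partial>circle_measure)\<^sup>2 \<le> (\<integral>\<zeta>. (cmod (F \<zeta>))\<^sup>2 \<partial>circle_measure)"
        using circle.variance_eq[of "\<lambda>\<zeta>. cmod (F \<zeta>)"] circle.variance_positive[of "\<lambda>\<zeta>. cmod (F \<zeta>)"]
        by (simp add: integrable_circle_continuous continuous_on_norm continuous_on_power cF)
      also have "\<dots> = circle_mean f b" by (simp add: circle_mean_def F_def)
      also have "\<dots> \<le> B" using b by (intro B) auto
      finally show "(\<integral>\<zeta>. cmod (F \<zeta>) \<partial>circle_measure)\<^sup>2 \<le> B" .
    qed
    finally show ?thesis by simp
  qed
  define b where "b n = 1 - 1 / (real n + 2)" for n
  have b: "0 < b n" "b n < 1" for n by (auto simp: b_def field_simps)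
  have S1: "S 1 = (\<Union>n. S (b n))"
  proof
    show "S 1 \<subseteq> (\<Union>n. S (b n))"
    proof
      fix \<zeta> assume "\<zeta> \<in> S 1"
      then obtain s where s: "\<zeta> \<in> sphere 0 1" "0 \<le> s" "s < 1" "l < cmod (f (of_real s * \<zeta>))"
        unfolding S_def by auto
      obtain n where n: "1 / (1 - s) < real n" using reals_Archimedean2 by blast
      have "1 / (1 - s) < real n + 2" using n by simp
      then have "s < b n" using s by (simp add: b_def field_simps)
      with s have "\<zeta> \<in> S (b n)" unfolding S_def by auto
      then show "\<zeta> \<in> (\<Union>n. S (b n))" by blast
    qed
    show "(\<Union>n. S (b n)) \<subseteq> S 1"
      using b(2) unfolding S_def by (fastforce intro: less_trans)
  qed
  have "incseq (\<lambda>n. S (b n))"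
  proof (rule incseq_SucI)
    fix n
    have "b n \<le> b (Suc n)" by (simp add: b_def frac_le)
    then show "S (b n) \<subseteq> S (b (Suc n))" unfolding S_def by fastforce
  qed
  moreover have "range (\<lambda>n. S (b n)) \<subseteq> sets circle_measure" using Sm b less_imp_le by blast
  ultimately have "(\<lambda>n. measure circle_measure (S (b n))) \<longlonglongrightarrow> measure circle_measure (S 1)"
    unfolding S1 by (intro circle.finite_Lim_measure_incseq)
  then have "(\<lambda>n. l * measure circle_measure (S (b n))) \<longlonglongrightarrow> l * measure circle_measure (S 1)"
    by (intro tendsto_intros)
  then have "l * measure circle_measure (S 1) \<le> 1920 * sqrt B"
    by (rule LIMSEQ_le_const2) (use bd b in blast)
  then show ?thesis unfolding S_def .
qed

text \<open>Cauchy's criterion with countable quantifiers over \<open>k\<close> and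
  \<open>n\<close>. This form allows almost-everywhere statements for the single \<open>k\<close> to
  be combined, and it exhibits the set of convergence as Borel.\<close>

lemma left_limit_Cauchy_iff:
  fixes h :: "real \<Rightarrow> complex"
  shows "(\<exists>l. (h \<longlongrightarrow> l) (at_left 1)) \<longleftrightarrow>
    (\<forall>k. \<exists>n. \<forall>r\<in>{1 - 1 / real (n + 2)<..<1}. \<forall>s\<in>{1 - 1 / real (n + 2)<..<1}. cmod (h r - h s) \<le> 1 / real (k + 1))"
    (is "_ \<longleftrightarrow> ?C")
proof
  assume "\<exists>l. (h \<longlongrightarrow> l) (at_left 1)"
  then obtain l where l: "(h \<longlongrightarrow> l) (at_left 1)" by blast
  show ?C
  proof
    fix k :: nat
    have "\<forall>\<^sub>F r in at_left 1. dist (h r) l < 1 / (2 * real (k + 1))"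
      using l by (rule tendstoD) simp
    then obtain b where b: "b < 1" "\<And>r. b < r \<Longrightarrow> r < 1 \<Longrightarrow> dist (h r) l < 1 / (2 * real (k + 1))"
      unfolding eventually_at_left_field by blast
    obtain n where n: "1 / (1 - b) < real n" using reals_Archimedean2 by blast
    have "1 / (1 - b) < real (n + 2)" using n by simp
    then have bn: "b < 1 - 1 / real (n + 2)" using b(1) by (simp add: field_simps)
    show "\<exists>n. \<forall>r\<in>{1 - 1 / real (n + 2)<..<1}. \<forall>s\<in>{1 - 1 / real (n + 2)<..<1}. cmod (h r - h s) \<le> 1 / real (k + 1)"
    proof (intro exI[of _ n] ballI)
      fix r s assume "r \<in> {1 - 1 / real (n + 2)<..<1}" "s \<in> {1 - 1 / real (n + 2)<..<1}"
      then have "dist (h r) l < 1 / (2 * real (k + 1))" "dist (h s) l < 1 / (2 * real (k + 1))"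
        using bn b(2)[of r] b(2)[of s] by auto
      then have "dist (h r) (h s) \<le> 1 / (2 * real (k + 1)) + 1 / (2 * real (k + 1))"
        using dist_triangle2[of "h r" "h s" l] by linarith
      also have "\<dots> = 1 / real (k + 1)" by (simp add: field_simps)
      finally show "cmod (h r - h s) \<le> 1 / real (k + 1)" by (simp add: dist_norm)
    qed
  qed
next
  assume C: ?C
  \<comment> \<open>The offset 3 puts \<open>x n\<close> strictly inside the open interval that
    starts at \<open>1 - 1 / real (n + 2)\<close>.\<close>
  define x where "x n = 1 - 1 / real (n + 3)" for n
  have x: "1 - 1 / real (m + 2) < x n" "x n < 1" if "n \<ge> m" for m n
    using that by (auto simp: x_def frac_less2)
  have "Cauchy (\<lambda>n. h (x n))"
  proof (rule metric_CauchyI)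
    fix e :: real assume "e > 0"
    then obtain k where k: "1 / real (k + 1) < e"
      using reals_Archimedean[of e] by (auto simp: inverse_eq_divide)
    obtain m where m: "\<And>r s. r \<in> {1 - 1 / real (m + 2)<..<1} \<Longrightarrow> s \<in> {1 - 1 / real (m + 2)<..<1} \<Longrightarrow>
        cmod (h r - h s) \<le> 1 / real (k + 1)" using C by blast
    have "dist (h (x i)) (h (x j)) < e" if "i \<ge> m" "j \<ge> m" for i j
      using m[of "x i" "x j"] x[OF that(1)] x[OF that(2)] k by (simp add: dist_norm)
    then show "\<exists>M. \<forall>i\<ge>M. \<forall>j\<ge>M. dist (h (x i)) (h (x j)) < e" by blast
  qed
  then obtain l where l: "(\<lambda>n. h (x n)) \<longlonglongrightarrow> l" using Cauchy_convergent convergent_def by blast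
  have "(h \<longlongrightarrow> l) (at_left 1)"
  proof (rule tendstoI)
    fix e :: real assume "e > 0"
    then obtain k where k: "1 / real (k + 1) < e"
      using reals_Archimedean[of e] by (auto simp: inverse_eq_divide)
    obtain m where m: "\<And>r s. r \<in> {1 - 1 / real (m + 2)<..<1} \<Longrightarrow> s \<in> {1 - 1 / real (m + 2)<..<1} \<Longrightarrow>
        cmod (h r - h s) \<le> 1 / real (k + 1)" using C by blast
    have "dist (h r) l < e" if r: "1 - 1 / real (m + 2) < r" "r < 1" for r
    proof -
      have "(\<lambda>n. cmod (h r - h (x n))) \<longlonglongrightarrow> cmod (h r - l)" by (intro tendsto_intros l)
      then have "cmod (h r - l) \<le> 1 / real (k + 1)"
        by (rule LIMSEQ_le_const2) (use m x r in \<open>auto intro!: exI[of _ m]\<close>)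
      then show ?thesis using k by (simp add: dist_norm)
    qed
    then show "\<forall>\<^sub>F r in at_left 1. dist (h r) l < e"
      unfolding eventually_at_left_field by (intro exI[of _ "1 - 1 / real (m + 2)"]) auto
  qed
  then show "\<exists>l. (h \<longlongrightarrow> l) (at_left 1)" by blast
qed

section \<open>Radial limits\<close>

theorem fatou_radial_limit:
  assumes f: "f holomorphic_on ball 0 1" and B: "\<And>r. \<lbrakk>0 \<le> r; r < 1\<rbrakk> \<Longrightarrow> circle_mean f r \<le> B"
  shows "AE \<zeta> in circle_measure. \<exists>l. ((\<lambda>r. f (of_real r * \<zeta>)) \<longlongrightarrow> l) (at_left 1)"
proof -
  define L where "L = (SUP r\<in>{0..<1}. circle_mean f r)"
  have bdd: "bdd_above (circle_mean f ` {0..<1})" using B by (intro bdd_aboveI[of _ B]) auto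
  have meanL: "circle_mean f r \<le> L" if "0 \<le> r" "r < 1" for r
    unfolding L_def using that by (intro cSUP_upper bdd) auto
  \<comment> \<open>The difference of \<open>f\<close> and its dilation by \<open>\<rho>\<close>
    compares the radii \<open>s\<close> and \<open>\<rho> * s\<close>. For
    \<open>s \<ge> \<rho>\<close> the smaller one is at least \<open>\<rho>\<^sup>2\<close>, so it
    is the mean at the square that has to be close to the supremum.\<close>
  have "\<exists>\<rho>. 0 < \<rho> \<and> \<rho> < 1 \<and> L - circle_mean f (\<rho>\<^sup>2) < (1 / real (j + 1))\<^sup>2" for j
  proof -
    have "L - (1 / real (j + 1))\<^sup>2 < L" by simp
    then obtain r where r: "0 \<le> r" "r < 1" "L - (1 / real (j + 1))\<^sup>2 < circle_mean f r"
      unfolding L_def using less_cSUP_iff[OF _ bdd] by auto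
    \<comment> \<open>The maximum with \<open>1/2\<close> keeps \<open>\<rho>\<close> positive, as
      \<open>holomorphic_dilation\<close> requires.\<close>
    define \<rho> where "\<rho> = sqrt (max r (1/2))"
    have \<rho>: "\<rho>\<^sup>2 = max r (1/2)" "0 < \<rho>" "\<rho> < 1" using r by (auto simp: \<rho>_def)
    have "circle_mean f r \<le> circle_mean f (\<rho>\<^sup>2)"
      unfolding \<rho>(1) using r by (intro circle_mean_mono[OF f]) auto
    with r \<rho> show ?thesis by (intro exI[of _ \<rho>]) auto
  qed
  then obtain \<rho> where \<rho>: "\<And>j. 0 < \<rho> j" "\<And>j. \<rho> j < 1"
      "\<And>j. L - circle_mean f ((\<rho> j)\<^sup>2) < (1 / real (j + 1))\<^sup>2" by metis
  define g where "g j z = f z - f (of_real (\<rho> j) * z)" for j z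
  have g: "g j holomorphic_on ball 0 1" for j
  proof -
    have "(\<lambda>z. f (of_real (\<rho> j) * z)) holomorphic_on ball 0 1"
      using \<rho>(1,2)[of j] by (intro holomorphic_on_subset[OF holomorphic_dilation[OF f \<rho>(1)]] subset_ball) simp
    then show ?thesis unfolding g_def by (intro holomorphic_intros f)
  qed
  have gB: "circle_mean (g j) r \<le> (1 / real (j + 1))\<^sup>2" if r: "0 \<le> r" "r < 1" for j r
  proof -
    define s where "s = max r (\<rho> j)"
    have s: "0 \<le> s" "s < 1" "r \<le> s" "\<rho> j \<le> s" using r \<rho>[of j] by (auto simp: s_def)
    have \<rho>s: "0 \<le> \<rho> j * s" "\<rho> j * s \<le> s" "\<rho> j * s < 1" "(\<rho> j)\<^sup>2 \<le> \<rho> j * s"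
      using s \<rho>(1,2)[of j] by (auto simp: mult_left_le_one_le power2_eq_square less_imp_le
          intro!: mult_left_mono intro: le_less_trans[OF mult_left_le_one_le])
    have "circle_mean (g j) r \<le> circle_mean (g j) s" by (rule circle_mean_mono(1)[OF g r(1) s(3,2)])
    also have "\<dots> = (\<integral>\<zeta>. (cmod (f (of_real s * \<zeta>) - f (of_real (\<rho> j * s) * \<zeta>)))\<^sup>2 \<partial>circle_measure)"
      by (simp add: circle_mean_def g_def mult.assoc)
    also have "\<dots> \<le> circle_mean f s - circle_mean f (\<rho> j * s)"
      by (rule circle_mean_mono(2)[OF f \<rho>s(1,2) s(2)])
    also have "\<dots> \<le> L - circle_mean f ((\<rho> j)\<^sup>2)"
      using meanL[OF s(1,2)] circle_mean_mono(1)[OF f _ \<rho>s(4,3)] by auto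
    finally show ?thesis using \<rho>(3)[of j] by linarith
  qed
  have "AE \<zeta> in circle_measure. \<exists>n. \<forall>r\<in>{1 - 1 / real (n + 2)<..<1}. \<forall>s\<in>{1 - 1 / real (n + 2)<..<1}.
      cmod (f (of_real r * \<zeta>) - f (of_real s * \<zeta>)) \<le> 1 / real (k + 1)" for k
  proof -
    define e where "e = 1 / (3 * real (k + 1))"
    have e: "e > 0" "3 * e = 1 / real (k + 1)" by (auto simp: e_def field_simps)
    define S where "S j = {\<zeta>\<in>sphere 0 1. \<exists>s\<in>{0..<1}. e < cmod (g j (of_real s * \<zeta>))}" for j
    have Sm: "S j \<in> sets circle_measure" for j
      unfolding S_def by (rule radial_superlevel_measurable[OF g]) simp
    have "e * measure circle_measure (S j) \<le> 1920 * sqrt ((1 / real (j + 1))\<^sup>2)" for j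
      unfolding S_def by (rule radial_maximal_inequality_L2[OF g e(1) gB])
    then have "e * measure circle_measure (S j) \<le> 1920 * (1 / real (j + 1))" for j
      by (simp only: real_sqrt_abs abs_of_nonneg[OF divide_nonneg_nonneg] of_nat_0_le_iff zero_le_one)
    then have Sj: "measure circle_measure (S j) \<le> 1920 / e * (1 / real (j + 1))" for j
      using e(1) by (simp only: times_divide_eq_left pos_le_divide_eq mult.commute[of _ e])
    have Nm: "(\<Inter>j. S j) \<in> sets circle_measure" using Sm by auto
    \<comment> \<open>Points where every \<open>g j\<close> is large somewhere on the radius form a
      null set. At any other point some \<open>g j\<close> stays within \<open>e\<close> along the
      whole radius, and the remaining dilation of \<open>f\<close> is continuous up to the circle,
      so \<open>f\<close> oscillates by at most \<open>3 * e\<close> near the end.\<close>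
    have "measure circle_measure (\<Inter>j. S j) \<le> 0"
    proof (rule LIMSEQ_le_const)
      have "(\<lambda>j. 1920 / e * (1 / real (j + 1))) \<longlonglongrightarrow> 1920 / e * 0"
        using LIMSEQ_Suc[OF lim_1_over_n] by (intro tendsto_intros) simp
      then show "(\<lambda>j. 1920 / e * (1 / real (j + 1))) \<longlonglongrightarrow> 0" by simp
      have "measure circle_measure (\<Inter>j. S j) \<le> measure circle_measure (S j)" for j
        using Sm by (intro circle.finite_measure_mono) auto
      with Sj show "\<exists>N. \<forall>j\<ge>N. measure circle_measure (\<Inter>j. S j) \<le> 1920 / e * (1 / real (j + 1))"
        using order_trans by blast
    qed
    then have "measure circle_measure (\<Inter>j. S j) = 0" by (simp add: measure_le_0_iff)
    then have "emeasure circle_measure (\<Inter>j. S j) = 0" by (simp add: circle.emeasure_eq_measure)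
    then have "AE \<zeta> in circle_measure. \<zeta> \<notin> (\<Inter>j. S j)"
      using Nm by (intro AE_not_in) auto
    then show ?thesis
    proof (rule AE_mp[OF _ AE_I2], intro impI)
      fix \<zeta> assume "\<zeta> \<in> space circle_measure" "\<zeta> \<notin> (\<Inter>j. S j)"
      then obtain j where z: "cmod \<zeta> = 1" and "\<zeta> \<notin> S j" by auto
      then have j: "cmod (g j (of_real s * \<zeta>)) \<le> e" if "0 \<le> s" "s < 1" for s
        using that unfolding S_def by (auto simp: not_less)
      have "((\<lambda>r. f (of_real (\<rho> j) * (of_real r * \<zeta>))) \<longlongrightarrow> f (of_real (\<rho> j) * (of_real 1 * \<zeta>))) (at_left 1)"
      proof -
        have "continuous_on (ball 0 1) f" by (rule holomorphic_on_imp_continuous_on[OF f])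
        then have "isCont f (of_real (\<rho> j) * (of_real 1 * \<zeta>))"
          using z \<rho>(1,2)[of j] by (simp add: continuous_on_eq_continuous_at norm_mult)
        moreover have "((\<lambda>r. of_real (\<rho> j) * (of_real r * \<zeta>)) \<longlongrightarrow> of_real (\<rho> j) * (of_real 1 * \<zeta>)) (at_left 1)"
          by (intro tendsto_intros)
        ultimately show ?thesis by (rule isCont_tendsto_compose)
      qed
      then have "\<exists>l. ((\<lambda>r. f (of_real (\<rho> j) * (of_real r * \<zeta>))) \<longlongrightarrow> l) (at_left 1)" by blast
      then obtain n where n: "\<And>r s. \<lbrakk>r \<in> {1 - 1 / real (n + 2)<..<1}; s \<in> {1 - 1 / real (n + 2)<..<1}\<rbrakk> \<Longrightarrow>
          cmod (f (of_real (\<rho> j) * (of_real r * \<zeta>)) - f (of_real (\<rho> j) * (of_real s * \<zeta>))) \<le> 1 / real ((3 * k + 2) + 1)"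
        unfolding left_limit_Cauchy_iff by blast
      \<comment> \<open>The index \<open>3 * k + 2\<close> was chosen so that its tolerance
        \<open>1 / (3 * k + 3)\<close> is exactly \<open>e\<close>; three such errors make
        \<open>1 / (k + 1)\<close>.\<close>
      have e': "1 / real ((3 * k + 2) + 1) = e" by (simp add: e_def)
      show "\<exists>n. \<forall>r\<in>{1 - 1 / real (n + 2)<..<1}. \<forall>s\<in>{1 - 1 / real (n + 2)<..<1}.
          cmod (f (of_real r * \<zeta>) - f (of_real s * \<zeta>)) \<le> 1 / real (k + 1)"
      proof (intro exI[of _ n] ballI)
        fix r s assume rs: "r \<in> {1 - 1 / real (n + 2)<..<1}" "s \<in> {1 - 1 / real (n + 2)<..<1}"
        have n1: "1 / real (n + 2) \<le> 1" by simp
        have rs0: "0 \<le> r" "r < 1" "0 \<le> s" "s < 1" using rs n1 unfolding greaterThanLessThan_iff by linarith+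
        define d where "d = f (of_real (\<rho> j) * (of_real r * \<zeta>)) - f (of_real (\<rho> j) * (of_real s * \<zeta>))"
        have "f (of_real r * \<zeta>) - f (of_real s * \<zeta>) =
            g j (of_real r * \<zeta>) - g j (of_real s * \<zeta>) + d"
          by (simp add: g_def d_def)
        also have "cmod \<dots> \<le> cmod (g j (of_real r * \<zeta>)) + cmod (g j (of_real s * \<zeta>)) + cmod d"
          using norm_triangle_ineq[of "g j (of_real r * \<zeta>) - g j (of_real s * \<zeta>)" d]
            norm_triangle_ineq4[of "g j (of_real r * \<zeta>)" "g j (of_real s * \<zeta>)"] by linarith
        also have "\<dots> \<le> e + e + e"
          using j[OF rs0(1,2)] j[OF rs0(3,4)] n[OF rs] unfolding d_def e' by (intro add_mono)
        finally show "cmod (f (of_real r * \<zeta>) - f (of_real s * \<zeta>)) \<le> 1 / real (k + 1)"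
          using e(2) by linarith
      qed
    qed
  qed
  then have "AE \<zeta> in circle_measure. \<forall>k. \<exists>n. \<forall>r\<in>{1 - 1 / real (n + 2)<..<1}. \<forall>s\<in>{1 - 1 / real (n + 2)<..<1}.
      cmod (f (of_real r * \<zeta>) - f (of_real s * \<zeta>)) \<le> 1 / real (k + 1)"
    unfolding AE_all_countable by blast
  then show ?thesis by (simp only: left_limit_Cauchy_iff)
qed

text \<open>A fixed sequence of radii, because the limit theorems for integrals are
  sequential.\<close>

definition radius_seq :: "nat \<Rightarrow> real" where
  "radius_seq n = 1 - 1 / real (n + 2)"

lemma radius_seq: "0 \<le> radius_seq n" "radius_seq n < 1"
  by (auto simp: radius_seq_def)

lemma radius_seq_tendsto: "radius_seq \<longlonglongrightarrow> 1"
proof -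
  have "(\<lambda>n. 1 / real (n + 2)) \<longlonglongrightarrow> 0" using LIMSEQ_ignore_initial_segment[OF lim_1_over_n, of 2] by simp
  from tendsto_diff[OF tendsto_const this, of 1] show ?thesis unfolding radius_seq_def by simp
qed

lemma radius_seq_at_left: "filterlim radius_seq (at_left 1) sequentially"
  using radius_seq radius_seq_tendsto by (intro tendsto_imp_filterlim_at_left) auto

text \<open>Without a radial limit \<open>Lim\<close> returns one fixed value, so
  \<open>boundary f\<close> is constant off the set of convergence and a sequential limit of
  continuous functions on it. That set is a countable combination of the closed sets
  \<open>D k n\<close>.\<close>

lemma boundary_measurable:
  assumes f: "f holomorphic_on ball 0 1"
  shows "boundary f \<in> borel_measurable circle_measure"
proof -
  define C where "C \<zeta> \<longleftrightarrow> (\<exists>l. ((\<lambda>r. f (of_real r * \<zeta>)) \<longlongrightarrow> l) (at_left 1))" for \<zeta>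
  define D where "D k n = {\<zeta>\<in>sphere 0 1. \<forall>r\<in>{1 - 1 / real (n + 2)<..<1}. \<forall>s\<in>{1 - 1 / real (n + 2)<..<1}.
      cmod (f (of_real r * \<zeta>) - f (of_real s * \<zeta>)) \<le> 1 / real (k + 1)}" for k n
  have "closed (D k n)" for k n
  proof -
    have eq: "D k n = sphere 0 1 \<inter> (\<Inter>r\<in>{1 - 1 / real (n + 2)<..<1}. \<Inter>s\<in>{1 - 1 / real (n + 2)<..<1}.
        sphere 0 1 \<inter> (\<lambda>\<zeta>. cmod (f (of_real r * \<zeta>) - f (of_real s * \<zeta>))) -` {.. 1 / real (k + 1)})"
      unfolding D_def by auto
    have n1: "1 / real (n + 2) \<le> 1" by simp
    show ?thesis unfolding eq
    proof (rule closed_Int[OF closed_sphere], intro closed_INT ballI)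
      fix r s assume "r \<in> {1 - 1 / real (n + 2)<..<1}" "s \<in> {1 - 1 / real (n + 2)<..<1}"
      then have rs: "0 \<le> r" "r < 1" "0 \<le> s" "s < 1" using n1 unfolding greaterThanLessThan_iff by linarith+
      show "closed (sphere 0 1 \<inter> (\<lambda>\<zeta>. cmod (f (of_real r * \<zeta>) - f (of_real s * \<zeta>))) -` {.. 1 / real (k + 1)})"
        by (intro continuous_closed_preimage continuous_intros continuous_on_dilation[OF f] rs) auto
    qed
  qed
  moreover have "{\<zeta> \<in> space circle_measure. C \<zeta>} = (\<Inter>k. \<Union>n. D k n)"
    unfolding C_def left_limit_Cauchy_iff D_def by auto
  ultimately have CS [measurable]: "{\<zeta> \<in> space circle_measure. C \<zeta>} \<in> sets circle_measure"
    unfolding sets_circle_measure_iff by (auto intro!: borel_closed)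
  have [measurable]: "(\<lambda>\<zeta>. f (of_real (radius_seq n) * \<zeta>)) \<in> borel_measurable circle_measure" for n
    by (intro borel_measurable_dilation[OF f] radius_seq)
  have "boundary f \<zeta> = (if C \<zeta> then lim (\<lambda>n. f (of_real (radius_seq n) * \<zeta>)) else (THE l. False))" for \<zeta>
  proof (cases "C \<zeta>")
    case True
    then obtain l where l: "((\<lambda>r. f (of_real r * \<zeta>)) \<longlongrightarrow> l) (at_left 1)" unfolding C_def by blast
    have "(\<lambda>n. f (of_real (radius_seq n) * \<zeta>)) \<longlonglongrightarrow> l" by (rule filterlim_compose[OF l radius_seq_at_left])
    then show ?thesis using True l by (simp add: boundary_def tendsto_Lim limI)
  next
    case False
    then show ?thesis unfolding C_def boundary_def t2_space_class.Lim_def by simp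
  qed
  moreover have "(\<lambda>\<zeta>. if C \<zeta> then lim (\<lambda>n. f (of_real (radius_seq n) * \<zeta>)) else (THE l. False)) \<in> borel_measurable circle_measure"
    by measurable
  ultimately show ?thesis by (simp cong: measurable_cong)
qed

lemma H2_iff:
  "f \<in> H2 \<longleftrightarrow> f holomorphic_on ball 0 1 \<and> (\<forall>z. z \<notin> ball 0 1 \<longrightarrow> f z = 0) \<and>
    (\<exists>B. \<forall>r. 0 \<le> r \<longrightarrow> r < 1 \<longrightarrow> circle_mean f r \<le> B)"
proof -
  have "(\<exists>M. \<forall>x\<in>circle_mean f ` {0..<1}. x \<le> M) \<longleftrightarrow> (\<exists>B. \<forall>r. 0 \<le> r \<longrightarrow> r < 1 \<longrightarrow> circle_mean f r \<le> B)"
    by (rule arg_cong[where f = Ex], rule ext) auto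
  then show ?thesis unfolding H2_def bdd_above_def circle_mean_def[abs_def] by simp
qed

lemma H2_holomorphic: "f \<in> H2 \<Longrightarrow> f holomorphic_on ball 0 1"
  and H2_off_disk: "f \<in> H2 \<Longrightarrow> \<not> cmod z < 1 \<Longrightarrow> f z = 0"
  by (auto simp: H2_iff)

lemma boundary_tendsto:
  assumes "f \<in> H2"
  shows "AE \<zeta> in circle_measure. ((\<lambda>r. f (of_real r * \<zeta>)) \<longlongrightarrow> boundary f \<zeta>) (at_left 1)"
proof -
  have "AE \<zeta> in circle_measure. \<exists>l. ((\<lambda>r. f (of_real r * \<zeta>)) \<longlongrightarrow> l) (at_left 1)"
    using assms fatou_radial_limit unfolding H2_iff by blast
  then show ?thesis
    by (rule AE_mp[OF _ AE_I2]) (auto simp: boundary_def tendsto_Lim)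
qed

section \<open>Square-integrable functions on the circle\<close>

definition circle_L2 :: "(complex \<Rightarrow> complex) set" where
  "circle_L2 = {F \<in> borel_measurable circle_measure. integrable circle_measure (\<lambda>\<zeta>. (cmod (F \<zeta>))\<^sup>2)}"

lemma circle_L2_measurable: "F \<in> circle_L2 \<Longrightarrow> F \<in> borel_measurable circle_measure"
  by (simp add: circle_L2_def)

lemma circle_L2_integrable: "F \<in> circle_L2 \<Longrightarrow> integrable circle_measure (\<lambda>\<zeta>. (cmod (F \<zeta>))\<^sup>2)"
  by (simp add: circle_L2_def)

lemma borel_measurable_cnj [measurable (raw)]:
  "f \<in> borel_measurable M \<Longrightarrow> (\<lambda>x. cnj (f x)) \<in> borel_measurable M"
  by (erule measurable_compose) (intro borel_measurable_continuous_onI continuous_intros)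

lemma circle_L2_prod_integrable:
  assumes "F \<in> circle_L2" "G \<in> circle_L2"
  shows "integrable circle_measure (\<lambda>\<zeta>. F \<zeta> * cnj (G \<zeta>))"
proof (rule Bochner_Integration.integrable_bound)
  show "integrable circle_measure (\<lambda>\<zeta>. (cmod (F \<zeta>))\<^sup>2 + (cmod (G \<zeta>))\<^sup>2)"
    using assms by (intro Bochner_Integration.integrable_add circle_L2_integrable)
  have [measurable]: "F \<in> borel_measurable circle_measure" "G \<in> borel_measurable circle_measure"
    using assms by (simp_all add: circle_L2_def)
  show "(\<lambda>\<zeta>. F \<zeta> * cnj (G \<zeta>)) \<in> borel_measurable circle_measure"
    by measurable
  have "cmod (F \<zeta>) * cmod (G \<zeta>) \<le> (cmod (F \<zeta>))\<^sup>2 + (cmod (G \<zeta>))\<^sup>2" for \<zeta>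
    using sum_squares_bound[of "cmod (F \<zeta>)" "cmod (G \<zeta>)"]
      mult_nonneg_nonneg[OF norm_ge_zero[of "F \<zeta>"] norm_ge_zero[of "G \<zeta>"]] by linarith
  then show "AE \<zeta> in circle_measure. norm (F \<zeta> * cnj (G \<zeta>)) \<le> norm ((cmod (F \<zeta>))\<^sup>2 + (cmod (G \<zeta>))\<^sup>2)"
    by (intro AE_I2) (simp add: norm_mult)
qed

lemma cmod_add_squared_le: "(cmod (u + v))\<^sup>2 \<le> 2 * (cmod u)\<^sup>2 + 2 * (cmod v)\<^sup>2"
proof -
  have "(cmod (u + v))\<^sup>2 \<le> (cmod u + cmod v)\<^sup>2" by (intro power_mono norm_triangle_ineq) auto
  also have "\<dots> \<le> 2 * (cmod u)\<^sup>2 + 2 * (cmod v)\<^sup>2"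
    using sum_squares_bound[of "cmod u" "cmod v"] by (simp add: power2_sum)
  finally show ?thesis .
qed

lemma circle_L2_add:
  assumes "F \<in> circle_L2" "G \<in> circle_L2"
  shows "(\<lambda>\<zeta>. F \<zeta> + G \<zeta>) \<in> circle_L2"
proof -
  have [measurable]: "F \<in> borel_measurable circle_measure" "G \<in> borel_measurable circle_measure"
    using assms by (simp_all add: circle_L2_def)
  have "integrable circle_measure (\<lambda>\<zeta>. (cmod (F \<zeta> + G \<zeta>))\<^sup>2)"
  proof (rule Bochner_Integration.integrable_bound)
    show "integrable circle_measure (\<lambda>\<zeta>. 2 * (cmod (F \<zeta>))\<^sup>2 + 2 * (cmod (G \<zeta>))\<^sup>2)"
      using assms by (intro Bochner_Integration.integrable_add integrable_mult_right circle_L2_integrable)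
    show "AE \<zeta> in circle_measure. norm ((cmod (F \<zeta> + G \<zeta>))\<^sup>2) \<le> norm (2 * (cmod (F \<zeta>))\<^sup>2 + 2 * (cmod (G \<zeta>))\<^sup>2)"
      by (intro AE_I2) (simp add: cmod_add_squared_le)
  qed measurable
  then show ?thesis by (simp add: circle_L2_def)
qed

lemma circle_L2_bounded_mult:
  assumes F: "F \<in> circle_L2" and [measurable]: "\<phi> \<in> borel_measurable circle_measure"
    and \<phi>: "AE \<zeta> in circle_measure. cmod (\<phi> \<zeta>) \<le> B"
  shows "(\<lambda>\<zeta>. \<phi> \<zeta> * F \<zeta>) \<in> circle_L2"
    and "(\<integral>\<zeta>. (cmod (\<phi> \<zeta> * F \<zeta>))\<^sup>2 \<partial>circle_measure) \<le> B\<^sup>2 * (\<integral>\<zeta>. (cmod (F \<zeta>))\<^sup>2 \<partial>circle_measure)"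
proof -
  have [measurable]: "F \<in> borel_measurable circle_measure" using F by (simp add: circle_L2_def)
  have i: "integrable circle_measure (\<lambda>\<zeta>. B\<^sup>2 * (cmod (F \<zeta>))\<^sup>2)"
    using F by (intro integrable_mult_right circle_L2_integrable)
  have le: "AE \<zeta> in circle_measure. (cmod (\<phi> \<zeta> * F \<zeta>))\<^sup>2 \<le> B\<^sup>2 * (cmod (F \<zeta>))\<^sup>2"
    using \<phi>
  proof (rule AE_mp[OF _ AE_I2], intro impI)
    fix \<zeta> assume "cmod (\<phi> \<zeta>) \<le> B"
    then have "(cmod (\<phi> \<zeta>))\<^sup>2 \<le> B\<^sup>2" by (intro power_mono) auto
    then show "(cmod (\<phi> \<zeta> * F \<zeta>))\<^sup>2 \<le> B\<^sup>2 * (cmod (F \<zeta>))\<^sup>2"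
      by (simp add: norm_mult power_mult_distrib mult_right_mono)
  qed
  have i2: "integrable circle_measure (\<lambda>\<zeta>. (cmod (\<phi> \<zeta> * F \<zeta>))\<^sup>2)"
    by (rule Bochner_Integration.integrable_bound[OF i]) (use le in auto)
  then show "(\<lambda>\<zeta>. \<phi> \<zeta> * F \<zeta>) \<in> circle_L2" by (simp add: circle_L2_def)
  have "(\<integral>\<zeta>. (cmod (\<phi> \<zeta> * F \<zeta>))\<^sup>2 \<partial>circle_measure) \<le> (\<integral>\<zeta>. B\<^sup>2 * (cmod (F \<zeta>))\<^sup>2 \<partial>circle_measure)"
    by (rule integral_mono_AE[OF i2 i le])
  then show "(\<integral>\<zeta>. (cmod (\<phi> \<zeta> * F \<zeta>))\<^sup>2 \<partial>circle_measure) \<le> B\<^sup>2 * (\<integral>\<zeta>. (cmod (F \<zeta>))\<^sup>2 \<partial>circle_measure)"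
    by simp
qed

lemma circle_L2_scale: "F \<in> circle_L2 \<Longrightarrow> (\<lambda>\<zeta>. c * F \<zeta>) \<in> circle_L2"
  by (rule circle_L2_bounded_mult[where B="cmod c"]) auto

lemma circle_L2_diff:
  assumes "F \<in> circle_L2" "G \<in> circle_L2"
  shows "(\<lambda>\<zeta>. F \<zeta> - G \<zeta>) \<in> circle_L2"
  using circle_L2_add[OF assms(1) circle_L2_scale[OF assms(2), of "-1"]] by simp

lemma circle_L2_continuous:
  assumes "continuous_on (sphere 0 1) F"
  shows "F \<in> circle_L2"
  unfolding circle_L2_def using assms
  by (auto intro!: borel_measurable_circle_continuous integrable_circle_continuous continuous_intros)

lemma L2_inner_self: "L2_inner F F = of_real (\<integral>\<zeta>. (cmod (F \<zeta>))\<^sup>2 \<partial>circle_measure)"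
  unfolding L2_inner_def
  by (simp only: complex_norm_square[symmetric] integral_complex_of_real)

lemma L2_inner_cnj: "cnj (L2_inner F G) = L2_inner G F"
  unfolding L2_inner_def by (simp add: mult.commute flip: Bochner_Integration.integral_cnj)

lemma L2_inner_add_left:
  assumes "F \<in> circle_L2" "G \<in> circle_L2" "H \<in> circle_L2"
  shows "L2_inner (\<lambda>\<zeta>. F \<zeta> + G \<zeta>) H = L2_inner F H + L2_inner G H"
  unfolding L2_inner_def
  using circle_L2_prod_integrable[OF assms(1,3)] circle_L2_prod_integrable[OF assms(2,3)]
  by (simp add: distrib_right)

lemma L2_inner_diff_left:
  assumes "F \<in> circle_L2" "G \<in> circle_L2" "H \<in> circle_L2"
  shows "L2_inner (\<lambda>\<zeta>. F \<zeta> - G \<zeta>) H = L2_inner F H - L2_inner G H"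
  unfolding L2_inner_def
  using circle_L2_prod_integrable[OF assms(1,3)] circle_L2_prod_integrable[OF assms(2,3)]
  by (simp add: left_diff_distrib)

lemma L2_inner_scale_left: "L2_inner (\<lambda>\<zeta>. c * F \<zeta>) H = c * L2_inner F H"
  unfolding L2_inner_def by (simp add: mult.assoc)

lemma L2_inner_cong_AE:
  assumes "AE \<zeta> in circle_measure. F \<zeta> = F' \<zeta>" "AE \<zeta> in circle_measure. G \<zeta> = G' \<zeta>"
    and [measurable]: "F \<in> borel_measurable circle_measure" "F' \<in> borel_measurable circle_measure"
      "G \<in> borel_measurable circle_measure" "G' \<in> borel_measurable circle_measure"
  shows "L2_inner F G = L2_inner F' G'"
  unfolding L2_inner_def
proof (rule integral_cong_AE)
  show "AE \<zeta> in circle_measure. F \<zeta> * cnj (G \<zeta>) = F' \<zeta> * cnj (G' \<zeta>)"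
    using assms(1,2) by eventually_elim simp
qed (intro borel_measurable_times borel_measurable_cnj assms(3-6))+

text \<open>The integral of \<open>(cmod (F \<zeta>) - t * cmod (G \<zeta>))\<^sup>2\<close> is a
  nonnegative quadratic in \<open>t\<close>; its discriminant gives the inequality for the
  moduli.\<close>

lemma L2_Cauchy_Schwarz:
  assumes F: "F \<in> circle_L2" and G: "G \<in> circle_L2"
  shows "(cmod (L2_inner F G))\<^sup>2 \<le>
    (\<integral>\<zeta>. (cmod (F \<zeta>))\<^sup>2 \<partial>circle_measure) * (\<integral>\<zeta>. (cmod (G \<zeta>))\<^sup>2 \<partial>circle_measure)"
proof -
  define A Q P where "A = (\<integral>\<zeta>. (cmod (F \<zeta>))\<^sup>2 \<partial>circle_measure)"
    and "Q = (\<integral>\<zeta>. (cmod (G \<zeta>))\<^sup>2 \<partial>circle_measure)" and "P = (\<integral>\<zeta>. cmod (F \<zeta>) * cmod (G \<zeta>) \<partial>circle_measure)"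
  have i: "integrable circle_measure (\<lambda>\<zeta>. (cmod (F \<zeta>))\<^sup>2)" "integrable circle_measure (\<lambda>\<zeta>. (cmod (G \<zeta>))\<^sup>2)"
      "integrable circle_measure (\<lambda>\<zeta>. cmod (F \<zeta>) * cmod (G \<zeta>))"
    using F G integrable_norm[OF circle_L2_prod_integrable[OF F G]]
    by (simp_all add: circle_L2_integrable norm_mult)
  have quad: "0 \<le> A - 2 * t * P + t\<^sup>2 * Q" for t
  proof -
    have "0 \<le> (\<integral>\<zeta>. (cmod (F \<zeta>) - t * cmod (G \<zeta>))\<^sup>2 \<partial>circle_measure)"
      by (intro Bochner_Integration.integral_nonneg) auto
    also have "\<dots> = (\<integral>\<zeta>. (cmod (F \<zeta>))\<^sup>2 - 2 * t * (cmod (F \<zeta>) * cmod (G \<zeta>)) + t\<^sup>2 * (cmod (G \<zeta>))\<^sup>2 \<partial>circle_measure)"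
      by (intro Bochner_Integration.integral_cong refl) (simp add: power2_eq_square algebra_simps)
    also have "\<dots> = A - 2 * t * P + t\<^sup>2 * Q" using i by (simp add: A_def P_def Q_def)
    finally show ?thesis .
  qed
  have "P\<^sup>2 \<le> A * Q"
  proof (cases "Q = 0")
    case True
    have "P = 0"
    proof (rule ccontr)
      assume "P \<noteq> 0"
      \<comment> \<open>For \<open>Q = 0\<close> the quadratic degenerates to a linear function of
        \<open>t\<close>, and this \<open>t\<close> is where it equals \<open>-1\<close>.\<close>
      then have "A - 2 * ((A + 1) / (2 * P)) * P = -1" by (simp add: field_simps)
      then show False using quad[of "(A + 1) / (2 * P)"] True by simp
    qed
    then show ?thesis using True by simp
  next
    case False
    have "Q \<ge> 0" unfolding Q_def by (intro Bochner_Integration.integral_nonneg) auto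
    then have Q: "Q > 0" using False by simp
    then have "A - 2 * (P / Q) * P + (P / Q)\<^sup>2 * Q = (A * Q - P\<^sup>2) / Q" by (simp add: field_simps power2_eq_square)
    then have "0 \<le> (A * Q - P\<^sup>2) / Q" using quad[of "P / Q"] by simp
    then show ?thesis using Q by (simp add: zero_le_divide_iff)
  qed
  moreover have "cmod (L2_inner F G) \<le> P"
    unfolding L2_inner_def P_def
    using integral_norm_bound[of circle_measure "\<lambda>\<zeta>. F \<zeta> * cnj (G \<zeta>)"] by (simp add: norm_mult)
  then have "(cmod (L2_inner F G))\<^sup>2 \<le> P\<^sup>2" by (intro power_mono) auto
  ultimately show ?thesis unfolding A_def Q_def by linarith
qed

text \<open>The tool for passing to boundary values: Fatou's lemma asks only for a uniform
  mean-square bound and convergence almost everywhere, with no dominating function.\<close>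

lemma circle_L2_Fatou:
  assumes F: "\<And>n. F n \<in> circle_L2" "\<And>n::nat. (\<integral>\<zeta>. (cmod (F n \<zeta>))\<^sup>2 \<partial>circle_measure) \<le> C"
    and G: "G \<in> borel_measurable circle_measure"
    and lim: "AE \<zeta> in circle_measure. (\<lambda>n. F n \<zeta>) \<longlonglongrightarrow> G \<zeta>"
  shows "G \<in> circle_L2" "(\<integral>\<zeta>. (cmod (G \<zeta>))\<^sup>2 \<partial>circle_measure) \<le> C"
proof -
  have [measurable]: "F n \<in> borel_measurable circle_measure" for n using F(1) by (simp add: circle_L2_def)
  note G [measurable]
  have "0 \<le> (\<integral>\<zeta>. (cmod (F 0 \<zeta>))\<^sup>2 \<partial>circle_measure)"
    by (rule Bochner_Integration.integral_nonneg) simp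
  with F(2)[of 0] have C0: "0 \<le> C" by linarith
  have "(\<integral>\<^sup>+\<zeta>. ennreal ((cmod (G \<zeta>))\<^sup>2) \<partial>circle_measure) =
      (\<integral>\<^sup>+\<zeta>. liminf (\<lambda>n. ennreal ((cmod (F n \<zeta>))\<^sup>2)) \<partial>circle_measure)"
  proof (rule nn_integral_cong_AE)
    show "AE \<zeta> in circle_measure. ennreal ((cmod (G \<zeta>))\<^sup>2) = liminf (\<lambda>n. ennreal ((cmod (F n \<zeta>))\<^sup>2))"
      using lim
    proof eventually_elim
      fix \<zeta> assume "(\<lambda>n. F n \<zeta>) \<longlonglongrightarrow> G \<zeta>"
      then have "(\<lambda>n. ennreal ((cmod (F n \<zeta>))\<^sup>2)) \<longlonglongrightarrow> ennreal ((cmod (G \<zeta>))\<^sup>2)"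
        by (intro tendsto_ennrealI tendsto_intros)
      then show "ennreal ((cmod (G \<zeta>))\<^sup>2) = liminf (\<lambda>n. ennreal ((cmod (F n \<zeta>))\<^sup>2))"
        by (intro lim_imp_Liminf[symmetric]) auto
    qed
  qed
  also have "\<dots> \<le> liminf (\<lambda>n. \<integral>\<^sup>+\<zeta>. ennreal ((cmod (F n \<zeta>))\<^sup>2) \<partial>circle_measure)"
    by (rule nn_integral_liminf) measurable
  also have "\<dots> \<le> ennreal C"
  proof -
    have "(\<integral>\<^sup>+\<zeta>. ennreal ((cmod (F n \<zeta>))\<^sup>2) \<partial>circle_measure) \<le> ennreal C" for n
      using F by (subst nn_integral_eq_integral) (auto simp: circle_L2_integrable intro: ennreal_leI)
    then have "liminf (\<lambda>n. \<integral>\<^sup>+\<zeta>. ennreal ((cmod (F n \<zeta>))\<^sup>2) \<partial>circle_measure) \<le> liminf (\<lambda>n::nat. ennreal C)"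
      by (intro Liminf_mono) auto
    then show ?thesis by (simp add: Liminf_const)
  qed
  finally have le: "(\<integral>\<^sup>+\<zeta>. ennreal ((cmod (G \<zeta>))\<^sup>2) \<partial>circle_measure) \<le> ennreal C" .
  have i: "integrable circle_measure (\<lambda>\<zeta>. (cmod (G \<zeta>))\<^sup>2)"
    unfolding integrable_iff_bounded using le_less_trans[OF le ennreal_less_top] by simp
  then show "G \<in> circle_L2" by (simp add: circle_L2_def)
  show "(\<integral>\<zeta>. (cmod (G \<zeta>))\<^sup>2 \<partial>circle_measure) \<le> C"
    using le i C0 by (subst (asm) nn_integral_eq_integral) auto
qed

section \<open>The Hardy space\<close>

lemma H2_dilation_L2:
  assumes "f \<in> H2" "0 \<le> r" "r < 1"
  shows "(\<lambda>\<zeta>. f (of_real r * \<zeta>)) \<in> circle_L2"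
  using assms by (intro circle_L2_continuous continuous_on_dilation H2_holomorphic)

lemma boundary_tendsto_seq:
  assumes "f \<in> H2"
  shows "AE \<zeta> in circle_measure. (\<lambda>n. f (of_real (radius_seq n) * \<zeta>)) \<longlonglongrightarrow> boundary f \<zeta>"
  using boundary_tendsto[OF assms] by eventually_elim (rule filterlim_compose[OF _ radius_seq_at_left])

lemma boundary_borel: "f \<in> H2 \<Longrightarrow> boundary f \<in> borel_measurable circle_measure"
  by (intro boundary_measurable H2_holomorphic)

lemma boundary_L2:
  assumes f: "f \<in> H2" and B: "\<And>r. \<lbrakk>0 \<le> r; r < 1\<rbrakk> \<Longrightarrow> circle_mean f r \<le> B"
  shows "boundary f \<in> circle_L2" "(\<integral>\<zeta>. (cmod (boundary f \<zeta>))\<^sup>2 \<partial>circle_measure) \<le> B"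
proof -
  have "(\<integral>\<zeta>. (cmod (f (of_real (radius_seq n) * \<zeta>)))\<^sup>2 \<partial>circle_measure) \<le> B" for n
    using B[OF radius_seq] by (simp add: circle_mean_def)
  then show "boundary f \<in> circle_L2" "(\<integral>\<zeta>. (cmod (boundary f \<zeta>))\<^sup>2 \<partial>circle_measure) \<le> B"
    using circle_L2_Fatou[OF H2_dilation_L2[OF f radius_seq] _ boundary_borel[OF f] boundary_tendsto_seq[OF f]]
    by blast+
qed

lemma boundary_in_L2:
  assumes "f \<in> H2" shows "boundary f \<in> circle_L2"
proof -
  obtain B where "\<And>r. \<lbrakk>0 \<le> r; r < 1\<rbrakk> \<Longrightarrow> circle_mean f r \<le> B" using assms unfolding H2_iff by blast
  then show ?thesis by (rule boundary_L2(1)[OF assms])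
qed

text \<open>The outer radius in \<open>circle_mean_mono\<close> tends to 1 while \<open>r\<close>
  stays fixed.\<close>

lemma boundary_dilation_distance:
  assumes f: "f \<in> H2" and r: "0 \<le> r" "r < 1"
    and B: "\<And>r. \<lbrakk>0 \<le> r; r < 1\<rbrakk> \<Longrightarrow> circle_mean f r \<le> B"
  shows "(\<integral>\<zeta>. (cmod (boundary f \<zeta> - f (of_real r * \<zeta>)))\<^sup>2 \<partial>circle_measure) \<le> B - circle_mean f r"
proof -
  have "\<forall>\<^sub>F n in sequentially. radius_seq n > r"
    using radius_seq_tendsto r(2) by (rule order_tendstoD)
  then obtain N where N: "\<And>n. n \<ge> N \<Longrightarrow> radius_seq n > r" unfolding eventually_sequentially by blast
  \<comment> \<open>The shift by \<open>N\<close> keeps the outer radius above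
    \<open>r\<close>.\<close>
  define F where "F n \<zeta> = f (of_real (radius_seq (n + N)) * \<zeta>) - f (of_real r * \<zeta>)" for n \<zeta>
  have "F n \<in> circle_L2" for n
    unfolding F_def by (intro circle_L2_diff H2_dilation_L2 f r radius_seq)
  moreover have "(\<integral>\<zeta>. (cmod (F n \<zeta>))\<^sup>2 \<partial>circle_measure) \<le> B - circle_mean f r" for n
  proof -
    have "(\<integral>\<zeta>. (cmod (F n \<zeta>))\<^sup>2 \<partial>circle_measure) \<le> circle_mean f (radius_seq (n + N)) - circle_mean f r"
      unfolding F_def using N[of "n + N"] r radius_seq
      by (intro circle_mean_mono(2)[OF H2_holomorphic[OF f]]) auto
    also have "\<dots> \<le> B - circle_mean f r" using B[OF radius_seq] by simp
    finally show ?thesis .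
  qed
  moreover have "(\<lambda>\<zeta>. boundary f \<zeta> - f (of_real r * \<zeta>)) \<in> borel_measurable circle_measure"
    by (intro borel_measurable_diff boundary_borel f borel_measurable_dilation H2_holomorphic r)
  moreover have "AE \<zeta> in circle_measure. (\<lambda>n. F n \<zeta>) \<longlonglongrightarrow> boundary f \<zeta> - f (of_real r * \<zeta>)"
    using boundary_tendsto_seq[OF f] unfolding F_def
    by eventually_elim (intro tendsto_diff tendsto_const LIMSEQ_ignore_initial_segment)
  ultimately show ?thesis by (rule circle_L2_Fatou(2))
qed

text \<open>The means increase to their supremum \<open>L\<close>, and the distance at a radius is
  at most \<open>L\<close> minus the mean there.\<close>

lemma boundary_dilation_tendsto:
  assumes f: "f \<in> H2"
  shows "(\<lambda>n. \<integral>\<zeta>. (cmod (boundary f \<zeta> - f (of_real (radius_seq n) * \<zeta>)))\<^sup>2 \<partial>circle_measure) \<longlonglongrightarrow> 0"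
proof -
  define L where "L = (SUP r\<in>{0..<1}. circle_mean f r)"
  obtain B where "\<And>r. \<lbrakk>0 \<le> r; r < 1\<rbrakk> \<Longrightarrow> circle_mean f r \<le> B" using f unfolding H2_iff by blast
  then have bdd: "bdd_above (circle_mean f ` {0..<1})" by (intro bdd_aboveI[of _ B]) auto
  have leL: "circle_mean f r \<le> L" if "0 \<le> r" "r < 1" for r
    unfolding L_def using that by (intro cSUP_upper bdd) auto
  have "(\<lambda>n. circle_mean f (radius_seq n)) \<longlonglongrightarrow> L"
  proof (rule LIMSEQ_I)
    fix e :: real assume "e > 0"
    then have "L - e < L" by simp
    then obtain r where r: "0 \<le> r" "r < 1" "L - e < circle_mean f r"
      unfolding L_def using less_cSUP_iff[OF _ bdd] by auto
    have "\<forall>\<^sub>F n in sequentially. radius_seq n > r"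
      using radius_seq_tendsto r(2) by (rule order_tendstoD)
    then obtain N where N: "\<And>n. n \<ge> N \<Longrightarrow> radius_seq n > r" unfolding eventually_sequentially by blast
    have "norm (circle_mean f (radius_seq n) - L) < e" if "n \<ge> N" for n
    proof -
      have "circle_mean f r \<le> circle_mean f (radius_seq n)"
        using N[OF that] r radius_seq by (intro circle_mean_mono(1) H2_holomorphic f) auto
      then show ?thesis using leL[OF radius_seq, of n] r(3) by simp
    qed
    then show "\<exists>N. \<forall>n\<ge>N. norm (circle_mean f (radius_seq n) - L) < e" by blast
  qed
  from tendsto_diff[OF tendsto_const this, of L]
  have "(\<lambda>n. L - circle_mean f (radius_seq n)) \<longlonglongrightarrow> 0" by simp
  then show ?thesis
  proof (rule tendsto_sandwich[OF _ _ tendsto_const, rotated 2])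
    show "\<forall>\<^sub>F n in sequentially. (\<integral>\<zeta>. (cmod (boundary f \<zeta> - f (of_real (radius_seq n) * \<zeta>)))\<^sup>2 \<partial>circle_measure)
        \<le> L - circle_mean f (radius_seq n)"
      by (intro always_eventually allI boundary_dilation_distance f radius_seq leL)
    show "\<forall>\<^sub>F n in sequentially. 0 \<le> (\<integral>\<zeta>. (cmod (boundary f \<zeta> - f (of_real (radius_seq n) * \<zeta>)))\<^sup>2 \<partial>circle_measure)"
      by (intro always_eventually allI Bochner_Integration.integral_nonneg) simp
  qed
qed

lemma L2_inner_dilation_tendsto:
  assumes f: "f \<in> H2" and G: "G \<in> circle_L2"
  shows "(\<lambda>n. L2_inner (\<lambda>\<zeta>. f (of_real (radius_seq n) * \<zeta>)) G) \<longlonglongrightarrow> L2_inner (boundary f) G"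
proof -
  define d where "d n = (\<integral>\<zeta>. (cmod (boundary f \<zeta> - f (of_real (radius_seq n) * \<zeta>)))\<^sup>2 \<partial>circle_measure)" for n
  define Q where "Q = (\<integral>\<zeta>. (cmod (G \<zeta>))\<^sup>2 \<partial>circle_measure)"
  have "(\<lambda>n. sqrt (d n * Q)) \<longlonglongrightarrow> sqrt (0 * Q)"
    unfolding d_def by (intro tendsto_intros boundary_dilation_tendsto f)
  then have lim: "(\<lambda>n. sqrt (d n * Q)) \<longlonglongrightarrow> 0" by simp
  have "cmod (L2_inner (\<lambda>\<zeta>. f (of_real (radius_seq n) * \<zeta>)) G - L2_inner (boundary f) G) \<le> sqrt (d n * Q)" for n
  proof -
    have "cmod (L2_inner (\<lambda>\<zeta>. f (of_real (radius_seq n) * \<zeta>)) G - L2_inner (boundary f) G)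
      = cmod (L2_inner (\<lambda>\<zeta>. boundary f \<zeta> - f (of_real (radius_seq n) * \<zeta>)) G)"
      by (simp add: L2_inner_diff_left boundary_in_L2 f G H2_dilation_L2 radius_seq norm_minus_commute)
    also have "\<dots> \<le> sqrt (d n * Q)"
      unfolding d_def Q_def
      by (intro real_le_rsqrt L2_Cauchy_Schwarz circle_L2_diff boundary_in_L2 f G H2_dilation_L2 radius_seq)
    finally show ?thesis .
  qed
  then have "(\<lambda>n. L2_inner (\<lambda>\<zeta>. f (of_real (radius_seq n) * \<zeta>)) G - L2_inner (boundary f) G) \<longlonglongrightarrow> 0"
    by (intro Lim_null_comparison[OF _ lim] always_eventually allI)
  then show ?thesis by (rule LIM_zero_cancel)
qed

section \<open>Reproducing kernel, norm and completeness\<close>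

definition szego_kernel :: "complex \<Rightarrow> complex \<Rightarrow> complex" where
  "szego_kernel z w = 1 / (1 - cnj z * w)"

lemma szego_kernel_continuous: "cmod z < 1 \<Longrightarrow> continuous_on (cball 0 1) (szego_kernel z)"
  unfolding szego_kernel_def
  by (intro continuous_intros ballI one_minus_cnj_mult_nonzero(1)) auto

lemma szego_kernel_L2: "cmod z < 1 \<Longrightarrow> szego_kernel z \<in> circle_L2"
  by (intro circle_L2_continuous continuous_on_subset[OF szego_kernel_continuous]) auto

lemma szego_kernel_bound:
  assumes "cmod z < 1" "cmod w \<le> 1"
  shows "cmod (szego_kernel z w) \<le> 1 / (1 - cmod z)"
proof -
  have "cmod (cnj z * w) \<le> cmod z" using assms by (simp add: norm_mult mult_left_le)
  then have "1 - cmod z \<le> cmod (1 - cnj z * w)" using norm_triangle_ineq2[of 1 "cnj z * w"] by simp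
  then show ?thesis unfolding szego_kernel_def using assms
    by (simp add: norm_divide frac_le)
qed

text \<open>The Cauchy formula holds for each dilation. Mean-square convergence carries its left
  side to the boundary, continuity of \<open>f\<close> carries its right side to \<open>f z\<close>.
  Thus boundary values, known only almost everywhere, determine the function on the disk.\<close>

lemma boundary_reproducing:
  assumes f: "f \<in> H2" and z: "cmod z < 1"
  shows "L2_inner (boundary f) (szego_kernel z) = f z"
proof -
  have "L2_inner (\<lambda>\<zeta>. f (of_real r * \<zeta>)) (szego_kernel z) = f (of_real r * z)" if r: "0 < r" "r < 1" for r
  proof -
    have "(\<integral>\<zeta>. f (of_real r * \<zeta>) / (1 - z * cnj \<zeta>) \<partial>circle_measure) = f (of_real r * z)"
      using r by (intro cauchy_formula_circle[OF holomorphic_dilation[OF H2_holomorphic[OF f] r(1)] _ z]) auto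
    then show ?thesis by (simp add: L2_inner_def szego_kernel_def)
  qed
  moreover have "0 < radius_seq n" for n by (auto simp: radius_seq_def field_simps)
  ultimately have "(\<lambda>n. f (of_real (radius_seq n) * z)) \<longlonglongrightarrow> L2_inner (boundary f) (szego_kernel z)"
    using L2_inner_dilation_tendsto[OF f szego_kernel_L2[OF z]] radius_seq by simp
  moreover have "(\<lambda>n. f (of_real (radius_seq n) * z)) \<longlonglongrightarrow> f (of_real 1 * z)"
  proof -
    have "continuous_on (ball 0 1) f" by (intro holomorphic_on_imp_continuous_on H2_holomorphic f)
    then have "isCont f (of_real 1 * z)" using z by (simp add: continuous_on_eq_continuous_at)
    moreover have "(\<lambda>n. of_real (radius_seq n) * z) \<longlonglongrightarrow> of_real 1 * z"
      by (intro tendsto_intros radius_seq_tendsto)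
    ultimately show ?thesis by (rule isCont_tendsto_compose)
  qed
  ultimately have "L2_inner (boundary f) (szego_kernel z) = f (of_real 1 * z)" by (rule LIMSEQ_unique)
  then show ?thesis by simp
qed

definition H2_sqnorm :: "(complex \<Rightarrow> complex) \<Rightarrow> real" where
  "H2_sqnorm f = (\<integral>\<zeta>. (cmod (boundary f \<zeta>))\<^sup>2 \<partial>circle_measure)"

lemma H2_sqnorm_nonneg: "0 \<le> H2_sqnorm f"
  unfolding H2_sqnorm_def by (intro Bochner_Integration.integral_nonneg) auto

lemma H2_inner_self: "H2_inner f f = of_real (H2_sqnorm f)"
  by (simp add: H2_inner_def H2_sqnorm_def L2_inner_self)

text \<open>Cauchy-Schwarz against the kernel, whose norm is estimated by its supremum. The bound
  turns norm convergence into uniform convergence on smaller disks.\<close>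

lemma H2_point_bound:
  assumes f: "f \<in> H2" and z: "cmod z < 1"
  shows "cmod (f z) \<le> sqrt (H2_sqnorm f) / (1 - cmod z)"
proof -
  have "(\<integral>\<zeta>. (cmod (szego_kernel z \<zeta>))\<^sup>2 \<partial>circle_measure) \<le> (\<integral>\<zeta>. (1 / (1 - cmod z))\<^sup>2 \<partial>circle_measure)"
    using szego_kernel_bound[OF z]
    by (intro Bochner_Integration.integral_mono circle_L2_integrable szego_kernel_L2 z power_mono) auto
  also have "\<dots> = (1 / (1 - cmod z))\<^sup>2" using circle.prob_space by simp
  finally have "H2_sqnorm f * (\<integral>\<zeta>. (cmod (szego_kernel z \<zeta>))\<^sup>2 \<partial>circle_measure) \<le> H2_sqnorm f * (1 / (1 - cmod z))\<^sup>2"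
    by (intro mult_left_mono H2_sqnorm_nonneg)
  with L2_Cauchy_Schwarz[OF boundary_in_L2[OF f] szego_kernel_L2[OF z]]
  have "(cmod (f z))\<^sup>2 \<le> H2_sqnorm f * (1 / (1 - cmod z))\<^sup>2"
    unfolding boundary_reproducing[OF f z] H2_sqnorm_def[symmetric] by linarith
  also have "\<dots> = (sqrt (H2_sqnorm f) / (1 - cmod z))\<^sup>2"
    by (simp add: power_divide H2_sqnorm_nonneg)
  finally show ?thesis
    by (rule power2_le_imp_le) (use z H2_sqnorm_nonneg[of f] in simp)
qed

text \<open>Converse of the Fatou bound in \<open>boundary_L2\<close>: the boundary norm controls
  all interior means, because the dilations converge to the boundary function in mean square and
  their means increase.\<close>

lemma circle_mean_le_sqnorm:
  assumes f: "f \<in> H2" and r: "0 \<le> r" "r < 1"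
  shows "circle_mean f r \<le> H2_sqnorm f"
proof (rule field_le_epsilon)
  fix e :: real assume e: "e > 0"
  define d where "d n = (\<integral>\<zeta>. (cmod (boundary f \<zeta> - f (of_real (radius_seq n) * \<zeta>)))\<^sup>2 \<partial>circle_measure)" for n
  \<comment> \<open>Splitting a square with weights \<open>1 + t\<close> and
    \<open>1 + 1 / t\<close> costs \<open>H2_sqnorm f * t\<close> in the first term. This is made at
    most \<open>e / 2\<close> first; the radius is chosen afterwards to make the second term
    small.\<close>
  obtain t where t: "t > 0" "H2_sqnorm f * t \<le> e / 2"
  proof
    show "e / 2 / (H2_sqnorm f + 1) > 0" using e H2_sqnorm_nonneg[of f] by (intro divide_pos_pos) auto
    have "H2_sqnorm f * (e / 2 / (H2_sqnorm f + 1)) = (e / 2) * (H2_sqnorm f / (H2_sqnorm f + 1))" by simp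
    also have "\<dots> \<le> (e / 2) * 1" using e H2_sqnorm_nonneg[of f] by (intro mult_left_mono) (auto simp: divide_le_eq)
    finally show "H2_sqnorm f * (e / 2 / (H2_sqnorm f + 1)) \<le> e / 2" by simp
  qed
  have "\<forall>\<^sub>F n in sequentially. (1 + 1 / t) * d n < e / 2"
  proof (rule order_tendstoD)
    show "(\<lambda>n. (1 + 1 / t) * d n) \<longlonglongrightarrow> (1 + 1 / t) * 0"
      unfolding d_def by (intro tendsto_intros boundary_dilation_tendsto f)
  qed (use e in simp)
  moreover have "\<forall>\<^sub>F n in sequentially. radius_seq n > r"
    using radius_seq_tendsto r(2) by (rule order_tendstoD)
  ultimately have "\<forall>\<^sub>F n in sequentially. (1 + 1 / t) * d n < e / 2 \<and> radius_seq n > r" by eventually_elim simp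
  then obtain n where n: "(1 + 1 / t) * d n < e / 2" "radius_seq n > r"
    unfolding eventually_sequentially by blast
  have iB: "integrable circle_measure (\<lambda>\<zeta>. (cmod (boundary f \<zeta>))\<^sup>2)"
    and iD: "integrable circle_measure (\<lambda>\<zeta>. (cmod (boundary f \<zeta> - f (of_real (radius_seq n) * \<zeta>)))\<^sup>2)"
    by (intro circle_L2_integrable circle_L2_diff boundary_in_L2 f H2_dilation_L2 radius_seq)+
  have sq: "(cmod v)\<^sup>2 \<le> (1 + t) * (cmod u)\<^sup>2 + (1 + 1 / t) * (cmod (u - v))\<^sup>2" for u v
  proof -
    have "cmod v \<le> cmod u + cmod (u - v)" using norm_triangle_ineq4[of u "u - v"] by simp
    then have "(cmod v)\<^sup>2 \<le> (cmod u + cmod (u - v))\<^sup>2" by (intro power_mono) auto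
    also have "\<dots> = (cmod u)\<^sup>2 + (cmod (u - v))\<^sup>2 + 2 * (cmod u * cmod (u - v))" by (simp add: power2_sum)
    also have "2 * (cmod u * cmod (u - v)) \<le> t * (cmod u)\<^sup>2 + 1 / t * (cmod (u - v))\<^sup>2"
    proof -
      have "0 \<le> (t * cmod u - cmod (u - v))\<^sup>2 / t" using t by simp
      also have "\<dots> = t * (cmod u)\<^sup>2 + 1 / t * (cmod (u - v))\<^sup>2 - 2 * (cmod u * cmod (u - v))"
        using t by (simp add: power2_eq_square field_simps)
      finally show ?thesis by simp
    qed
    finally show ?thesis by (simp add: algebra_simps)
  qed
  have "circle_mean f r \<le> circle_mean f (radius_seq n)"
    using n r radius_seq by (intro circle_mean_mono(1) H2_holomorphic f) auto
  also have "\<dots> \<le> (\<integral>\<zeta>. (1 + t) * (cmod (boundary f \<zeta>))\<^sup>2 +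
      (1 + 1 / t) * (cmod (boundary f \<zeta> - f (of_real (radius_seq n) * \<zeta>)))\<^sup>2 \<partial>circle_measure)"
    unfolding circle_mean_def
    by (intro Bochner_Integration.integral_mono sq Bochner_Integration.integrable_add integrable_mult_right
        iB iD circle_L2_integrable H2_dilation_L2 f radius_seq)
  also have "\<dots> = (1 + t) * H2_sqnorm f + (1 + 1 / t) * d n"
    using iB iD by (simp add: H2_sqnorm_def d_def)
  also have "(1 + t) * H2_sqnorm f = H2_sqnorm f + H2_sqnorm f * t" by (simp add: algebra_simps)
  also have "\<dots> + (1 + 1 / t) * d n \<le> H2_sqnorm f + e" using n(1) t(2) by linarith
  finally show "circle_mean f r \<le> H2_sqnorm f + e" .
qed

lemma H2_sqnorm_le:
  assumes "f \<in> H2" "\<And>r. \<lbrakk>0 \<le> r; r < 1\<rbrakk> \<Longrightarrow> circle_mean f r \<le> B"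
  shows "H2_sqnorm f \<le> B"
  unfolding H2_sqnorm_def by (rule boundary_L2(2)[OF assms])

lemma H2_sqnorm_eq_0:
  assumes "f \<in> H2" "H2_sqnorm f = 0" shows "f = (\<lambda>z. 0)"
proof
  show "f z = 0" for z
    using H2_point_bound[OF assms(1), of z] H2_off_disk[OF assms(1), of z] assms(2)
    by (cases "cmod z < 1") simp_all
qed

lemma H2_zero: "(\<lambda>z. 0) \<in> H2"
  unfolding H2_iff by (auto simp: circle_mean_def)

lemma H2_scale:
  assumes "f \<in> H2" shows "(\<lambda>z. c * f z) \<in> H2"
proof -
  obtain B where B: "\<And>r. \<lbrakk>0 \<le> r; r < 1\<rbrakk> \<Longrightarrow> circle_mean f r \<le> B" using assms unfolding H2_iff by blast
  have "circle_mean (\<lambda>z. c * f z) r = (cmod c)\<^sup>2 * circle_mean f r" for r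
    by (simp add: circle_mean_def norm_mult power_mult_distrib)
  then have "circle_mean (\<lambda>z. c * f z) r \<le> (cmod c)\<^sup>2 * B" if "0 \<le> r" "r < 1" for r
    using B[OF that] by (simp add: mult_left_mono)
  then show ?thesis
    using assms by (auto simp: H2_iff intro!: holomorphic_intros)
qed

lemma H2_add:
  assumes f: "f \<in> H2" and g: "g \<in> H2" shows "(\<lambda>z. f z + g z) \<in> H2"
proof -
  obtain B where B: "\<And>r. \<lbrakk>0 \<le> r; r < 1\<rbrakk> \<Longrightarrow> circle_mean f r \<le> B" using f unfolding H2_iff by blast
  obtain C where C: "\<And>r. \<lbrakk>0 \<le> r; r < 1\<rbrakk> \<Longrightarrow> circle_mean g r \<le> C" using g unfolding H2_iff by blast
  have "circle_mean (\<lambda>z. f z + g z) r \<le> 2 * B + 2 * C" if r: "0 \<le> r" "r < 1" for r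
  proof -
    have i: "integrable circle_measure (\<lambda>\<zeta>. (cmod (f (of_real r * \<zeta>)))\<^sup>2)"
        "integrable circle_measure (\<lambda>\<zeta>. (cmod (g (of_real r * \<zeta>)))\<^sup>2)"
        "integrable circle_measure (\<lambda>\<zeta>. (cmod (f (of_real r * \<zeta>) + g (of_real r * \<zeta>)))\<^sup>2)"
      by (intro circle_L2_integrable circle_L2_add H2_dilation_L2 f g r)+
    have "circle_mean (\<lambda>z. f z + g z) r \<le>
        (\<integral>\<zeta>. 2 * (cmod (f (of_real r * \<zeta>)))\<^sup>2 + 2 * (cmod (g (of_real r * \<zeta>)))\<^sup>2 \<partial>circle_measure)"
      unfolding circle_mean_def
      by (intro Bochner_Integration.integral_mono i Bochner_Integration.integrable_add integrable_mult_right
          cmod_add_squared_le)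
    also have "\<dots> = 2 * circle_mean f r + 2 * circle_mean g r" using i by (simp add: circle_mean_def)
    finally show ?thesis using B[OF r] C[OF r] by linarith
  qed
  then show ?thesis
    using f g by (auto simp: H2_iff intro!: holomorphic_intros)
qed

lemma H2_diff: "f \<in> H2 \<Longrightarrow> g \<in> H2 \<Longrightarrow> (\<lambda>z. f z - g z) \<in> H2"
  using H2_add[of f "\<lambda>z. -1 * g z"] H2_scale[of g "-1"] by simp

lemma boundary_add_AE:
  assumes "f \<in> H2" "g \<in> H2"
  shows "AE \<zeta> in circle_measure. boundary (\<lambda>z. f z + g z) \<zeta> = boundary f \<zeta> + boundary g \<zeta>"
  using boundary_tendsto[OF assms(1)] boundary_tendsto[OF assms(2)]
  by eventually_elim (subst boundary_def, intro tendsto_Lim tendsto_add; simp)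

lemma boundary_scale_AE:
  assumes "f \<in> H2"
  shows "AE \<zeta> in circle_measure. boundary (\<lambda>z. c * f z) \<zeta> = c * boundary f \<zeta>"
  using boundary_tendsto[OF assms]
  by eventually_elim (subst boundary_def, intro tendsto_Lim tendsto_mult_left; simp)

lemma L2_inner_boundary_add:
  assumes "f \<in> H2" "g \<in> H2" "G \<in> circle_L2"
  shows "L2_inner (boundary (\<lambda>z. f z + g z)) G = L2_inner (boundary f) G + L2_inner (boundary g) G"
proof -
  have "L2_inner (boundary (\<lambda>z. f z + g z)) G = L2_inner (\<lambda>\<zeta>. boundary f \<zeta> + boundary g \<zeta>) G"
    using assms by (intro L2_inner_cong_AE boundary_add_AE)
      (auto intro!: boundary_borel circle_L2_measurable[OF assms(3)] H2_add borel_measurable_add)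
  also have "\<dots> = L2_inner (boundary f) G + L2_inner (boundary g) G"
    by (intro L2_inner_add_left boundary_in_L2 assms)
  finally show ?thesis .
qed

lemma L2_inner_boundary_scale:
  assumes "f \<in> H2" "G \<in> circle_L2"
  shows "L2_inner (boundary (\<lambda>z. c * f z)) G = c * L2_inner (boundary f) G"
proof -
  have "L2_inner (boundary (\<lambda>z. c * f z)) G = L2_inner (\<lambda>\<zeta>. c * boundary f \<zeta>) G"
    using assms by (intro L2_inner_cong_AE boundary_scale_AE)
      (auto intro!: boundary_borel circle_L2_measurable[OF assms(2)] H2_scale borel_measurable_times)
  then show ?thesis by (simp add: L2_inner_scale_left)
qed

lemma H2_inner_add_left:
  "\<lbrakk>f \<in> H2; g \<in> H2; h \<in> H2\<rbrakk> \<Longrightarrow> H2_inner (\<lambda>z. f z + g z) h = H2_inner f h + H2_inner g h"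
  unfolding H2_inner_def by (intro L2_inner_boundary_add boundary_in_L2)

lemma H2_inner_scale_left: "\<lbrakk>f \<in> H2; h \<in> H2\<rbrakk> \<Longrightarrow> H2_inner (\<lambda>z. c * f z) h = c * H2_inner f h"
  unfolding H2_inner_def by (intro L2_inner_boundary_scale boundary_in_L2)

lemma H2_inner_cnj: "cnj (H2_inner f h) = H2_inner h f"
  unfolding H2_inner_def by (rule L2_inner_cnj)

text \<open>The point bound makes the sequence uniformly Cauchy on smaller disks, which gives a
  holomorphic limit. Fatou's lemma on each circle of radius \<open>r < 1\<close> then bounds the
  means of \<open>f n - g\<close>, which yields both membership in \<open>H2\<close> and norm
  convergence.\<close>

lemma H2_Cauchy_limit:
  fixes f :: "nat \<Rightarrow> complex \<Rightarrow> complex"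
  assumes f: "\<And>n. f n \<in> H2"
    and C: "\<And>e. e > 0 \<Longrightarrow> \<exists>N. \<forall>m\<ge>N. \<forall>n\<ge>N. H2_sqnorm (\<lambda>z. f m z - f n z) \<le> e\<^sup>2"
  obtains g where "g \<in> H2" "\<And>e. e > 0 \<Longrightarrow> \<exists>N. \<forall>n\<ge>N. H2_sqnorm (\<lambda>z. f n z - g z) \<le> e\<^sup>2"
proof -
  have uc: "uniformly_Cauchy_on (cball 0 r) f" if r: "0 \<le> r" "r < 1" for r
  proof (rule uniformly_Cauchy_onI)
    fix e :: real assume e: "e > 0"
    have "e * (1 - r) / 2 > 0" using e r by simp
    from C[OF this] obtain N where N: "\<And>m n. \<lbrakk>m \<ge> N; n \<ge> N\<rbrakk> \<Longrightarrow> H2_sqnorm (\<lambda>z. f m z - f n z) \<le> (e * (1 - r) / 2)\<^sup>2"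
      by blast
    have "dist (f m z) (f n z) < e" if z: "z \<in> cball 0 r" and mn: "m \<ge> N" "n \<ge> N" for z m n
    proof -
      have z1: "cmod z \<le> r" "cmod z < 1" using z r by auto
      have "sqrt (H2_sqnorm (\<lambda>z. f m z - f n z)) \<le> e * (1 - r) / 2"
        using N[OF mn] e r by (intro real_le_lsqrt) auto
      then have "sqrt (H2_sqnorm (\<lambda>z. f m z - f n z)) / (1 - cmod z) \<le> (e * (1 - r) / 2) / (1 - r)"
        using z1 r e by (intro frac_le) auto
      also have "(e * (1 - r) / 2) / (1 - r) = e / 2" using r by (simp add: divide_simps)
      finally have "sqrt (H2_sqnorm (\<lambda>z. f m z - f n z)) / (1 - cmod z) \<le> e / 2" .
      moreover have "cmod (f m z - f n z) \<le> sqrt (H2_sqnorm (\<lambda>z. f m z - f n z)) / (1 - cmod z)"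
        by (rule H2_point_bound[OF H2_diff[OF f f] z1(2)])
      ultimately show ?thesis using e unfolding dist_norm by linarith
    qed
    then show "\<exists>M. \<forall>x\<in>cball 0 r. \<forall>m\<ge>M. \<forall>n\<ge>M. dist (f m x) (f n x) < e" by blast
  qed
  define g where "g z = lim (\<lambda>n. f n z)" for z
  have ul: "uniform_limit (cball 0 r) f g sequentially" if "0 \<le> r" "r < 1" for r
    unfolding g_def using Cauchy_uniformly_convergent[OF uc[OF that]]
    by (simp add: uniformly_convergent_uniform_limit_iff)
  have pw: "(\<lambda>n. f n z) \<longlonglongrightarrow> g z" if "cmod z < 1" for z
    using tendsto_uniform_limitI[OF ul[of "cmod z"], of z] that by auto
  have hol: "g holomorphic_on ball 0 1"
  proof (rule holomorphic_uniform_sequence[of _ f])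
    fix z :: complex assume z: "z \<in> ball 0 1"
    obtain r where r: "cmod z < r" "r < 1" using z dense by auto
    have sub: "cball z (r - cmod z) \<subseteq> cball 0 r"
    proof
      fix w assume "w \<in> cball z (r - cmod z)"
      then have "cmod (z - w) \<le> r - cmod z" by (simp add: dist_norm)
      then show "w \<in> cball 0 r" using norm_triangle_ineq4[of z "z - w"] by simp
    qed
    have r0: "0 \<le> r" using r(1) norm_ge_zero[of z] by linarith
    have "cball 0 r \<subseteq> ball (0::complex) 1" using r by auto
    then show "\<exists>d>0. cball z d \<subseteq> ball 0 1 \<and> uniform_limit (cball z d) f g sequentially"
      using r uniform_limit_on_subset[OF ul[OF r0 r(2)] sub] sub
      by (intro exI[of _ "r - cmod z"]) auto
  qed (use f H2_holomorphic in auto)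
  have off: "g z = 0" if "\<not> cmod z < 1" for z
    unfolding g_def using H2_off_disk[OF f that] by (simp add: limI)
  have key: "circle_mean (\<lambda>z. f n z - g z) r \<le> e\<^sup>2"
    if N: "\<And>m n. \<lbrakk>m \<ge> N; n \<ge> N\<rbrakk> \<Longrightarrow> H2_sqnorm (\<lambda>z. f m z - f n z) \<le> e\<^sup>2"
      and n: "n \<ge> N" and r: "0 \<le> r" "r < 1" for n N r e
    unfolding circle_mean_def
  proof (rule circle_L2_Fatou(2))
    show "(\<lambda>\<zeta>. f n (of_real r * \<zeta>) - f (m + N) (of_real r * \<zeta>)) \<in> circle_L2" for m
      by (intro circle_L2_diff H2_dilation_L2 f r)
    show "(\<integral>\<zeta>. (cmod (f n (of_real r * \<zeta>) - f (m + N) (of_real r * \<zeta>)))\<^sup>2 \<partial>circle_measure) \<le> e\<^sup>2" for m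
    proof -
      have "circle_mean (\<lambda>z. f n z - f (m + N) z) r \<le> H2_sqnorm (\<lambda>z. f n z - f (m + N) z)"
        by (intro circle_mean_le_sqnorm H2_diff f r)
      also have "\<dots> \<le> e\<^sup>2" using n by (intro N) auto
      finally show ?thesis by (simp add: circle_mean_def)
    qed
    show "(\<lambda>\<zeta>. f n (of_real r * \<zeta>) - g (of_real r * \<zeta>)) \<in> borel_measurable circle_measure"
      by (intro borel_measurable_diff borel_measurable_dilation H2_holomorphic f hol r)
    show "AE \<zeta> in circle_measure. (\<lambda>m. f n (of_real r * \<zeta>) - f (m + N) (of_real r * \<zeta>))
        \<longlonglongrightarrow> f n (of_real r * \<zeta>) - g (of_real r * \<zeta>)"
      using r by (intro AE_I2 tendsto_diff tendsto_const LIMSEQ_ignore_initial_segment pw) (simp add: norm_mult)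
  qed
  have diffH2: "(\<lambda>z. f n z - g z) \<in> H2"
    if N: "\<And>m n. \<lbrakk>m \<ge> N; n \<ge> N\<rbrakk> \<Longrightarrow> H2_sqnorm (\<lambda>z. f m z - f n z) \<le> e\<^sup>2" and n: "n \<ge> N" for n N e
    unfolding H2_iff
  proof (intro conjI allI impI exI)
    show "(\<lambda>z. f n z - g z) holomorphic_on ball 0 1"
      by (intro holomorphic_intros H2_holomorphic f hol)
    show "f n z - g z = 0" if "z \<notin> ball 0 1" for z using that off H2_off_disk[OF f] by simp
    show "circle_mean (\<lambda>z. f n z - g z) r \<le> e\<^sup>2" if "0 \<le> r" "r < 1" for r
      by (rule key[OF N n that])
  qed
  show ?thesis
  proof (rule that)
    obtain N where N: "\<And>m n. \<lbrakk>m \<ge> N; n \<ge> N\<rbrakk> \<Longrightarrow> H2_sqnorm (\<lambda>z. f m z - f n z) \<le> 1\<^sup>2"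
      using C[of 1] by auto
    have "(\<lambda>z. f N z - (f N z - g z)) \<in> H2" by (intro H2_diff f diffH2[OF N]) auto
    then show "g \<in> H2" by simp
    fix e :: real assume "e > 0"
    from C[OF this] obtain N where N: "\<And>m n. \<lbrakk>m \<ge> N; n \<ge> N\<rbrakk> \<Longrightarrow> H2_sqnorm (\<lambda>z. f m z - f n z) \<le> e\<^sup>2"
      by blast
    have "H2_sqnorm (\<lambda>z. f n z - g z) \<le> e\<^sup>2" if "n \<ge> N" for n
      by (intro H2_sqnorm_le diffH2[OF N that] key[OF N that])
    then show "\<exists>N. \<forall>n\<ge>N. H2_sqnorm (\<lambda>z. f n z - g z) \<le> e\<^sup>2" by blast
  qed
qed

section \<open>Toeplitz operators\<close>

text \<open>A type, so that the Hilbert-space lemmas for \<open>real_inner\<close> and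
  \<open>banach\<close> apply. Members of \<open>H2\<close> vanish off the disk, so norm zero means
  literally zero and no quotient has to be formed.\<close>

typedef hardy = H2 morphisms disk_fun to_hardy
  using H2_zero by blast

lemmas disk_fun_H2 [simp] = disk_fun
lemmas disk_fun_to_hardy = to_hardy_inverse

instantiation hardy :: real_inner
begin

definition "0 = to_hardy (\<lambda>z. 0)"
definition "f + g = to_hardy (\<lambda>z. disk_fun f z + disk_fun g z)"
definition "f - g = to_hardy (\<lambda>z. disk_fun f z - disk_fun g z)"
definition "- f = to_hardy (\<lambda>z. - 1 * disk_fun f z)" for f :: hardy
definition "r *\<^sub>R f = to_hardy (\<lambda>z. of_real r * disk_fun f z)" for f :: hardy
definition "f \<bullet> g = Re (H2_inner (disk_fun f) (disk_fun g))"
definition "norm f = sqrt (f \<bullet> f)" for f :: hardy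
definition "sgn f = inverse (norm f) *\<^sub>R f" for f :: hardy
definition "dist f g = norm (f - g)" for f g :: hardy
definition "(uniformity :: (hardy \<times> hardy) filter) = (INF e\<in>{0 <..}. principal {(x, y). dist x y < e})"
definition "open U \<longleftrightarrow> (\<forall>x\<in>U. \<forall>\<^sub>F (x', y) in uniformity. x' = x \<longrightarrow> y \<in> U)" for U :: "hardy set"

lemma disk_fun_zero: "disk_fun 0 = (\<lambda>z. 0)"
  by (simp add: zero_hardy_def disk_fun_to_hardy H2_zero)

lemma disk_fun_add: "disk_fun (f + g) = (\<lambda>z. disk_fun f z + disk_fun g z)"
  by (simp add: plus_hardy_def disk_fun_to_hardy H2_add)

lemma disk_fun_diff: "disk_fun (f - g) = (\<lambda>z. disk_fun f z - disk_fun g z)"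
  by (simp add: minus_hardy_def disk_fun_to_hardy H2_diff)

lemma disk_fun_uminus: "disk_fun (- f) = (\<lambda>z. - disk_fun f z)"
  using H2_scale[OF disk_fun_H2, of "- 1" f] by (simp add: uminus_hardy_def disk_fun_to_hardy)

lemma disk_fun_scaleR: "disk_fun (r *\<^sub>R f) = (\<lambda>z. of_real r * disk_fun f z)"
  by (simp add: scaleR_hardy_def disk_fun_to_hardy H2_scale)

instance
proof
  fix f g h :: hardy and r s :: real
  note fun_simps = disk_fun_inject[symmetric] fun_eq_iff disk_fun_add disk_fun_zero disk_fun_diff
    disk_fun_uminus disk_fun_scaleR
  show "f + g + h = f + (g + h)" "f + g = g + f" "0 + f = f" "- f + f = 0" "f - g = f + - g"
    "r *\<^sub>R (f + g) = r *\<^sub>R f + r *\<^sub>R g" "(r + s) *\<^sub>R f = r *\<^sub>R f + s *\<^sub>R f"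
    "r *\<^sub>R s *\<^sub>R f = (r * s) *\<^sub>R f" "1 *\<^sub>R f = f"
    by (simp_all add: fun_simps algebra_simps)
  show "f \<bullet> g = g \<bullet> f"
    unfolding inner_hardy_def using arg_cong[OF H2_inner_cnj[of "disk_fun f" "disk_fun g"], of Re]
    by simp
  show "(f + g) \<bullet> h = f \<bullet> h + g \<bullet> h"
    by (simp add: inner_hardy_def disk_fun_add H2_inner_add_left)
  show "(r *\<^sub>R f) \<bullet> g = r * (f \<bullet> g)"
    by (simp add: inner_hardy_def disk_fun_scaleR H2_inner_scale_left)
  show "0 \<le> f \<bullet> f" by (simp add: inner_hardy_def H2_inner_self H2_sqnorm_nonneg)
  show "f \<bullet> f = 0 \<longleftrightarrow> f = 0"
  proof
    assume "f \<bullet> f = 0"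
    then have "disk_fun f = (\<lambda>z. 0)"
      by (intro H2_sqnorm_eq_0) (simp_all add: inner_hardy_def H2_inner_self)
    then show "f = 0" by (simp add: disk_fun_inject[symmetric] disk_fun_zero)
  next
    assume "f = 0"
    then show "f \<bullet> f = 0"
      using H2_inner_scale_left[OF H2_zero H2_zero, of 0] by (simp add: inner_hardy_def disk_fun_zero)
  qed
qed (rule dist_hardy_def norm_hardy_def sgn_hardy_def uniformity_hardy_def open_hardy_def)+

end

lemma H2_norm_disk_fun: "H2_norm (disk_fun f) = norm f"
  by (simp add: H2_norm_def norm_hardy_def inner_hardy_def)

lemma norm_hardy_sqnorm: "norm f = sqrt (H2_sqnorm (disk_fun f))"
  by (simp add: norm_hardy_def inner_hardy_def H2_inner_self)

instance hardy :: banach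
proof
  fix X :: "nat \<Rightarrow> hardy" assume X: "Cauchy X"
  have n2: "H2_sqnorm (\<lambda>z. disk_fun f z - disk_fun g z) = (dist f g)\<^sup>2" for f g
    by (simp add: dist_norm norm_hardy_sqnorm disk_fun_diff H2_sqnorm_nonneg)
  obtain g where g: "g \<in> H2" "\<And>e. e > 0 \<Longrightarrow> \<exists>N. \<forall>n\<ge>N. H2_sqnorm (\<lambda>z. disk_fun (X n) z - g z) \<le> e\<^sup>2"
  proof (rule H2_Cauchy_limit[of "\<lambda>n. disk_fun (X n)"])
    fix e :: real assume "e > 0"
    from metric_CauchyD[OF X this] obtain N where "\<And>m n. \<lbrakk>m \<ge> N; n \<ge> N\<rbrakk> \<Longrightarrow> dist (X m) (X n) < e" by blast
    then show "\<exists>N. \<forall>m\<ge>N. \<forall>n\<ge>N. H2_sqnorm (\<lambda>z. disk_fun (X m) z - disk_fun (X n) z) \<le> e\<^sup>2"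
      unfolding n2 by (intro exI[of _ N] allI impI power_mono) (auto intro: less_imp_le)
  qed (simp, blast)
  have "X \<longlonglongrightarrow> to_hardy g"
  proof (rule metric_LIMSEQ_I)
    fix e :: real assume e: "e > 0"
    then have "e / 2 > 0" by simp
    from g(2)[OF this] obtain N where "\<And>n. n \<ge> N \<Longrightarrow> (dist (X n) (to_hardy g))\<^sup>2 \<le> (e / 2)\<^sup>2"
      using n2[of _ "to_hardy g"] g(1) by (auto simp: disk_fun_to_hardy)
    then have "dist (X n) (to_hardy g) < e" if "n \<ge> N" for n
      using power2_le_imp_le[of "dist (X n) (to_hardy g)" "e / 2"] that e by fastforce
    then show "\<exists>N. \<forall>n\<ge>N. dist (X n) (to_hardy g) < e" by blast
  qed
  then show "convergent X" by (rule convergentI)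
qed

text \<open>Complex scalar multiplication, which the real vector space class does not carry.\<close>

definition hscale :: "complex \<Rightarrow> hardy \<Rightarrow> hardy" where
  "hscale c f = to_hardy (\<lambda>z. c * disk_fun f z)"

lemma disk_fun_hscale: "disk_fun (hscale c f) = (\<lambda>z. c * disk_fun f z)"
  by (simp add: hscale_def disk_fun_to_hardy H2_scale)

lemma inner_hscale_left: "hscale c f \<bullet> g = f \<bullet> hscale (cnj c) g"
proof -
  have "H2_inner (disk_fun f) (\<lambda>z. cnj c * disk_fun g z) = c * H2_inner (disk_fun f) (disk_fun g)"
    using H2_inner_scale_left[of "disk_fun g" "disk_fun f" "cnj c"]
      H2_inner_cnj[of "\<lambda>z. cnj c * disk_fun g z" "disk_fun f", symmetric]
      H2_inner_cnj[of "disk_fun g" "disk_fun f", symmetric]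
    by simp
  then show ?thesis by (simp add: inner_hardy_def disk_fun_hscale H2_inner_scale_left)
qed

section \<open>The projection and Toeplitz operators as bounded operators\<close>

text \<open>Existence comes from the Riesz representation of the real functional
  \<open>\<phi>\<close>. This gives equality of real parts; testing with \<open>- \<i> * h\<close>
  adds the imaginary parts. Two candidates differ by a vector orthogonal to itself, so they
  agree.\<close>

lemma P_plus_characterization:
  assumes F: "F \<in> circle_L2"
  shows "P_plus F \<in> H2" "\<And>h. h \<in> H2 \<Longrightarrow> H2_inner (P_plus F) h = L2_inner F (boundary h)"
    "\<And>g. g \<in> H2 \<Longrightarrow> (\<And>h. h \<in> H2 \<Longrightarrow> H2_inner g h = L2_inner F (boundary h)) \<Longrightarrow> P_plus F = g"
proof -
  have eq: "L2_inner (\<lambda>\<zeta>. F \<zeta> - boundary g \<zeta>) (boundary h) = L2_inner F (boundary h) - H2_inner g h"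
    if "g \<in> H2" "h \<in> H2" for g h
    unfolding H2_inner_def using that F by (intro L2_inner_diff_left boundary_in_L2)
  define P where "P g \<longleftrightarrow> g \<in> H2 \<and> (\<forall>h\<in>H2. L2_inner (\<lambda>\<zeta>. F \<zeta> - boundary g \<zeta>) (boundary h) = 0)" for g
  have P: "P g \<longleftrightarrow> g \<in> H2 \<and> (\<forall>h\<in>H2. H2_inner g h = L2_inner F (boundary h))" for g
  proof -
    have "L2_inner (\<lambda>\<zeta>. F \<zeta> - boundary g \<zeta>) (boundary h) = 0 \<longleftrightarrow> H2_inner g h = L2_inner F (boundary h)"
      if "g \<in> H2" "h \<in> H2" for h
      using eq[OF that] by auto
    then show ?thesis unfolding P_def by blast
  qed
  define \<phi> where "\<phi> h = Re (L2_inner (boundary (disk_fun h)) F)" for h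
  have "bounded_linear \<phi>"
  proof (rule bounded_linear_intro)
    show "\<phi> (f + g) = \<phi> f + \<phi> g" for f g
      by (simp add: \<phi>_def disk_fun_add L2_inner_boundary_add F)
    show "\<phi> (r *\<^sub>R f) = r *\<^sub>R \<phi> f" for r f
      by (simp add: \<phi>_def disk_fun_scaleR L2_inner_boundary_scale F)
    show "norm (\<phi> f) \<le> norm f * sqrt (\<integral>\<zeta>. (cmod (F \<zeta>))\<^sup>2 \<partial>circle_measure)" for f
    proof -
      have "norm (\<phi> f) \<le> cmod (L2_inner (boundary (disk_fun f)) F)"
        unfolding \<phi>_def real_norm_def by (rule abs_Re_le_cmod)
      also have "\<dots> \<le> sqrt (H2_sqnorm (disk_fun f) * (\<integral>\<zeta>. (cmod (F \<zeta>))\<^sup>2 \<partial>circle_measure))"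
        unfolding H2_sqnorm_def by (intro real_le_rsqrt L2_Cauchy_Schwarz boundary_in_L2 F) simp
      finally show ?thesis by (simp add: norm_hardy_sqnorm real_sqrt_mult)
    qed
  qed
  then obtain w where w: "\<And>h. \<phi> h = w \<bullet> h" using riesz_representation by blast
  have "P (disk_fun w)"
    unfolding P
  proof (intro conjI ballI)
    fix h assume h: "h \<in> H2"
    have re: "Re (H2_inner (disk_fun w) k) = Re (L2_inner F (boundary k))" if "k \<in> H2" for k
    proof -
      have "Re (L2_inner F (boundary k)) = Re (L2_inner (boundary k) F)"
        using arg_cong[OF L2_inner_cnj[of F "boundary k"], of Re] by simp
      then show ?thesis using w[of "to_hardy k"] that by (simp add: \<phi>_def inner_hardy_def disk_fun_to_hardy)
    qed
    have "H2_inner (disk_fun w) (\<lambda>z. - \<i> * h z) = \<i> * H2_inner (disk_fun w) h"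
      using H2_inner_scale_left[OF h disk_fun_H2, of "- \<i>" w]
        H2_inner_cnj[of "\<lambda>z. - \<i> * h z" "disk_fun w", symmetric] H2_inner_cnj[of h "disk_fun w", symmetric]
      by simp
    moreover have "L2_inner F (boundary (\<lambda>z. - \<i> * h z)) = \<i> * L2_inner F (boundary h)"
      using L2_inner_boundary_scale[OF h F, of "- \<i>"]
        L2_inner_cnj[of "boundary (\<lambda>z. - \<i> * h z)" F, symmetric] L2_inner_cnj[of "boundary h" F, symmetric]
      by simp
    ultimately have "Re (\<i> * H2_inner (disk_fun w) h) = Re (\<i> * L2_inner F (boundary h))"
      using re[OF H2_scale[OF h, of "- \<i>"]] by simp
    with re[OF h] show "H2_inner (disk_fun w) h = L2_inner F (boundary h)"
      by (simp add: complex_eq_iff)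
  qed simp
  moreover have uniq: "g = g'" if "P g" "P g'" for g g'
  proof -
    have g: "g \<in> H2" "g' \<in> H2" using that by (auto simp: P)
    have "to_hardy g - to_hardy g' = 0"
    proof -
      define k where "k = to_hardy g - to_hardy g'"
      have "to_hardy g \<bullet> k = to_hardy g' \<bullet> k"
        using that by (simp add: inner_hardy_def disk_fun_to_hardy g P)
      then have "k \<bullet> k = 0" unfolding k_def by (simp add: inner_diff_left)
      then show ?thesis unfolding k_def by simp
    qed
    then show ?thesis using g by (simp add: to_hardy_inject)
  qed
  ultimately have ex1: "\<exists>!g. P g" by blast
  have Pp: "P_plus F = (THE g. P g)" unfolding P_plus_def P_def ..
  have "P (P_plus F)" unfolding Pp by (rule theI'[OF ex1])
  then show "P_plus F \<in> H2" "\<And>h. h \<in> H2 \<Longrightarrow> H2_inner (P_plus F) h = L2_inner F (boundary h)"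
    by (simp_all add: P)
  show "P_plus F = g" if "g \<in> H2" "\<And>h. h \<in> H2 \<Longrightarrow> H2_inner g h = L2_inner F (boundary h)" for g
    unfolding Pp using that by (intro the1_equality ex1) (simp add: P)
qed

definition bounded_symbol :: "(complex \<Rightarrow> complex) \<Rightarrow> bool" where
  "bounded_symbol \<phi> \<longleftrightarrow> \<phi> \<in> borel_measurable circle_measure \<and>
     (\<exists>B. AE \<zeta> in circle_measure. cmod (\<phi> \<zeta>) \<le> B)"

lemma bounded_symbol_cnj: "bounded_symbol \<phi> \<Longrightarrow> bounded_symbol (\<lambda>\<zeta>. cnj (\<phi> \<zeta>))"
  by (auto simp: bounded_symbol_def intro: borel_measurable_cnj)

lemma bounded_symbol_mult_L2:
  assumes "bounded_symbol \<phi>" "F \<in> circle_L2" shows "(\<lambda>\<zeta>. \<phi> \<zeta> * F \<zeta>) \<in> circle_L2"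
  using assms circle_L2_bounded_mult(1) unfolding bounded_symbol_def by blast

text \<open>Weak form for proving operator identities: a Toeplitz image is identified by pairing a
  candidate with every \<open>h\<close> in \<open>H2\<close>.\<close>

lemma Toeplitz_characterization:
  assumes \<phi>: "bounded_symbol \<phi>" and f: "f \<in> H2"
  shows "Toeplitz \<phi> f \<in> H2"
    "\<And>h. h \<in> H2 \<Longrightarrow> H2_inner (Toeplitz \<phi> f) h = L2_inner (\<lambda>\<zeta>. \<phi> \<zeta> * boundary f \<zeta>) (boundary h)"
    "\<And>g. g \<in> H2 \<Longrightarrow> (\<And>h. h \<in> H2 \<Longrightarrow> H2_inner g h = L2_inner (\<lambda>\<zeta>. \<phi> \<zeta> * boundary f \<zeta>) (boundary h))
      \<Longrightarrow> Toeplitz \<phi> f = g"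
  unfolding Toeplitz_def
  using P_plus_characterization[OF bounded_symbol_mult_L2[OF \<phi> boundary_in_L2[OF f]]] by blast+

lemma Toeplitz_adjoint:
  assumes \<phi>: "bounded_symbol \<phi>" and f: "f \<in> H2" and h: "h \<in> H2"
  shows "H2_inner (Toeplitz \<phi> f) h = H2_inner f (Toeplitz (\<lambda>\<zeta>. cnj (\<phi> \<zeta>)) h)"
proof -
  have "H2_inner f (Toeplitz (\<lambda>\<zeta>. cnj (\<phi> \<zeta>)) h) =
      cnj (L2_inner (\<lambda>\<zeta>. cnj (\<phi> \<zeta>) * boundary h \<zeta>) (boundary f))"
    unfolding Toeplitz_characterization(2)[OF bounded_symbol_cnj[OF \<phi>] h f, symmetric]
    by (rule H2_inner_cnj[symmetric])
  also have "\<dots> = L2_inner (\<lambda>\<zeta>. \<phi> \<zeta> * boundary f \<zeta>) (boundary h)"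
    unfolding L2_inner_cnj by (simp add: L2_inner_def mult_ac)
  also have "\<dots> = H2_inner (Toeplitz \<phi> f) h" using Toeplitz_characterization(2)[OF \<phi> f h] by simp
  finally show ?thesis by simp
qed

text \<open>Passing to the adjoint moves \<open>f\<close> and \<open>g\<close> into the first slot
  of \<open>H2_inner\<close>, where additivity is already known.\<close>

lemma Toeplitz_add:
  assumes \<phi>: "bounded_symbol \<phi>" and f: "f \<in> H2" and g: "g \<in> H2"
  shows "Toeplitz \<phi> (\<lambda>z. f z + g z) = (\<lambda>z. Toeplitz \<phi> f z + Toeplitz \<phi> g z)"
proof (rule Toeplitz_characterization(3)[OF \<phi> H2_add[OF f g]])
  show "(\<lambda>z. Toeplitz \<phi> f z + Toeplitz \<phi> g z) \<in> H2"
    by (intro H2_add Toeplitz_characterization(1) \<phi> f g)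
  fix h assume h: "h \<in> H2"
  have "H2_inner (\<lambda>z. Toeplitz \<phi> f z + Toeplitz \<phi> g z) h = H2_inner (Toeplitz \<phi> f) h + H2_inner (Toeplitz \<phi> g) h"
    by (intro H2_inner_add_left Toeplitz_characterization(1) \<phi> f g h)
  also have "\<dots> = H2_inner (\<lambda>z. f z + g z) (Toeplitz (\<lambda>\<zeta>. cnj (\<phi> \<zeta>)) h)"
    by (simp add: Toeplitz_adjoint \<phi> f g h H2_inner_add_left Toeplitz_characterization(1) bounded_symbol_cnj)
  also have "\<dots> = H2_inner (Toeplitz \<phi> (\<lambda>z. f z + g z)) h"
    by (rule Toeplitz_adjoint[OF \<phi> H2_add[OF f g] h, symmetric])
  also have "\<dots> = L2_inner (\<lambda>\<zeta>. \<phi> \<zeta> * boundary (\<lambda>z. f z + g z) \<zeta>) (boundary h)"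
    by (rule Toeplitz_characterization(2)[OF \<phi> H2_add[OF f g] h])
  finally show "H2_inner (\<lambda>z. Toeplitz \<phi> f z + Toeplitz \<phi> g z) h = L2_inner (\<lambda>\<zeta>. \<phi> \<zeta> * boundary (\<lambda>z. f z + g z) \<zeta>) (boundary h)" .
qed

lemma Toeplitz_scale:
  assumes \<phi>: "bounded_symbol \<phi>" and f: "f \<in> H2"
  shows "Toeplitz \<phi> (\<lambda>z. c * f z) = (\<lambda>z. c * Toeplitz \<phi> f z)"
proof (rule Toeplitz_characterization(3)[OF \<phi> H2_scale[OF f]])
  show "(\<lambda>z. c * Toeplitz \<phi> f z) \<in> H2" by (intro H2_scale Toeplitz_characterization(1) \<phi> f)
  fix h assume h: "h \<in> H2"
  have "H2_inner (\<lambda>z. c * Toeplitz \<phi> f z) h = c * H2_inner (Toeplitz \<phi> f) h"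
    by (intro H2_inner_scale_left Toeplitz_characterization(1) \<phi> f h)
  also have "\<dots> = H2_inner (\<lambda>z. c * f z) (Toeplitz (\<lambda>\<zeta>. cnj (\<phi> \<zeta>)) h)"
    by (simp add: Toeplitz_adjoint \<phi> f h H2_inner_scale_left Toeplitz_characterization(1) bounded_symbol_cnj)
  also have "\<dots> = H2_inner (Toeplitz \<phi> (\<lambda>z. c * f z)) h"
    by (rule Toeplitz_adjoint[OF \<phi> H2_scale[OF f] h, symmetric])
  also have "\<dots> = L2_inner (\<lambda>\<zeta>. \<phi> \<zeta> * boundary (\<lambda>z. c * f z) \<zeta>) (boundary h)"
    by (rule Toeplitz_characterization(2)[OF \<phi> H2_scale[OF f] h])
  finally show "H2_inner (\<lambda>z. c * Toeplitz \<phi> f z) h = L2_inner (\<lambda>\<zeta>. \<phi> \<zeta> * boundary (\<lambda>z. c * f z) \<zeta>) (boundary h)" .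
qed

definition toeplitz_op :: "(complex \<Rightarrow> complex) \<Rightarrow> hardy \<Rightarrow> hardy" where
  "toeplitz_op \<phi> f = to_hardy (Toeplitz \<phi> (disk_fun f))"

lemma disk_fun_toeplitz_op: "bounded_symbol \<phi> \<Longrightarrow> disk_fun (toeplitz_op \<phi> f) = Toeplitz \<phi> (disk_fun f)"
  by (simp add: toeplitz_op_def disk_fun_to_hardy Toeplitz_characterization(1))

lemma Toeplitz_image_H2: "bounded_symbol \<phi> \<Longrightarrow> Toeplitz \<phi> ` H2 = disk_fun ` range (toeplitz_op \<phi>)"
  unfolding type_definition.Rep_range[OF type_definition_hardy, symmetric] image_image
  by (intro image_cong refl disk_fun_toeplitz_op[symmetric])

lemma toeplitz_op_adjoint:
  "bounded_symbol \<phi> \<Longrightarrow> toeplitz_op \<phi> f \<bullet> h = f \<bullet> toeplitz_op (\<lambda>\<zeta>. cnj (\<phi> \<zeta>)) h"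
  by (simp add: inner_hardy_def disk_fun_toeplitz_op bounded_symbol_cnj Toeplitz_adjoint)

lemma toeplitz_op_hscale:
  "bounded_symbol \<phi> \<Longrightarrow> toeplitz_op \<phi> (hscale c f) = hscale c (toeplitz_op \<phi> f)"
  by (simp add: disk_fun_inject[symmetric] disk_fun_toeplitz_op disk_fun_hscale Toeplitz_scale)

lemma bounded_linear_toeplitz_op:
  assumes \<phi>: "bounded_symbol \<phi>"
  shows "bounded_linear (toeplitz_op \<phi>)"
proof -
  obtain B where B: "AE \<zeta> in circle_measure. cmod (\<phi> \<zeta>) \<le> B" and m: "\<phi> \<in> borel_measurable circle_measure"
    using \<phi> unfolding bounded_symbol_def by blast
  show ?thesis
  proof (rule bounded_linear_intro)
    show "toeplitz_op \<phi> (f + g) = toeplitz_op \<phi> f + toeplitz_op \<phi> g" for f g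
      by (simp add: disk_fun_inject[symmetric] disk_fun_toeplitz_op \<phi> disk_fun_add Toeplitz_add)
    show "toeplitz_op \<phi> (r *\<^sub>R f) = r *\<^sub>R toeplitz_op \<phi> f" for r f
      by (simp add: disk_fun_inject[symmetric] disk_fun_toeplitz_op \<phi> disk_fun_scaleR Toeplitz_scale)
    show "norm (toeplitz_op \<phi> f) \<le> norm f * \<bar>B\<bar>" for f
    proof -
      \<comment> \<open>The square of \<open>norm g\<close> is the pairing of \<open>\<phi>\<close>
        times the boundary of \<open>f\<close> with the boundary of \<open>g\<close>; Cauchy-Schwarz
        leaves one factor \<open>norm g\<close> to cancel.\<close>
      define g where "g = toeplitz_op \<phi> f"
      have "norm g * norm g = g \<bullet> g" by (simp add: power2_norm_eq_inner[symmetric] power2_eq_square)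
      also have "\<dots> = Re (L2_inner (\<lambda>\<zeta>. \<phi> \<zeta> * boundary (disk_fun f) \<zeta>) (boundary (disk_fun g)))"
        unfolding inner_hardy_def using Toeplitz_characterization(2)[OF \<phi> disk_fun_H2 disk_fun_H2, of f g]
        by (simp add: g_def disk_fun_toeplitz_op \<phi>)
      also have "\<dots> \<le> cmod (L2_inner (\<lambda>\<zeta>. \<phi> \<zeta> * boundary (disk_fun f) \<zeta>) (boundary (disk_fun g)))"
        by (rule complex_Re_le_cmod)
      also have "\<dots> \<le> sqrt ((\<integral>\<zeta>. (cmod (\<phi> \<zeta> * boundary (disk_fun f) \<zeta>))\<^sup>2 \<partial>circle_measure) * H2_sqnorm (disk_fun g))"
        unfolding H2_sqnorm_def
        by (intro real_le_rsqrt L2_Cauchy_Schwarz bounded_symbol_mult_L2 \<phi> boundary_in_L2 disk_fun_H2)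
      also have "\<dots> \<le> sqrt ((B\<^sup>2 * H2_sqnorm (disk_fun f)) * H2_sqnorm (disk_fun g))"
        unfolding H2_sqnorm_def[of "disk_fun f"]
        by (intro real_sqrt_le_mono mult_right_mono H2_sqnorm_nonneg circle_L2_bounded_mult(2) B m boundary_in_L2 disk_fun_H2)
      also have "\<dots> = (norm f * \<bar>B\<bar>) * norm g" by (simp add: real_sqrt_mult norm_hardy_sqnorm)
      finally show ?thesis unfolding g_def[symmetric] by (cases "g = 0") auto
    qed
  qed
qed

section \<open>Outer functions\<close>

lemma Hinf_bound:
  assumes "a \<in> Hinf"
  obtains M where "M \<ge> 0" "\<And>z. cmod z < 1 \<Longrightarrow> cmod (a z) \<le> M"
proof -
  have "bounded (a ` ball 0 1)" using assms by (simp add: Hinf_def)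
  then obtain M where "M > 0" "\<forall>x\<in>a ` ball 0 1. cmod x \<le> M" unfolding bounded_pos by blast
  then show ?thesis by (intro that[of M]) auto
qed

lemma HinfI:
  assumes "a holomorphic_on ball 0 1" "\<And>z. cmod z < 1 \<Longrightarrow> cmod (a z) \<le> M"
  shows "a \<in> Hinf"
  using assms unfolding Hinf_def bounded_iff by (auto intro!: exI[of _ M])

lemma Hinf_holomorphic: "a \<in> Hinf \<Longrightarrow> a holomorphic_on ball 0 1"
  by (simp add: Hinf_def)

lemma Hinf_mult_H2:
  assumes a: "a \<in> Hinf" and f: "f \<in> H2"
  shows "(\<lambda>z. a z * f z) \<in> H2"
proof -
  obtain M where M: "M \<ge> 0" "\<And>z. cmod z < 1 \<Longrightarrow> cmod (a z) \<le> M" using Hinf_bound[OF a] by blast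
  obtain B where B: "\<And>r. \<lbrakk>0 \<le> r; r < 1\<rbrakk> \<Longrightarrow> circle_mean f r \<le> B" using f unfolding H2_iff by blast
  have hol: "(\<lambda>z. a z * f z) holomorphic_on ball 0 1"
    by (intro holomorphic_intros Hinf_holomorphic a H2_holomorphic f)
  have "circle_mean (\<lambda>z. a z * f z) r \<le> M\<^sup>2 * B" if r: "0 \<le> r" "r < 1" for r
  proof -
    have "circle_mean (\<lambda>z. a z * f z) r \<le> M\<^sup>2 * (\<integral>\<zeta>. (cmod (f (of_real r * \<zeta>)))\<^sup>2 \<partial>circle_measure)"
      unfolding circle_mean_def
      by (rule circle_L2_bounded_mult(2)[OF H2_dilation_L2[OF f r] borel_measurable_dilation[OF Hinf_holomorphic[OF a] r] AE_I2])
         (use M(2) r in \<open>auto simp: norm_mult\<close>)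
    also have "\<dots> \<le> M\<^sup>2 * B" using B[OF r] by (intro mult_left_mono) (auto simp: circle_mean_def)
    finally show ?thesis .
  qed
  then show ?thesis using hol H2_off_disk[OF f] unfolding H2_iff by (auto intro!: exI[of _ "M\<^sup>2 * B"])
qed

text \<open>Members of \<open>Hinf\<close> are not normalized off the disk, those of
  \<open>H2\<close> are; this cut-off embeds the former into the latter and keeps the boundary
  values on the circle.\<close>

definition disk_restrict :: "(complex \<Rightarrow> complex) \<Rightarrow> complex \<Rightarrow> complex" where
  "disk_restrict f z = (if cmod z < 1 then f z else 0)"

lemma disk_restrict_one_H2: "disk_restrict (\<lambda>z. 1) \<in> H2"
proof -
  have "disk_restrict (\<lambda>z. 1) holomorphic_on ball 0 1"
    by (rule holomorphic_transform[of "\<lambda>z. 1"]) (auto simp: disk_restrict_def)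
  moreover have "circle_mean (disk_restrict (\<lambda>z. 1)) r \<le> 1" if r: "0 \<le> r" "r < 1" for r
  proof -
    have "circle_mean (disk_restrict (\<lambda>z. 1)) r = (\<integral>\<zeta>. 1 \<partial>circle_measure)"
      unfolding circle_mean_def using r
      by (intro Bochner_Integration.integral_cong) (auto simp: disk_restrict_def norm_mult)
    then show ?thesis using circle.prob_space by simp
  qed
  ultimately show ?thesis unfolding H2_iff by (auto simp: disk_restrict_def)
qed

lemma disk_restrict_H2:
  assumes "a \<in> Hinf" shows "disk_restrict a \<in> H2"
proof -
  have "disk_restrict a = (\<lambda>z. a z * disk_restrict (\<lambda>z. 1) z)" by (auto simp: disk_restrict_def)
  then show ?thesis using Hinf_mult_H2[OF assms disk_restrict_one_H2] by simp
qed

lemma boundary_disk_restrict: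
  assumes "cmod \<zeta> = 1" shows "boundary (disk_restrict f) \<zeta> = boundary f \<zeta>"
proof -
  have "\<forall>\<^sub>F r in at_left 1. disk_restrict f (of_real r * \<zeta>) = f (of_real r * \<zeta>)"
    unfolding eventually_at_left_field using assms
    by (intro exI[of _ 0]) (auto simp: disk_restrict_def norm_mult)
  then have "((\<lambda>r. disk_restrict f (of_real r * \<zeta>)) \<longlongrightarrow> l) (at_left 1) \<longleftrightarrow> ((\<lambda>r. f (of_real r * \<zeta>)) \<longlongrightarrow> l) (at_left 1)" for l
    by (rule tendsto_cong)
  then show ?thesis unfolding boundary_def t2_space_class.Lim_def by simp
qed

lemma Hinf_boundary_tendsto:
  assumes a: "a \<in> Hinf"
  shows "AE \<zeta> in circle_measure. ((\<lambda>r. a (of_real r * \<zeta>)) \<longlongrightarrow> boundary a \<zeta>) (at_left 1)"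
  using boundary_tendsto[OF disk_restrict_H2[OF a]]
proof (rule AE_mp[OF _ AE_I2], intro impI)
  fix \<zeta> assume "\<zeta> \<in> space circle_measure"
    and l: "((\<lambda>r. disk_restrict a (of_real r * \<zeta>)) \<longlongrightarrow> boundary (disk_restrict a) \<zeta>) (at_left 1)"
  then have z: "cmod \<zeta> = 1" by simp
  have "\<forall>\<^sub>F r in at_left 1. disk_restrict a (of_real r * \<zeta>) = a (of_real r * \<zeta>)"
    unfolding eventually_at_left_field using z
    by (intro exI[of _ 0]) (auto simp: disk_restrict_def norm_mult)
  from tendsto_cong[OF this] l show "((\<lambda>r. a (of_real r * \<zeta>)) \<longlongrightarrow> boundary a \<zeta>) (at_left 1)"
    by (simp add: boundary_disk_restrict z)
qed

lemma Hinf_boundary_bound: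
  assumes a: "a \<in> Hinf" and M: "\<And>z. cmod z < 1 \<Longrightarrow> cmod (a z) \<le> M"
  shows "AE \<zeta> in circle_measure. cmod (boundary a \<zeta>) \<le> M"
  using Hinf_boundary_tendsto[OF a]
proof (rule AE_mp[OF _ AE_I2], intro impI)
  fix \<zeta> assume "\<zeta> \<in> space circle_measure"
    and l: "((\<lambda>r. a (of_real r * \<zeta>)) \<longlongrightarrow> boundary a \<zeta>) (at_left 1)"
  then have z: "cmod \<zeta> = 1" by simp
  have "\<forall>\<^sub>F r in at_left 1. cmod (a (of_real r * \<zeta>)) \<le> M"
    unfolding eventually_at_left_field using z
    by (intro exI[of _ 0]) (auto intro!: M simp: norm_mult)
  then show "cmod (boundary a \<zeta>) \<le> M"
    by (intro tendsto_upperbound[OF tendsto_norm[OF l]]) auto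
qed

lemma bounded_symbol_boundary:
  assumes "a \<in> Hinf" shows "bounded_symbol (boundary a)"
proof -
  obtain M where "\<And>z. cmod z < 1 \<Longrightarrow> cmod (a z) \<le> M" using Hinf_bound[OF assms] by blast
  from Hinf_boundary_bound[OF assms this] show ?thesis
    using boundary_measurable[OF Hinf_holomorphic[OF assms]] unfolding bounded_symbol_def by blast
qed

lemma boundary_mult_AE:
  assumes a: "a \<in> Hinf" and f: "f \<in> H2"
  shows "AE \<zeta> in circle_measure. boundary (\<lambda>z. a z * f z) \<zeta> = boundary a \<zeta> * boundary f \<zeta>"
  using Hinf_boundary_tendsto[OF a] boundary_tendsto[OF f]
  by eventually_elim (subst boundary_def, intro tendsto_Lim tendsto_mult; simp)

section \<open>Herglotz integrals and approximate inverses of outer functions\<close>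

text \<open>With \<open>u = ln \<phi>\<close> this is the exponent of an outer function; its real
  part is the Poisson integral of \<open>u\<close>.\<close>

definition herglotz :: "(complex \<Rightarrow> real) \<Rightarrow> complex \<Rightarrow> complex" where
  "herglotz u z = (\<integral>\<zeta>. (\<zeta> + z) / (\<zeta> - z) * of_real (u \<zeta>) \<partial>circle_measure)"

lemma herglotz_kernel_eq:
  assumes z: "cmod z < 1" and \<zeta>: "cmod \<zeta> = 1"
  shows "(\<zeta> + z) / (\<zeta> - z) = 2 / (1 - z * cnj \<zeta>) - 1"
proof -
  have "\<zeta> * cnj \<zeta> = 1" using \<zeta> by (simp add: complex_norm_square[symmetric])
  then have eq: "\<zeta> - z = \<zeta> * (1 - z * cnj \<zeta>)" "\<zeta> + z = \<zeta> * (1 + z * cnj \<zeta>)"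
    by (simp_all add: algebra_simps)
  have nz: "1 - z * cnj \<zeta> \<noteq> 0" "\<zeta> \<noteq> 0" using one_minus_cnj_mult_nonzero(2)[OF z, of \<zeta>] \<zeta> by auto
  have "(\<zeta> + z) / (\<zeta> - z) = (1 + z * cnj \<zeta>) / (1 - z * cnj \<zeta>)" unfolding eq using nz(2) by simp
  also have "\<dots> = 2 / (1 - z * cnj \<zeta>) - 1" using nz(1) by (simp add: field_simps)
  finally show ?thesis .
qed

lemma herglotz_integrable:
  assumes z: "cmod z < 1" and u: "integrable circle_measure u"
  shows "integrable circle_measure (\<lambda>\<zeta>. (\<zeta> + z) / (\<zeta> - z) * of_real (u \<zeta>))"
proof -
  have c: "continuous_on (sphere 0 1) (\<lambda>\<zeta>. (\<zeta> + z) / (\<zeta> - z))"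
    using z by (intro continuous_intros) auto
  have [measurable]: "u \<in> borel_measurable circle_measure" using u by auto
  have [measurable]: "(\<lambda>\<zeta>. (\<zeta> + z) / (\<zeta> - z)) \<in> borel_measurable circle_measure"
    by (rule borel_measurable_circle_continuous[OF c])
  have "bounded ((\<lambda>\<zeta>. (\<zeta> + z) / (\<zeta> - z)) ` sphere 0 1)"
    by (intro compact_imp_bounded compact_continuous_image c) simp
  then obtain B where B: "B > 0" "\<forall>x\<in>(\<lambda>\<zeta>. (\<zeta> + z) / (\<zeta> - z)) ` sphere 0 1. cmod x \<le> B"
    unfolding bounded_pos by blast
  show ?thesis
  proof (rule Bochner_Integration.integrable_bound)
    show "integrable circle_measure (\<lambda>\<zeta>. B * u \<zeta>)" using u by simp
    show "AE \<zeta> in circle_measure. norm ((\<zeta> + z) / (\<zeta> - z) * of_real (u \<zeta>)) \<le> norm (B * u \<zeta>)"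
    proof (rule AE_I2)
      fix \<zeta> assume "\<zeta> \<in> space circle_measure"
      then have "cmod ((\<zeta> + z) / (\<zeta> - z)) \<le> B" using B(2) by auto
      then show "norm ((\<zeta> + z) / (\<zeta> - z) * of_real (u \<zeta>)) \<le> norm (B * u \<zeta>)"
        using B(1) unfolding norm_mult by (simp add: mult_right_mono del: norm_divide)
    qed
  qed measurable
qed

lemma herglotz_add:
  assumes "cmod z < 1" "integrable circle_measure u" "integrable circle_measure v"
  shows "herglotz (\<lambda>\<zeta>. u \<zeta> + v \<zeta>) z = herglotz u z + herglotz v z"
  unfolding herglotz_def
  using herglotz_integrable[OF assms(1,2)] herglotz_integrable[OF assms(1,3)]
  by (simp add: distrib_left)

lemma herglotz_zero:
  "herglotz u 0 = of_real (\<integral>\<zeta>. u \<zeta> \<partial>circle_measure)"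
proof -
  have "herglotz u 0 = (\<integral>\<zeta>. complex_of_real (u \<zeta>) \<partial>circle_measure)"
    unfolding herglotz_def by (intro Bochner_Integration.integral_cong) auto
  then show ?thesis by (simp only: integral_complex_of_real)
qed

lemma herglotz_one:
  assumes z: "cmod z < 1" shows "herglotz (\<lambda>_. 1) z = 1"
proof -
  have c: "continuous_on (sphere 0 1) (\<lambda>\<zeta>. 2 / (1 - z * cnj \<zeta>))"
    using one_minus_cnj_mult_nonzero(2)[OF z] by (intro continuous_intros) auto
  have "herglotz (\<lambda>_. 1) z = (\<integral>\<zeta>. 2 / (1 - z * cnj \<zeta>) - 1 \<partial>circle_measure)"
    unfolding herglotz_def by (intro Bochner_Integration.integral_cong) (auto simp: herglotz_kernel_eq[OF z])
  also have "\<dots> = (\<integral>\<zeta>. 2 / (1 - z * cnj \<zeta>) \<partial>circle_measure) - (\<integral>\<zeta>. 1 \<partial>circle_measure)"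
    by (intro Bochner_Integration.integral_diff integrable_circle_continuous c) auto
  also have "(\<integral>\<zeta>. 2 / (1 - z * cnj \<zeta>) \<partial>circle_measure) = 2"
    using cauchy_formula_circle[of "\<lambda>_. 2" 2 z] z by simp
  finally show ?thesis using circle.prob_space by simp
qed

text \<open>Writing the kernel as \<open>2 / (1 - z * cnj \<zeta>) - 1\<close> leaves twice a Cauchy
  integral minus a constant, and the Cauchy integral is a power series whose coefficients are the
  conjugated moments of \<open>u\<close>.\<close>

lemma herglotz_holomorphic:
  assumes u: "integrable circle_measure u"
  shows "herglotz u holomorphic_on ball 0 1"
proof -
  define c where "c n = cnj (\<integral>\<zeta>. \<zeta> ^ n * of_real (u \<zeta>) \<partial>circle_measure)" for n
  have uc: "integrable circle_measure (\<lambda>\<zeta>. complex_of_real (u \<zeta>))" using u by simp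
  define F where "F z = (\<integral>\<zeta>. 1 / (1 - z * cnj \<zeta>) * of_real (u \<zeta>) \<partial>circle_measure)" for z
  have "(\<lambda>n. c n * (z - 0) ^ n) sums F z" if "z \<in> ball 0 1" for z
  proof -
    have z: "cmod z < 1" using that by simp
    have k: "(\<lambda>n. cnj z ^ n * \<zeta> ^ n) sums (1 / (1 - cnj z * \<zeta>))" if "cmod \<zeta> = 1" for \<zeta>
      using geometric_sums[of "cnj z * \<zeta>"] z that by (simp add: norm_mult power_mult_distrib)
    have "summable (\<lambda>n. cmod (cnj z ^ n))" using z by (simp add: norm_power)
    from circle_series_integral[OF k this uc]
    have "(\<lambda>n. cnj (cnj z ^ n * (\<integral>\<zeta>. \<zeta> ^ n * of_real (u \<zeta>) \<partial>circle_measure))) sums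
        cnj (\<integral>\<zeta>. 1 / (1 - cnj z * \<zeta>) * of_real (u \<zeta>) \<partial>circle_measure)"
      unfolding sums_cnj .
    moreover have "cnj (\<integral>\<zeta>. 1 / (1 - cnj z * \<zeta>) * of_real (u \<zeta>) \<partial>circle_measure) = F z"
      unfolding F_def by (subst Bochner_Integration.integral_cnj[symmetric]) simp
    ultimately show ?thesis by (simp add: c_def mult.commute)
  qed
  then have "F holomorphic_on ball 0 1" by (rule power_series_holomorphic)
  then have "(\<lambda>z. 2 * F z - of_real (\<integral>\<zeta>. u \<zeta> \<partial>circle_measure)) holomorphic_on ball 0 1"
    by (intro holomorphic_intros)
  then show ?thesis
  proof (rule holomorphic_transform)
    fix z :: complex assume "z \<in> ball 0 1"
    then have z: "cmod z < 1" by simp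
    have "herglotz u z + herglotz u 0 = 2 * F z"
    proof -
      have "herglotz u z + herglotz u 0 =
          (\<integral>\<zeta>. (\<zeta> + z) / (\<zeta> - z) * of_real (u \<zeta>) + (\<zeta> + 0) / (\<zeta> - 0) * of_real (u \<zeta>) \<partial>circle_measure)"
        unfolding herglotz_def using z
        by (intro Bochner_Integration.integral_add[symmetric] herglotz_integrable u) auto
      also have "\<dots> = (\<integral>\<zeta>. 2 * (1 / (1 - z * cnj \<zeta>) * of_real (u \<zeta>)) \<partial>circle_measure)"
        by (intro Bochner_Integration.integral_cong refl, subst herglotz_kernel_eq[OF z])
           (auto simp: algebra_simps)
      also have "\<dots> = 2 * F z" unfolding F_def by (rule integral_mult_right_zero)
      finally show ?thesis .
    qed
    then show "2 * F z - of_real (\<integral>\<zeta>. u \<zeta> \<partial>circle_measure) = herglotz u z"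
      by (metis add_diff_cancel_right' herglotz_zero)
  qed
qed

text \<open>The real part of the kernel is the Poisson kernel: nonnegative, and of integral one by
  \<open>herglotz_one\<close>.\<close>

lemma Re_herglotz_le:
  assumes z: "cmod z < 1" and u: "integrable circle_measure u" and K: "\<And>\<zeta>. cmod \<zeta> = 1 \<Longrightarrow> u \<zeta> \<le> K"
  shows "Re (herglotz u z) \<le> K"
proof -
  have pos: "0 \<le> Re ((\<zeta> + z) / (\<zeta> - z))" if "cmod \<zeta> = 1" for \<zeta>
  proof -
    have "(\<zeta> + z) / (\<zeta> - z) = ((\<zeta> + z) * cnj (\<zeta> - z)) / of_real ((cmod (\<zeta> - z))\<^sup>2)"
      using complex_div_cnj[of "\<zeta> + z" "\<zeta> - z"] by simp
    then have "Re ((\<zeta> + z) / (\<zeta> - z)) = Re ((\<zeta> + z) * cnj (\<zeta> - z)) / (cmod (\<zeta> - z))\<^sup>2"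
      by (simp only: Re_divide_of_real)
    also have "Re ((\<zeta> + z) * cnj (\<zeta> - z)) = (cmod \<zeta>)\<^sup>2 - (cmod z)\<^sup>2"
      unfolding cmod_power2 by (simp add: power2_eq_square algebra_simps)
    also have "\<dots> = 1 - (cmod z)\<^sup>2" using that by simp
    finally show ?thesis using z by (simp add: power_le_one less_imp_le)
  qed
  have re: "Re (herglotz v z) = (\<integral>\<zeta>. Re ((\<zeta> + z) / (\<zeta> - z)) * v \<zeta> \<partial>circle_measure)"
    "integrable circle_measure (\<lambda>\<zeta>. Re ((\<zeta> + z) / (\<zeta> - z)) * v \<zeta>)"
    if v: "integrable circle_measure v" for v
  proof -
    have eq: "Re ((\<zeta> + z) / (\<zeta> - z) * of_real (v \<zeta>)) = Re ((\<zeta> + z) / (\<zeta> - z)) * v \<zeta>" for \<zeta>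
      by (simp only: times_complex.simps Re_complex_of_real Im_complex_of_real mult_zero_right diff_zero)
    show "Re (herglotz v z) = (\<integral>\<zeta>. Re ((\<zeta> + z) / (\<zeta> - z)) * v \<zeta> \<partial>circle_measure)"
      unfolding herglotz_def eq[symmetric] by (rule integral_Re[OF herglotz_integrable[OF z v], symmetric])
    show "integrable circle_measure (\<lambda>\<zeta>. Re ((\<zeta> + z) / (\<zeta> - z)) * v \<zeta>)"
      unfolding eq[symmetric] by (rule integrable_Re[OF herglotz_integrable[OF z v]])
  qed
  have one: "integrable circle_measure (\<lambda>_. 1 :: real)" by simp
  have "Re (herglotz u z) \<le> (\<integral>\<zeta>. Re ((\<zeta> + z) / (\<zeta> - z)) * K \<partial>circle_measure)"
    unfolding re(1)[OF u]
  proof (rule Bochner_Integration.integral_mono[OF re(2)[OF u] re(2)])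
    show "Re ((\<zeta> + z) / (\<zeta> - z)) * u \<zeta> \<le> Re ((\<zeta> + z) / (\<zeta> - z)) * K" if "\<zeta> \<in> space circle_measure" for \<zeta>
      using that by (intro mult_left_mono K pos) auto
  qed simp
  also have "\<dots> = (\<integral>\<zeta>. Re ((\<zeta> + z) / (\<zeta> - z)) * 1 \<partial>circle_measure) * K"
    unfolding mult_1_right by (rule integral_mult_left_zero)
  also have "(\<integral>\<zeta>. Re ((\<zeta> + z) / (\<zeta> - z)) * 1 \<partial>circle_measure) = 1"
    unfolding re(1)[OF one, symmetric] by (simp add: herglotz_one[OF z])
  finally show ?thesis by simp
qed

text \<open>Truncating \<open>- ln \<phi>\<close> from above yields bounded approximate inverses of an outer function.\<close>

lemma outer_approximate_inverses:
  assumes "outer a"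
  obtains c h where "cmod c = 1" "\<And>n::nat. h n \<in> Hinf"
    "\<And>n z. cmod z < 1 \<Longrightarrow> cmod (a z * h n z) \<le> 1" "(\<lambda>n. a 0 * h n 0) \<longlonglongrightarrow> c"
proof -
  obtain c \<phi> where c: "cmod c = 1" and i: "integrable circle_measure (\<lambda>\<zeta>. ln (\<phi> \<zeta>) :: real)"
    and a: "\<forall>z\<in>ball 0 1. a z = c * exp (herglotz (\<lambda>\<zeta>. ln (\<phi> \<zeta>)) z)"
    using assms unfolding outer_def herglotz_def by blast
  have [measurable]: "(\<lambda>\<zeta>. ln (\<phi> \<zeta>)) \<in> borel_measurable circle_measure" using i by auto
  \<comment> \<open>The cap \<open>ln (real n + 1)\<close> bounds \<open>h n\<close>. The other
    entry of the minimum keeps \<open>ln (\<phi> \<zeta>) + u n \<zeta> \<le> 0\<close>, hence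
    \<open>cmod (a z * h n z) \<le> 1\<close>. Nonnegativity of the cap makes
    \<open>\<bar>ln (\<phi> \<zeta>)\<bar>\<close> a dominating function.\<close>
  define u where "u n \<zeta> = min (ln (real n + 1)) (- ln (\<phi> \<zeta>))" for n :: nat and \<zeta>
  have ln0: "0 \<le> ln (real n + 1)" for n :: nat by simp
  have ui: "integrable circle_measure (u n)" for n
    unfolding u_def using i by (intro integrable_min) auto
  define h where "h n z = exp (herglotz (u n) z)" for n z
  have ah: "a z * h n z = c * exp (herglotz (\<lambda>\<zeta>. ln (\<phi> \<zeta>) + u n \<zeta>) z)" if "cmod z < 1" for n z
    using a that by (simp add: h_def herglotz_add[OF that i ui] exp_add)
  show ?thesis
  proof (rule that[of c h])
    show "h n \<in> Hinf" for n
    proof (rule HinfI)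
      show "h n holomorphic_on ball 0 1"
        unfolding h_def[abs_def] by (intro holomorphic_intros herglotz_holomorphic ui)
      show "cmod (h n z) \<le> exp (ln (real n + 1))" if "cmod z < 1" for z
        unfolding h_def norm_exp_eq_Re exp_le_cancel_iff by (rule Re_herglotz_le[OF that ui]) (simp add: u_def)
    qed
    show "cmod (a z * h n z) \<le> 1" if "cmod z < 1" for n z
    proof -
      have "Re (herglotz (\<lambda>\<zeta>. ln (\<phi> \<zeta>) + u n \<zeta>) z) \<le> 0"
        by (rule Re_herglotz_le[OF that Bochner_Integration.integrable_add[OF i ui]]) (simp add: u_def)
      then show ?thesis unfolding ah[OF that] by (simp add: norm_mult c norm_exp_eq_Re)
    qed
    \<comment> \<open>This integral is the exponent of \<open>a * h n\<close> at the origin.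
      Pointwise the integrand is eventually exactly zero, as soon as the cap exceeds
      \<open>- ln (\<phi> \<zeta>)\<close>.\<close>
    have "(\<lambda>n. \<integral>\<zeta>. ln (\<phi> \<zeta>) + u n \<zeta> \<partial>circle_measure) \<longlonglongrightarrow> (\<integral>\<zeta>. 0 \<partial>circle_measure)"
    proof (rule integral_dominated_convergence[where w = "\<lambda>\<zeta>. \<bar>ln (\<phi> \<zeta>)\<bar>"])
      show "(\<lambda>\<zeta>. ln (\<phi> \<zeta>) + u n \<zeta>) \<in> borel_measurable circle_measure" for n
        using i ui by (intro borel_measurable_add) auto
      show "AE \<zeta> in circle_measure. norm (ln (\<phi> \<zeta>) + u n \<zeta>) \<le> \<bar>ln (\<phi> \<zeta>)\<bar>" for n
      proof -
        have "\<bar>x + min L (- x)\<bar> \<le> \<bar>x\<bar>" if "0 \<le> L" for x L :: real using that by (auto simp: min_def)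
        from this[OF ln0] show ?thesis unfolding u_def real_norm_def by simp
      qed
      show "AE \<zeta> in circle_measure. (\<lambda>n. ln (\<phi> \<zeta>) + u n \<zeta>) \<longlonglongrightarrow> 0"
      proof (rule AE_I2)
        fix \<zeta>
        have "\<forall>\<^sub>F n in sequentially. ln (\<phi> \<zeta>) + u n \<zeta> = 0"
        proof -
          obtain N :: nat where N: "exp (- ln (\<phi> \<zeta>)) < real N" using reals_Archimedean2 by blast
          have "ln (\<phi> \<zeta>) + u n \<zeta> = 0" if "n \<ge> N" for n
          proof -
            have "exp (- ln (\<phi> \<zeta>)) \<le> real n + 1" using N that by linarith
            then have "- ln (\<phi> \<zeta>) \<le> ln (real n + 1)" by (subst ln_ge_iff) auto
            then show ?thesis by (simp add: u_def)
          qed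
          then show ?thesis unfolding eventually_sequentially by blast
        qed
        then show "(\<lambda>n. ln (\<phi> \<zeta>) + u n \<zeta>) \<longlonglongrightarrow> 0" by (rule tendsto_eventually)
      qed
    qed (use i in auto)
    then have "(\<lambda>n. c * exp (of_real (\<integral>\<zeta>. ln (\<phi> \<zeta>) + u n \<zeta> \<partial>circle_measure))) \<longlonglongrightarrow> c * exp (of_real 0)"
      by (intro tendsto_intros) simp
    then show "(\<lambda>n. a 0 * h n 0) \<longlonglongrightarrow> c" by (simp add: ah herglotz_zero)
  qed (rule c)
qed

lemma Hinf_mult: 
  assumes a: "a \<in> Hinf" and b: "b \<in> Hinf" shows "(\<lambda>z. a z * b z) \<in> Hinf"
proof -
  obtain M where M: "M \<ge> 0" "\<And>z. cmod z < 1 \<Longrightarrow> cmod (a z) \<le> M" using Hinf_bound[OF a] by blast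
  obtain N where N: "N \<ge> 0" "\<And>z. cmod z < 1 \<Longrightarrow> cmod (b z) \<le> N" using Hinf_bound[OF b] by blast
  show ?thesis
  proof (rule HinfI)
    show "(\<lambda>z. a z * b z) holomorphic_on ball 0 1"
      by (intro holomorphic_intros Hinf_holomorphic a b)
    show "cmod (a z * b z) \<le> M * N" if "cmod z < 1" for z
      unfolding norm_mult using that M N by (intro mult_mono) auto
  qed
qed

text \<open>Since \<open>boundary q\<close> has modulus at most 1 almost everywhere, the square is
  at most \<open>2 - 2 * Re (cnj c * boundary q \<zeta>)\<close>, and the mean of
  \<open>boundary q\<close> is \<open>q 0\<close>. So convergence at the single point 0 controls
  convergence on the circle.\<close>

lemma contraction_boundary_distance:
  assumes q: "q \<in> Hinf" "\<And>z. cmod z < 1 \<Longrightarrow> cmod (q z) \<le> 1" and c: "cmod c = 1"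
  shows "(\<lambda>\<zeta>. c - boundary q \<zeta>) \<in> circle_L2"
    "(\<integral>\<zeta>. (cmod (c - boundary q \<zeta>))\<^sup>2 \<partial>circle_measure) \<le> 2 - 2 * Re (cnj c * q 0)"
proof -
  have m [measurable]: "boundary q \<in> borel_measurable circle_measure"
    by (intro boundary_measurable Hinf_holomorphic q)
  have b: "AE \<zeta> in circle_measure. cmod (boundary q \<zeta>) \<le> 1" by (rule Hinf_boundary_bound[OF q])
  have one: "(\<lambda>\<zeta>. 1) \<in> circle_L2" by (intro circle_L2_continuous continuous_intros)
  have qL: "boundary q \<in> circle_L2" using circle_L2_bounded_mult(1)[OF one m b] by simp
  have cL: "(\<lambda>\<zeta>. c) \<in> circle_L2" by (intro circle_L2_continuous continuous_intros)
  show L: "(\<lambda>\<zeta>. c - boundary q \<zeta>) \<in> circle_L2" by (intro circle_L2_diff cL qL)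
  have qi: "integrable circle_measure (boundary q)"
    using circle_L2_prod_integrable[OF qL one] by simp
  have q0: "(\<integral>\<zeta>. boundary q \<zeta> \<partial>circle_measure) = q 0"
  proof -
    have "q 0 = L2_inner (boundary (disk_restrict q)) (szego_kernel 0)"
      using boundary_reproducing[OF disk_restrict_H2[OF q(1)], of 0] by (simp add: disk_restrict_def)
    also have "\<dots> = (\<integral>\<zeta>. boundary q \<zeta> \<partial>circle_measure)"
      unfolding L2_inner_def by (intro Bochner_Integration.integral_cong) (auto simp: boundary_disk_restrict szego_kernel_def)
    finally show ?thesis by simp
  qed
  have i: "integrable circle_measure (\<lambda>\<zeta>. Re (cnj c * boundary q \<zeta>))"
    using qi by (intro integrable_Re integrable_mult_right) auto
  have "(\<integral>\<zeta>. (cmod (c - boundary q \<zeta>))\<^sup>2 \<partial>circle_measure) \<le> (\<integral>\<zeta>. 2 - 2 * Re (cnj c * boundary q \<zeta>) \<partial>circle_measure)"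
  proof (rule integral_mono_AE[OF circle_L2_integrable[OF L]])
    show "integrable circle_measure (\<lambda>\<zeta>. 2 - 2 * Re (cnj c * boundary q \<zeta>))"
      using i by (intro Bochner_Integration.integrable_diff integrable_mult_right) auto
    show "AE \<zeta> in circle_measure. (cmod (c - boundary q \<zeta>))\<^sup>2 \<le> 2 - 2 * Re (cnj c * boundary q \<zeta>)"
      using b
    proof eventually_elim
      fix \<zeta> assume le: "cmod (boundary q \<zeta>) \<le> 1"
      have "(cmod (c - boundary q \<zeta>))\<^sup>2 = (cmod c)\<^sup>2 + (cmod (boundary q \<zeta>))\<^sup>2 - 2 * Re (cnj c * boundary q \<zeta>)"
        unfolding cmod_power2 by (simp add: power2_eq_square algebra_simps)
      moreover have "(cmod (boundary q \<zeta>))\<^sup>2 \<le> 1" using le by (simp add: power_le_one)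
      ultimately show "(cmod (c - boundary q \<zeta>))\<^sup>2 \<le> 2 - 2 * Re (cnj c * boundary q \<zeta>)" using c by simp
    qed
  qed
  also have "\<dots> = 2 - 2 * (\<integral>\<zeta>. Re (cnj c * boundary q \<zeta>) \<partial>circle_measure)"
  proof -
    define R where "R \<zeta> = Re (cnj c * boundary q \<zeta>)" for \<zeta>
    show ?thesis using i circle.prob_space unfolding R_def[symmetric] by simp
  qed
  also have "(\<integral>\<zeta>. Re (cnj c * boundary q \<zeta>) \<partial>circle_measure) = Re (cnj c * q 0)"
  proof -
    have "integrable circle_measure (\<lambda>\<zeta>. cnj c * boundary q \<zeta>)" using qi by simp
    from integral_Re[OF this] show ?thesis by (simp add: q0 del: times_complex.sel)
  qed
  finally show "(\<integral>\<zeta>. (cmod (c - boundary q \<zeta>))\<^sup>2 \<partial>circle_measure) \<le> 2 - 2 * Re (cnj c * q 0)" .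
qed

lemma outer_approximants:
  assumes a: "a \<in> Hinf" "outer a"
  obtains c h where "cmod c = 1" "\<And>n::nat. h n \<in> Hinf"
    "\<And>n. (\<lambda>\<zeta>. c - boundary (\<lambda>z. a z * h n z) \<zeta>) \<in> circle_L2"
    "(\<lambda>n. \<integral>\<zeta>. (cmod (c - boundary (\<lambda>z. a z * h n z) \<zeta>))\<^sup>2 \<partial>circle_measure) \<longlonglongrightarrow> 0"
proof -
  obtain c h where ch: "cmod c = 1" "\<And>n::nat. h n \<in> Hinf"
    "\<And>n z. cmod z < 1 \<Longrightarrow> cmod (a z * h n z) \<le> 1" "(\<lambda>n. a 0 * h n 0) \<longlonglongrightarrow> c"
    by (rule outer_approximate_inverses[OF a(2)]) (rule that)
  note d = contraction_boundary_distance[OF Hinf_mult[OF a(1) ch(2)] ch(3) ch(1)]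
  have "(\<lambda>n. 2 - 2 * Re (cnj c * (a 0 * h n 0))) \<longlonglongrightarrow> 2 - 2 * Re (cnj c * c)"
    by (intro tendsto_intros ch(4))
  moreover have "cnj c * c = 1" using ch(1) by (simp add: complex_norm_square[symmetric] mult.commute)
  ultimately have lim: "(\<lambda>n. 2 - 2 * Re (cnj c * (a 0 * h n 0))) \<longlonglongrightarrow> 0" by simp
  show ?thesis
  proof (rule that[OF ch(1,2) d(1)])
    show "(\<lambda>n. \<integral>\<zeta>. (cmod (c - boundary (\<lambda>z. a z * h n z) \<zeta>))\<^sup>2 \<partial>circle_measure) \<longlonglongrightarrow> 0"
      by (rule tendsto_sandwich[OF _ _ tendsto_const lim])
         (intro always_eventually allI d(2) Bochner_Integration.integral_nonneg zero_le_power2)+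
  qed
qed

lemma Hinf_boundary_mult_AE:
  assumes a: "a \<in> Hinf" and b: "b \<in> Hinf"
  shows "AE \<zeta> in circle_measure. boundary (\<lambda>z. a z * b z) \<zeta> = boundary a \<zeta> * boundary b \<zeta>"
  using Hinf_boundary_tendsto[OF a] Hinf_boundary_tendsto[OF b]
  by eventually_elim (subst boundary_def, intro tendsto_Lim tendsto_mult; simp)

text \<open>Where the boundary function of \<open>a\<close> vanishes, so does almost everywhere that
  of \<open>a * h n\<close>, and the integrand of \<open>outer_approximants\<close> equals
  \<open>(cmod c)\<^sup>2 = 1\<close>. The integrals tend to 0 and dominate the measure of the zero
  set.\<close>

lemma outer_boundary_nonzero:
  assumes a: "a \<in> Hinf" "outer a"
  shows "AE \<zeta> in circle_measure. boundary a \<zeta> \<noteq> 0"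
proof -
  obtain c h where ch: "cmod c = 1" "\<And>n::nat. h n \<in> Hinf"
    "\<And>n. (\<lambda>\<zeta>. c - boundary (\<lambda>z. a z * h n z) \<zeta>) \<in> circle_L2"
    "(\<lambda>n. \<integral>\<zeta>. (cmod (c - boundary (\<lambda>z. a z * h n z) \<zeta>))\<^sup>2 \<partial>circle_measure) \<longlonglongrightarrow> 0"
    by (rule outer_approximants[OF a]) (rule that)
  have [measurable]: "boundary a \<in> borel_measurable circle_measure"
    by (intro boundary_measurable Hinf_holomorphic a)
  define E where "E = {\<zeta>\<in>space circle_measure. boundary a \<zeta> = 0}"
  have E [measurable]: "E \<in> sets circle_measure" unfolding E_def by measurable
  have le: "measure circle_measure E \<le> (\<integral>\<zeta>. (cmod (c - boundary (\<lambda>z. a z * h n z) \<zeta>))\<^sup>2 \<partial>circle_measure)" for n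
  proof -
    have "measure circle_measure E = (\<integral>\<zeta>. indicator E \<zeta> \<partial>circle_measure)"
      using sets.Int_space_eq2[OF E] by simp
    also have "\<dots> \<le> (\<integral>\<zeta>. (cmod (c - boundary (\<lambda>z. a z * h n z) \<zeta>))\<^sup>2 \<partial>circle_measure)"
    proof (rule integral_mono_AE[OF _ circle_L2_integrable[OF ch(3)]])
      show "integrable circle_measure (indicat_real E)" using E by (simp add: circle.emeasure_eq_measure)
      show "AE \<zeta> in circle_measure. indicat_real E \<zeta> \<le> (cmod (c - boundary (\<lambda>z. a z * h n z) \<zeta>))\<^sup>2"
        using Hinf_boundary_mult_AE[OF a(1) ch(2)[of n]]
        by eventually_elim (auto simp: E_def ch(1) split: split_indicator)
    qed
    finally show ?thesis .
  qed
  have "measure circle_measure E \<le> 0" by (rule LIMSEQ_le_const[OF ch(4)]) (use le in blast)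
  then have "emeasure circle_measure E = 0" by (simp add: circle.emeasure_eq_measure measure_le_0_iff)
  then have "AE \<zeta> in circle_measure. \<zeta> \<notin> E" using E by (intro AE_not_in) auto
  then show ?thesis by (rule AE_mp[OF _ AE_I2]) (simp add: E_def)
qed

text \<open>With \<open>k\<close> the reproducing kernel at \<open>z\<close>, pairing
  \<open>c * k\<close> with \<open>g\<close> gives \<open>c * cnj (g z)\<close>. Subtracting the
  multiple \<open>a * h n * k\<close> of \<open>a\<close>, which is orthogonal to \<open>g\<close>,
  leaves \<open>k * (c - a * h n)\<close>; this tends to 0 in mean square because \<open>k\<close>
  is bounded.\<close>

lemma outer_multiples_dense:
  assumes a: "a \<in> Hinf" "outer a" and g: "g \<in> H2"
    and orth: "\<And>h. h \<in> H2 \<Longrightarrow> H2_inner (\<lambda>z. a z * h z) g = 0"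
  shows "g = (\<lambda>z. 0)"
proof
  fix z
  show "g z = 0"
  proof (cases "cmod z < 1")
    case False
    then show ?thesis by (rule H2_off_disk[OF g])
  next
    case z: True
    obtain c h where ch: "cmod c = 1" "\<And>n::nat. h n \<in> Hinf"
      "\<And>n. (\<lambda>\<zeta>. c - boundary (\<lambda>z. a z * h n z) \<zeta>) \<in> circle_L2"
      "(\<lambda>n. \<integral>\<zeta>. (cmod (c - boundary (\<lambda>z. a z * h n z) \<zeta>))\<^sup>2 \<partial>circle_measure) \<longlonglongrightarrow> 0"
      by (rule outer_approximants[OF a]) (rule that)
    define k where "k = szego_kernel z"
    define q where "q n w = a w * h n w" for n w
    define M where "M = 1 / (1 - cmod z)"
    have kc: "continuous_on (cball 0 1) k" unfolding k_def by (rule szego_kernel_continuous[OF z])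
    have kM: "cmod (k w) \<le> M" if "cmod w \<le> 1" for w
      unfolding k_def M_def by (rule szego_kernel_bound[OF z that])
    have kH: "k \<in> Hinf"
    proof (rule HinfI)
      show "k holomorphic_on ball 0 1"
        unfolding k_def szego_kernel_def
        by (intro holomorphic_intros one_minus_cnj_mult_nonzero(1) z) auto
      show "cmod (k w) \<le> M" if "cmod w < 1" for w using kM that by simp
    qed
    have kb: "boundary k \<zeta> = k \<zeta>" if "cmod \<zeta> = 1" for \<zeta>
    proof -
      have "((\<lambda>r. k (of_real r * \<zeta>)) \<longlongrightarrow> k (of_real 1 * \<zeta>)) (at_left 1)"
      proof -
        have "continuous_on {0..1} (\<lambda>r. k (of_real r * \<zeta>))"
          using that by (intro continuous_on_compose2[OF kc] continuous_intros) (auto simp: norm_mult)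
        then have "((\<lambda>r. k (of_real r * \<zeta>)) \<longlongrightarrow> k (of_real 1 * \<zeta>)) (at 1 within {0..1})"
          unfolding continuous_on by (rule bspec[of "{0..1}" _ 1]) simp
        then show ?thesis by (simp add: at_within_Icc_at_left)
      qed
      then show ?thesis unfolding boundary_def by (intro tendsto_Lim) auto
    qed
    have km: "k \<in> borel_measurable circle_measure"
      using kc by (intro borel_measurable_circle_continuous continuous_on_subset[OF kc]) auto
    have kMA: "AE \<zeta> in circle_measure. cmod (k \<zeta>) \<le> M" by (intro AE_I2 kM) simp
    have kL: "k \<in> circle_L2" unfolding k_def by (rule szego_kernel_L2[OF z])
    have gL: "boundary g \<in> circle_L2" by (rule boundary_in_L2[OF g])
    have qm: "boundary (q n) \<in> borel_measurable circle_measure" for n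
      unfolding q_def by (intro boundary_measurable Hinf_holomorphic Hinf_mult a ch)
    have "cmod (c * cnj (g z)) \<le> sqrt (M\<^sup>2 * (\<integral>\<zeta>. (cmod (c - boundary (q n) \<zeta>))\<^sup>2 \<partial>circle_measure) * H2_sqnorm g)" for n
    proof -
      have hk: "(\<lambda>w. h n w * disk_restrict k w) \<in> H2" by (intro Hinf_mult_H2 ch disk_restrict_H2 kH)
      have AEq: "AE \<zeta> in circle_measure. boundary (\<lambda>w. q n w * disk_restrict k w) \<zeta> = k \<zeta> * boundary (q n) \<zeta>"
      proof -
        have "q n \<in> Hinf" unfolding q_def[abs_def] by (intro Hinf_mult a ch)
        from boundary_mult_AE[OF this disk_restrict_H2[OF kH]] AE_space[of circle_measure] show ?thesis
          by eventually_elim (auto simp: boundary_disk_restrict kb mult.commute)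
      qed
      \<comment> \<open>Regrouped, the product is \<open>a\<close> times a member of
        \<open>H2\<close>, so that \<open>orth\<close> applies.\<close>
      have qk: "(\<lambda>w. q n w * disk_restrict k w) = (\<lambda>w. a w * (h n w * disk_restrict k w))"
        by (simp add: q_def mult.assoc)
      have qkL: "(\<lambda>\<zeta>. k \<zeta> * boundary (q n) \<zeta>) \<in> borel_measurable circle_measure"
        by (intro borel_measurable_times km qm)
      have "L2_inner (\<lambda>\<zeta>. k \<zeta> * boundary (q n) \<zeta>) (boundary g) =
          L2_inner (boundary (\<lambda>w. q n w * disk_restrict k w)) (boundary g)"
        by (rule L2_inner_cong_AE)
           (use AEq qkL boundary_borel[OF g] boundary_borel[OF Hinf_mult_H2[OF a(1) hk]] in \<open>auto simp: qk\<close>)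
      also have "\<dots> = 0" using orth[OF hk] unfolding qk H2_inner_def .
      finally have z0: "L2_inner (\<lambda>\<zeta>. k \<zeta> * boundary (q n) \<zeta>) (boundary g) = 0" .
      have dL: "(\<lambda>\<zeta>. k \<zeta> * (c - boundary (q n) \<zeta>)) \<in> circle_L2"
        and dle: "(\<integral>\<zeta>. (cmod (k \<zeta> * (c - boundary (q n) \<zeta>)))\<^sup>2 \<partial>circle_measure)
          \<le> M\<^sup>2 * (\<integral>\<zeta>. (cmod (c - boundary (q n) \<zeta>))\<^sup>2 \<partial>circle_measure)"
        using circle_L2_bounded_mult[OF ch(3)[of n] km kMA] unfolding q_def[abs_def] by simp_all
      have "(\<lambda>\<zeta>. c * k \<zeta> - k \<zeta> * (c - boundary (q n) \<zeta>)) \<in> circle_L2"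
        by (intro circle_L2_diff circle_L2_scale kL dL)
      then have qkL2: "(\<lambda>\<zeta>. k \<zeta> * boundary (q n) \<zeta>) \<in> circle_L2" by (simp add: algebra_simps)
      have "c * cnj (g z) = c * L2_inner k (boundary g)"
        using boundary_reproducing[OF g z] L2_inner_cnj[of "boundary g" k] by (simp add: k_def)
      also have "\<dots> = L2_inner (\<lambda>\<zeta>. c * k \<zeta>) (boundary g)" by (simp add: L2_inner_scale_left)
      also have "\<dots> = L2_inner (\<lambda>\<zeta>. c * k \<zeta>) (boundary g) - L2_inner (\<lambda>\<zeta>. k \<zeta> * boundary (q n) \<zeta>) (boundary g)"
        unfolding z0 by simp
      also have "\<dots> = L2_inner (\<lambda>\<zeta>. c * k \<zeta> - k \<zeta> * boundary (q n) \<zeta>) (boundary g)"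
        by (intro L2_inner_diff_left[symmetric] circle_L2_scale kL qkL2 gL)
      also have "\<dots> = L2_inner (\<lambda>\<zeta>. k \<zeta> * (c - boundary (q n) \<zeta>)) (boundary g)" by (simp add: algebra_simps)
      finally have "cmod (c * cnj (g z)) \<le>
          sqrt ((\<integral>\<zeta>. (cmod (k \<zeta> * (c - boundary (q n) \<zeta>)))\<^sup>2 \<partial>circle_measure) * H2_sqnorm g)"
        unfolding H2_sqnorm_def using L2_Cauchy_Schwarz[OF dL gL] by (intro real_le_rsqrt) simp
      also have "\<dots> \<le> sqrt (M\<^sup>2 * (\<integral>\<zeta>. (cmod (c - boundary (q n) \<zeta>))\<^sup>2 \<partial>circle_measure) * H2_sqnorm g)"
        by (intro real_sqrt_le_mono mult_right_mono dle H2_sqnorm_nonneg)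
      finally show ?thesis .
    qed
    moreover have "(\<lambda>n. sqrt (M\<^sup>2 * (\<integral>\<zeta>. (cmod (c - boundary (q n) \<zeta>))\<^sup>2 \<partial>circle_measure) * H2_sqnorm g))
        \<longlonglongrightarrow> sqrt (M\<^sup>2 * 0 * H2_sqnorm g)"
      using ch(4) unfolding q_def by (intro tendsto_intros)
    ultimately have "cmod (c * cnj (g z)) \<le> sqrt (M\<^sup>2 * 0 * H2_sqnorm g)"
      by (intro LIMSEQ_le_const) auto
    then show ?thesis using ch(1) by (simp add: norm_mult)
  qed
qed

section \<open>Closed range and left invertibility\<close>

text \<open>The topologies live on carrier sets with their own distances; \<open>f\<close> matches
  balls and complements, and closedness is expressed through these alone.\<close>

lemma closedin_isometric_image:
  assumes A: "Metric_space A d" and B: "Metric_space (f ` A) e"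
    and iso: "\<And>x y. x \<in> A \<Longrightarrow> y \<in> A \<Longrightarrow> e (f x) (f y) = d x y" and C: "C \<subseteq> A"
  shows "closedin (Metric_space.mtopology (f ` A) e) (f ` C) \<longleftrightarrow> closedin (Metric_space.mtopology A d) C"
proof -
  interpret A: Metric_space A d by fact
  interpret B: Metric_space "f ` A" e by fact
  have inj: "inj_on f A"
  proof (rule inj_onI)
    fix x y assume xy: "x \<in> A" "y \<in> A" "f x = f y"
    then have "d x y = 0" using iso[OF xy(1,2)] B.mdist_zero[of "f y"] by auto
    then show "x = y" using xy by simp
  qed
  have disj: "disjnt (f ` C) (B.mball (f x) r) \<longleftrightarrow> disjnt C (A.mball x r)" if "x \<in> A" for x r
    using that C by (auto simp: disjnt_iff iso subset_iff)
  have diff: "f ` A - f ` C = f ` (A - C)"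
    using inj_on_image_set_diff[OF inj, of A C] C by auto
  show ?thesis
    unfolding A.closedin_metric B.closedin_metric
  proof (intro conj_cong)
    show "f ` C \<subseteq> f ` A \<longleftrightarrow> C \<subseteq> A" using C by auto
    show "(\<forall>y. y \<in> f ` A - f ` C \<longrightarrow> (\<exists>r>0. disjnt (f ` C) (B.mball y r))) \<longleftrightarrow>
        (\<forall>x. x \<in> A - C \<longrightarrow> (\<exists>r>0. disjnt C (A.mball x r)))"
      unfolding diff
    proof (intro iffI allI impI)
      fix x assume "\<forall>y. y \<in> f ` (A - C) \<longrightarrow> (\<exists>r>0. disjnt (f ` C) (B.mball y r))" and x: "x \<in> A - C"
      then obtain r where "r > 0" "disjnt (f ` C) (B.mball (f x) r)" by blast
      with x disj[of x r] show "\<exists>r>0. disjnt C (A.mball x r)" by blast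
    next
      fix y assume *: "\<forall>x. x \<in> A - C \<longrightarrow> (\<exists>r>0. disjnt C (A.mball x r))" and "y \<in> f ` (A - C)"
      then obtain x where x: "x \<in> A - C" "y = f x" by blast
      with * obtain r where "r > 0" "disjnt C (A.mball x r)" by blast
      with x disj[of x r] show "\<exists>r>0. disjnt (f ` C) (B.mball y r)" by blast
    qed
  qed
qed

text \<open>\<open>Metric_space\<close> demands nonnegativity and symmetry of the distance for all
  arguments, also off the carrier. Hence the unrestricted assumptions on \<open>e\<close>, and the
  later symmetry lemmas that deal with default values.\<close>

lemma Metric_space_isometric_image:
  assumes A: "Metric_space A d"
    and iso: "\<And>x y. x \<in> A \<Longrightarrow> y \<in> A \<Longrightarrow> e (f x) (f y) = d x y"
    and e: "\<And>x y. 0 \<le> e x y" "\<And>x y. e x y = e y x" and inj: "inj_on f A"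
  shows "Metric_space (f ` A) e"
proof -
  interpret A: Metric_space A d by fact
  show ?thesis
  proof
    show "0 \<le> e x y" "e x y = e y x" for x y by (rule e)+
    show "e x y = 0 \<longleftrightarrow> x = y" if "x \<in> f ` A" "y \<in> f ` A" for x y
      using that inj by (auto simp: iso inj_on_eq_iff)
    show "e x z \<le> e x y + e y z" if "x \<in> f ` A" "y \<in> f ` A" "z \<in> f ` A" for x y z
      using that by (auto simp: iso A.triangle)
  qed
qed

text \<open>Where the radial limit of \<open>f\<close> does not exist, \<open>boundary f\<close> and \<open>boundary (- f)\<close> have the same
  junk value.\<close>

lemma cmod_boundary_minus: "cmod (boundary (\<lambda>z. - f z) \<zeta>) = cmod (boundary f \<zeta>)"
proof (cases "\<exists>l. ((\<lambda>r. f (of_real r * \<zeta>)) \<longlongrightarrow> l) (at_left 1)")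
  case True
  then obtain l where l: "((\<lambda>r. f (of_real r * \<zeta>)) \<longlongrightarrow> l) (at_left 1)" by blast
  then have "boundary f \<zeta> = l" "boundary (\<lambda>z. - f z) \<zeta> = - l"
    unfolding boundary_def by (intro tendsto_Lim tendsto_minus; simp)+
  then show ?thesis by simp
next
  case False
  then have "\<not> ((\<lambda>r. - f (of_real r * \<zeta>)) \<longlongrightarrow> l) (at_left 1)" for l
    using tendsto_minus_cancel_left[of "\<lambda>r. f (of_real r * \<zeta>)"] by (metis tendsto_minus_cancel minus_minus)
  with False show ?thesis unfolding boundary_def t2_space_class.Lim_def by simp
qed

lemma H2_norm_nonneg: "0 \<le> H2_norm f"
  by (simp add: H2_norm_def H2_inner_self H2_sqnorm_nonneg)

lemma H2_norm_minus: "H2_norm (\<lambda>z. - f z) = H2_norm f"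
  by (simp add: H2_norm_def H2_inner_self H2_sqnorm_def cmod_boundary_minus)

lemma H2_norm_diff_commute: "H2_norm (\<lambda>z. f z - g z) = H2_norm (\<lambda>z. g z - f z)"
  using H2_norm_minus[of "\<lambda>z. f z - g z"] by simp

lemma range_disk_fun: "range disk_fun = H2"
  by (rule type_definition.Rep_range[OF type_definition_hardy])

lemma H2_norm_dist: "H2_norm (\<lambda>z. disk_fun f z - disk_fun g z) = dist f g"
  by (simp add: dist_norm H2_norm_disk_fun[symmetric] disk_fun_diff)

lemma Metric_space_H2: "Metric_space H2 (\<lambda>f g. H2_norm (\<lambda>z. f z - g z))"
  unfolding range_disk_fun[symmetric]
proof (rule Metric_space_isometric_image[OF Met_TC.Metric_space_axioms])
  show "H2_norm (\<lambda>z. disk_fun f z - disk_fun g z) = dist f g" for f g by (rule H2_norm_dist)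
  show "inj disk_fun" by (intro injI) (simp add: disk_fun_inject)
qed (rule H2_norm_nonneg H2_norm_diff_commute)+

lemma closedin_H2_iff:
  "closedin (Metric_space.mtopology H2 (\<lambda>f g. H2_norm (\<lambda>z. f z - g z))) (disk_fun ` C) \<longleftrightarrow> closed C"
proof -
  have "closedin (Metric_space.mtopology (range disk_fun) (\<lambda>f g. H2_norm (\<lambda>z. f z - g z))) (disk_fun ` C) \<longleftrightarrow>
      closedin Met_TC.mtopology C"
    by (rule closedin_isometric_image[OF Met_TC.Metric_space_axioms
        Metric_space_H2[folded range_disk_fun]]) (simp_all add: H2_norm_dist)
  then show ?thesis by (simp only: range_disk_fun mtopology_is_euclidean closed_closedin)
qed

section \<open>The co-analytic Toeplitz operator and its range space\<close>

text \<open>The adjoint of \<open>T_conj a\<close> is multiplication by \<open>a\<close>, which maps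
  \<open>H2\<close> into itself.\<close>

lemma T_conj_inner:
  assumes a: "a \<in> Hinf" and f: "f \<in> H2" and h: "h \<in> H2"
  shows "H2_inner (T_conj a f) h = H2_inner f (\<lambda>z. a z * h z)"
proof -
  note \<phi> = bounded_symbol_cnj[OF bounded_symbol_boundary[OF a]]
  have "H2_inner (T_conj a f) h = L2_inner (\<lambda>\<zeta>. cnj (boundary a \<zeta>) * boundary f \<zeta>) (boundary h)"
    by (rule Toeplitz_characterization(2)[OF \<phi> f h])
  also have "\<dots> = L2_inner (boundary f) (\<lambda>\<zeta>. boundary a \<zeta> * boundary h \<zeta>)"
    by (simp add: L2_inner_def mult_ac)
  also have "\<dots> = L2_inner (boundary f) (boundary (\<lambda>z. a z * h z))"
  proof (rule L2_inner_cong_AE)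
    show "AE \<zeta> in circle_measure. boundary a \<zeta> * boundary h \<zeta> = boundary (\<lambda>z. a z * h z) \<zeta>"
      using boundary_mult_AE[OF a h] by eventually_elim simp
  qed (simp, (intro borel_measurable_times boundary_measurable[OF Hinf_holomorphic[OF a]] boundary_borel[OF f]
        boundary_borel[OF h] boundary_borel[OF Hinf_mult_H2[OF a h]])+)
  finally show ?thesis by (simp add: H2_inner_def)
qed

text \<open>A kernel element of \<open>T_conj a\<close> is orthogonal to all multiples of
  \<open>a\<close>, and these are dense.\<close>

lemma T_conj_inject:
  assumes a: "a \<in> Hinf" "outer a" and f: "f \<in> H2" and "T_conj a f = (\<lambda>z. 0)"
  shows "f = (\<lambda>z. 0)"
proof (rule outer_multiples_dense[OF a f])
  fix h assume h: "h \<in> H2"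
  have "H2_inner f (\<lambda>z. a z * h z) = H2_inner (\<lambda>z. 0) h"
    using T_conj_inner[OF a(1) f h] assms(4) by simp
  also have "\<dots> = 0" using H2_inner_scale_left[OF H2_zero h, of 0] by simp
  finally show "H2_inner (\<lambda>z. a z * h z) f = 0" using H2_inner_cnj[of f "\<lambda>z. a z * h z"] by simp
qed

text \<open>The bound 1 holds at every point, also at zeros of the boundary function, where the
  quotient is \<open>0 / 0 = 0\<close>.\<close>

lemma bounded_symbol_unimodular:
  assumes "a \<in> Hinf" shows "bounded_symbol (\<lambda>\<zeta>. boundary a \<zeta> / cnj (boundary a \<zeta>))"
proof -
  have [measurable]: "boundary a \<in> borel_measurable circle_measure"
    by (intro boundary_measurable Hinf_holomorphic assms)
  have "cmod (boundary a \<zeta> / cnj (boundary a \<zeta>)) \<le> 1" for \<zeta> by (simp add: norm_divide)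
  then show ?thesis unfolding bounded_symbol_def by (auto intro!: exI[of _ 1])
qed

text \<open>On the circle, \<open>a * f\<close> paired with \<open>h\<close> equals
  \<open>(a / cnj a) * f\<close> paired with \<open>a * h\<close>; cancelling \<open>cnj a\<close>
  is legitimate almost everywhere by \<open>outer_boundary_nonzero\<close>. Since
  \<open>a * h\<close> lies in \<open>H2\<close>, the projection may be inserted, and the adjoint
  relation \<open>T_conj_inner\<close> finishes.\<close>

lemma T_conj_Toeplitz_unimodular:
  assumes a: "a \<in> Hinf" "outer a" and f: "f \<in> H2"
  shows "T_conj a (Toeplitz (\<lambda>\<zeta>. boundary a \<zeta> / cnj (boundary a \<zeta>)) f) = (\<lambda>z. a z * f z)"
proof -
  define \<phi> where "\<phi> \<zeta> = boundary a \<zeta> / cnj (boundary a \<zeta>)" for \<zeta>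
  have \<phi>: "bounded_symbol \<phi>" unfolding \<phi>_def by (rule bounded_symbol_unimodular[OF a(1)])
  note \<psi> = bounded_symbol_cnj[OF bounded_symbol_boundary[OF a(1)]]
  have af: "(\<lambda>z. a z * f z) \<in> H2" by (rule Hinf_mult_H2[OF a(1) f])
  have U: "Toeplitz \<phi> f \<in> H2" by (rule Toeplitz_characterization(1)[OF \<phi> f])
  have ma: "boundary a \<in> borel_measurable circle_measure"
    by (intro boundary_measurable Hinf_holomorphic a)
  have mfp: "(\<lambda>\<zeta>. \<phi> \<zeta> * boundary f \<zeta>) \<in> borel_measurable circle_measure"
    by (intro circle_L2_measurable bounded_symbol_mult_L2 \<phi> boundary_in_L2 f)
  show ?thesis unfolding \<phi>_def[symmetric]
  proof (rule Toeplitz_characterization(3)[OF \<psi> U af])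
    fix h assume h: "h \<in> H2"
    note mh = boundary_borel[OF h]
    have "H2_inner (\<lambda>z. a z * f z) h = L2_inner (\<lambda>\<zeta>. boundary a \<zeta> * boundary f \<zeta>) (boundary h)"
      unfolding H2_inner_def
      by (rule L2_inner_cong_AE[OF boundary_mult_AE[OF a(1) f]])
         (simp, (intro borel_measurable_times ma boundary_borel[OF f] boundary_borel[OF af] mh)+)
    also have "\<dots> = L2_inner (\<lambda>\<zeta>. \<phi> \<zeta> * boundary f \<zeta>) (\<lambda>\<zeta>. boundary a \<zeta> * boundary h \<zeta>)"
      unfolding L2_inner_def
    proof (rule integral_cong_AE)
      show "AE \<zeta> in circle_measure. boundary a \<zeta> * boundary f \<zeta> * cnj (boundary h \<zeta>) =
          \<phi> \<zeta> * boundary f \<zeta> * cnj (boundary a \<zeta> * boundary h \<zeta>)"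
        using outer_boundary_nonzero[OF a] by eventually_elim (simp add: \<phi>_def)
    qed (intro borel_measurable_times[OF mfp] borel_measurable_times borel_measurable_cnj ma mh boundary_borel[OF f])+
    also have "\<dots> = L2_inner (\<lambda>\<zeta>. \<phi> \<zeta> * boundary f \<zeta>) (boundary (\<lambda>z. a z * h z))"
    proof (rule L2_inner_cong_AE)
      show "AE \<zeta> in circle_measure. boundary a \<zeta> * boundary h \<zeta> = boundary (\<lambda>z. a z * h z) \<zeta>"
        using boundary_mult_AE[OF a(1) h] by eventually_elim simp
    qed (simp, (rule mfp borel_measurable_times[OF ma mh] boundary_borel[OF Hinf_mult_H2[OF a(1) h]])+)
    also have "\<dots> = H2_inner (Toeplitz \<phi> f) (\<lambda>z. a z * h z)"
      by (rule Toeplitz_characterization(2)[OF \<phi> f Hinf_mult_H2[OF a(1) h], symmetric])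
    also have "\<dots> = H2_inner (T_conj a (Toeplitz \<phi> f)) h" by (rule T_conj_inner[OF a(1) U h, symmetric])
    also have "\<dots> = L2_inner (\<lambda>\<zeta>. cnj (boundary a \<zeta>) * boundary (Toeplitz \<phi> f) \<zeta>) (boundary h)"
      by (rule Toeplitz_characterization(2)[OF \<psi> U h])
    finally show "H2_inner (\<lambda>z. a z * f z) h =
      L2_inner (\<lambda>\<zeta>. cnj (boundary a \<zeta>) * boundary (Toeplitz \<phi> f) \<zeta>) (boundary h)" .
  qed
qed

lemma outer_nonzero:
  assumes "outer a" "cmod z < 1" shows "a z \<noteq> 0"
proof -
  obtain c w where "cmod c = 1" "\<forall>z\<in>ball 0 1. a z = c * exp (w z)"
    using assms(1) unfolding outer_def by (elim exE conjE) (rule that)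
  then show ?thesis using assms(2) by auto
qed

lemma T_conj_inj_on:
  assumes a: "a \<in> Hinf" "outer a" shows "inj_on (T_conj a) H2"
proof (rule inj_onI)
  fix f g assume f: "f \<in> H2" and g: "g \<in> H2" and eq: "T_conj a f = T_conj a g"
  note \<psi> = bounded_symbol_cnj[OF bounded_symbol_boundary[OF a(1)]]
  have "T_conj a (\<lambda>z. f z + - 1 * g z) = (\<lambda>z. T_conj a f z + - 1 * T_conj a g z)"
    unfolding Toeplitz_add[OF \<psi> f H2_scale[OF g]] Toeplitz_scale[OF \<psi> g] ..
  also have "\<dots> = (\<lambda>z. 0)" by (simp add: eq)
  finally have "(\<lambda>z. f z + - 1 * g z) = (\<lambda>z. 0)"
    by (rule T_conj_inject[OF a H2_add[OF f H2_scale[OF g]]])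
  then show "f = g" by (simp add: fun_eq_iff)
qed

lemma M_co_norm_T_conj:
  assumes a: "a \<in> Hinf" "outer a" and f: "f \<in> H2"
  shows "M_co_norm a (T_conj a f) = H2_norm f"
  using inv_into_f_f[OF T_conj_inj_on[OF a] f] by (simp add: M_co_norm_def M_co_inner_def H2_norm_def)

lemma T_conj_diff:
  assumes a: "a \<in> Hinf" and f: "f \<in> H2" and g: "g \<in> H2"
  shows "(\<lambda>z. T_conj a f z - T_conj a g z) = T_conj a (\<lambda>z. f z - g z)"
proof -
  note \<psi> = bounded_symbol_cnj[OF bounded_symbol_boundary[OF a]]
  have "T_conj a (\<lambda>z. f z + - 1 * g z) = (\<lambda>z. T_conj a f z + - 1 * T_conj a g z)"
    unfolding Toeplitz_add[OF \<psi> f H2_scale[OF g]] Toeplitz_scale[OF \<psi> g] ..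
  then show ?thesis by simp
qed

text \<open>Off \<open>M_co a\<close> the preimage chosen by \<open>inv_into\<close> is a fixed junk value, so symmetry holds there too.\<close>

lemma M_co_norm_minus:
  assumes a: "a \<in> Hinf" "outer a"
  shows "M_co_norm a (\<lambda>z. - F z) = M_co_norm a F"
proof -
  have mem: "(\<lambda>z. - F z) \<in> M_co a \<and> M_co_norm a (\<lambda>z. - F z) = M_co_norm a F" if F: "F \<in> M_co a" for F
  proof -
    obtain f where f: "f \<in> H2" "F = T_conj a f" using F unfolding M_co_def by blast
    have m: "(\<lambda>z. - F z) = T_conj a (\<lambda>z. - 1 * f z)"
      unfolding f(2) Toeplitz_scale[OF bounded_symbol_cnj[OF bounded_symbol_boundary[OF a(1)]] f(1)] by simp
    have "M_co_norm a (\<lambda>z. - F z) = H2_norm (\<lambda>z. - 1 * f z)"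
      unfolding m by (rule M_co_norm_T_conj[OF a H2_scale[OF f(1)]])
    also have "\<dots> = M_co_norm a F" unfolding f(2) M_co_norm_T_conj[OF a f(1)] using H2_norm_minus[of f] by simp
    finally show ?thesis using H2_scale[OF f(1), of "- 1"] unfolding M_co_def m by blast
  qed
  show ?thesis
  proof (cases "F \<in> M_co a")
    case True
    then show ?thesis using mem by blast
  next
    case False
    moreover from this have "(\<lambda>z. - F z) \<notin> M_co a" using mem[of "\<lambda>z. - F z"] by auto
    ultimately have "inv_into H2 (T_conj a) (\<lambda>z. - F z) = inv_into H2 (T_conj a) F"
      unfolding inv_into_def M_co_def image_iff by (intro arg_cong[where f = Eps] ext) auto
    then show ?thesis by (simp add: M_co_norm_def M_co_inner_def)
  qed
qed

lemma Metric_space_M_co: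
  assumes a: "a \<in> Hinf" "outer a"
  shows "Metric_space (M_co a) (\<lambda>F G. M_co_norm a (\<lambda>z. F z - G z))"
  unfolding M_co_def
proof (rule Metric_space_isometric_image[OF Metric_space_H2 _ _ _ T_conj_inj_on[OF a]])
  show "M_co_norm a (\<lambda>z. T_conj a f z - T_conj a g z) = H2_norm (\<lambda>z. f z - g z)" if "f \<in> H2" "g \<in> H2" for f g
    using that by (simp add: T_conj_diff a M_co_norm_T_conj H2_diff)
  show "0 \<le> M_co_norm a (\<lambda>z. F z - G z)" for F G
    unfolding M_co_norm_def M_co_inner_def H2_inner_self by (simp add: H2_sqnorm_nonneg)
  show "M_co_norm a (\<lambda>z. F z - G z) = M_co_norm a (\<lambda>z. G z - F z)" for F G
    using M_co_norm_minus[OF a, of "\<lambda>z. F z - G z"] by simp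
qed

lemma closed_subspace_M_an_iff:
  assumes a: "a \<in> Hinf" "outer a"
  defines "\<phi> \<equiv> \<lambda>\<zeta>. boundary a \<zeta> / cnj (boundary a \<zeta>)"
  shows "closed_subspace (M_co a) (M_co_norm a) (M_an a) \<longleftrightarrow>
    closedin (Metric_space.mtopology H2 (\<lambda>f g. H2_norm (\<lambda>z. f z - g z))) (Toeplitz \<phi> ` H2)"
proof -
  have \<phi>: "bounded_symbol \<phi>" unfolding \<phi>_def by (rule bounded_symbol_unimodular[OF a(1)])
  have sub: "Toeplitz \<phi> ` H2 \<subseteq> H2" using Toeplitz_characterization(1)[OF \<phi>] by blast
  have img: "M_an a = T_conj a ` (Toeplitz \<phi> ` H2)"
    unfolding M_an_def image_image \<phi>_def
    by (intro image_cong refl T_conj_Toeplitz_unimodular[OF a, symmetric])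
  have add: "(\<lambda>z. F z + G z) \<in> M_an a" if FG: "F \<in> M_an a" "G \<in> M_an a" for F G
  proof -
    obtain f g where fg: "f \<in> H2" "F = (\<lambda>z. a z * f z)" "g \<in> H2" "G = (\<lambda>z. a z * g z)"
      using FG unfolding M_an_def by blast
    then show ?thesis unfolding M_an_def
      by (intro image_eqI[where x = "\<lambda>z. f z + g z"] H2_add) (auto simp: distrib_left)
  qed
  have scale: "(\<lambda>z. c * F z) \<in> M_an a" if F: "F \<in> M_an a" for F c
  proof -
    obtain f where f: "f \<in> H2" "F = (\<lambda>z. a z * f z)" using F unfolding M_an_def by blast
    then show ?thesis unfolding M_an_def
      by (intro image_eqI[where x = "\<lambda>z. c * f z"] H2_scale) auto
  qed
  have zero: "(\<lambda>z. 0) \<in> M_an a"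
    unfolding M_an_def by (rule image_eqI[OF _ H2_zero]) simp
  \<comment> \<open>The inclusion of the two range spaces is a by-product of the factorization
    \<open>img\<close>.\<close>
  have subM: "M_an a \<subseteq> M_co a" unfolding img M_co_def using sub by blast
  have "closedin (Metric_space.mtopology (M_co a) (\<lambda>F G. M_co_norm a (\<lambda>z. F z - G z))) (M_an a) \<longleftrightarrow>
      closedin (Metric_space.mtopology H2 (\<lambda>f g. H2_norm (\<lambda>z. f z - g z))) (Toeplitz \<phi> ` H2)"
    unfolding img M_co_def
  proof (rule closedin_isometric_image[OF Metric_space_H2 Metric_space_M_co[OF a, unfolded M_co_def] _ sub])
    show "M_co_norm a (\<lambda>z. T_conj a f z - T_conj a g z) = H2_norm (\<lambda>z. f z - g z)" if "f \<in> H2" "g \<in> H2" for f g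
      using that by (simp add: T_conj_diff a M_co_norm_T_conj H2_diff)
  qed
  then show ?thesis unfolding closed_subspace_def using add scale zero subM by blast
qed

lemma closed_subspace_Toeplitz_range_iff:
  assumes \<phi>: "bounded_symbol \<phi>"
  shows "closed_subspace H2 H2_norm (Toeplitz \<phi> ` H2) \<longleftrightarrow>
    closedin (Metric_space.mtopology H2 (\<lambda>f g. H2_norm (\<lambda>z. f z - g z))) (Toeplitz \<phi> ` H2)"
proof -
  have "Toeplitz \<phi> ` H2 \<subseteq> H2" using Toeplitz_characterization(1)[OF \<phi>] by blast
  moreover have "(\<lambda>z. 0) \<in> Toeplitz \<phi> ` H2"
    using Toeplitz_scale[OF \<phi> H2_zero, of 0] H2_zero by (intro image_eqI[of _ _ "\<lambda>z. 0"]) auto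
  moreover have "(\<lambda>z. F z + G z) \<in> Toeplitz \<phi> ` H2" if FG: "F \<in> Toeplitz \<phi> ` H2" "G \<in> Toeplitz \<phi> ` H2" for F G
  proof -
    obtain f g where fg: "f \<in> H2" "F = Toeplitz \<phi> f" "g \<in> H2" "G = Toeplitz \<phi> g" using FG by blast
    then show ?thesis by (intro image_eqI[where x = "\<lambda>z. f z + g z"] H2_add) (auto simp: Toeplitz_add[OF \<phi>])
  qed
  moreover have "(\<lambda>z. c * F z) \<in> Toeplitz \<phi> ` H2" if F: "F \<in> Toeplitz \<phi> ` H2" for F c
  proof -
    obtain f where f: "f \<in> H2" "F = Toeplitz \<phi> f" using F by blast
    then show ?thesis by (intro image_eqI[where x = "\<lambda>z. c * f z"] H2_scale) (auto simp: Toeplitz_scale[OF \<phi>])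
  qed
  ultimately show ?thesis unfolding closed_subspace_def by blast
qed

lemma left_invertible_H2_iff:
  assumes \<phi>: "bounded_symbol \<phi>"
  shows "left_invertible_H2 (Toeplitz \<phi>) \<longleftrightarrow> (\<exists>C>0. \<forall>f. norm f \<le> C * norm (toeplitz_op \<phi> f))"
proof
  assume "left_invertible_H2 (Toeplitz \<phi>)"
  then obtain S K where S: "S ` H2 \<subseteq> H2" "\<forall>f\<in>H2. H2_norm (S f) \<le> K * H2_norm f" "\<forall>f\<in>H2. S (Toeplitz \<phi> f) = f"
    unfolding left_invertible_H2_def bounded_operator_H2_def by blast
  \<comment> \<open>The bound \<open>K\<close> need not be positive, so
    \<open>\<bar>K\<bar> + 1\<close> is taken.\<close>
  have "norm f \<le> (\<bar>K\<bar> + 1) * norm (toeplitz_op \<phi> f)" for f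
  proof -
    have "norm f \<le> K * norm (toeplitz_op \<phi> f)"
      using S(2)[rule_format, OF Toeplitz_characterization(1)[OF \<phi> disk_fun_H2[of f]]] S(3)
      by (simp add: H2_norm_disk_fun disk_fun_toeplitz_op[OF \<phi>, symmetric] del: disk_fun_H2)
         (simp add: H2_norm_disk_fun disk_fun_toeplitz_op \<phi>)
    also have "\<dots> \<le> (\<bar>K\<bar> + 1) * norm (toeplitz_op \<phi> f)" by (intro mult_right_mono) auto
    finally show ?thesis .
  qed
  then show "\<exists>C>0. \<forall>f. norm f \<le> C * norm (toeplitz_op \<phi> f)" by (intro exI[of _ "\<bar>K\<bar> + 1"]) auto
next
  assume "\<exists>C>0. \<forall>f. norm f \<le> C * norm (toeplitz_op \<phi> f)"
  then obtain C where C: "C > 0" "\<And>f. norm f \<le> C * norm (toeplitz_op \<phi> f)" by blast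
  define U where "U = toeplitz_op \<phi>"
  have U: "bounded_linear U" unfolding U_def by (rule bounded_linear_toeplitz_op[OF \<phi>])
  obtain S where S: "bounded_linear S" "\<And>x. S (U x) = x" "\<And>y z. (y - U (S y)) \<bullet> U z = 0"
    by (rule bounded_below_imp_left_inverse[OF U C[folded U_def]])
      (rule that)
  interpret S: bounded_linear S by fact
  \<comment> \<open>\<open>S\<close> is so far only real-linear. Both \<open>S (hscale c y)\<close>
    and \<open>hscale c (S y)\<close> are least-squares solutions for \<open>hscale c y\<close>,
    because \<open>hscale c\<close> commutes with \<open>U\<close> and has adjoint
    \<open>hscale (cnj c)\<close>; their difference \<open>w\<close> is therefore annihilated by
    \<open>U\<close>.\<close>
  have Sh: "S (hscale c y) = hscale c (S y)" for c y
  proof -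
    define w where "w = S (hscale c y) - hscale c (S y)"
    have Uw: "U w = U (S (hscale c y)) - U (hscale c (S y))"
      unfolding w_def by (rule linear_diff[OF bounded_linear.linear[OF U]])
    have "hscale c y - U (hscale c (S y)) = hscale c (y - U (S y))"
      by (simp add: U_def toeplitz_op_hscale \<phi> disk_fun_inject[symmetric] disk_fun_diff disk_fun_hscale right_diff_distrib)
    then have "(hscale c y - U (hscale c (S y))) \<bullet> U w = (y - U (S y)) \<bullet> U (hscale (cnj c) w)"
      by (simp add: inner_hscale_left) (simp add: U_def toeplitz_op_hscale \<phi>)
    then have "U w \<bullet> U w = 0"
      using S(3)[of y "hscale (cnj c) w"] S(3)[of "hscale c y" w] by (simp add: Uw inner_diff_left)
    then have "w = 0" using S(2)[of w] by (simp add: S.zero)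
    then show ?thesis by (simp add: w_def)
  qed
  obtain K where K: "\<And>x. norm (S x) \<le> norm x * K" using S.bounded by blast
  define T where "T f = disk_fun (S (to_hardy f))" for f
  have TH: "T (disk_fun x) = disk_fun (S x)" for x by (simp add: T_def disk_fun_inverse)
  have ex: "\<exists>x. f = disk_fun x" if "f \<in> H2" for f using that range_disk_fun by blast
  have "bounded_operator_H2 T"
    unfolding bounded_operator_H2_def
  proof (intro conjI ballI allI)
    show "T ` H2 \<subseteq> H2" by (auto simp: T_def)
    show "T (\<lambda>z. f z + g z) = (\<lambda>z. T f z + T g z)" if fg: "f \<in> H2" "g \<in> H2" for f g
    proof -
      obtain x y where "f = disk_fun x" "g = disk_fun y" using ex[OF fg(1)] ex[OF fg(2)] by blast
      then show ?thesis by (simp add: disk_fun_add[symmetric] TH S.add)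
    qed
    show "T (\<lambda>z. c * f z) = (\<lambda>z. c * T f z)" if f: "f \<in> H2" for c f
    proof -
      obtain x where "f = disk_fun x" using ex[OF f] by blast
      then show ?thesis by (simp add: disk_fun_hscale[symmetric] TH Sh)
    qed
    show "\<exists>K. \<forall>f\<in>H2. H2_norm (T f) \<le> K * H2_norm f"
    proof (intro exI[of _ K] ballI)
      fix f assume "f \<in> H2"
      then obtain x where "f = disk_fun x" using ex by blast
      then show "H2_norm (T f) \<le> K * H2_norm f" using K[of x] by (simp add: TH H2_norm_disk_fun mult.commute)
    qed
  qed
  moreover have "T (Toeplitz \<phi> f) = f" if "f \<in> H2" for f
  proof -
    obtain x where x: "f = disk_fun x" using ex \<open>f \<in> H2\<close> by blast
    show ?thesis unfolding x disk_fun_toeplitz_op[OF \<phi>, symmetric] TH using S(2) by (simp add: U_def)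
  qed
  ultimately show "left_invertible_H2 (Toeplitz \<phi>)" unfolding left_invertible_H2_def by blast
qed

text \<open>Applying \<open>T_conj a\<close> to equal images gives \<open>a * f = a * g\<close>; an
  outer function has no zeros in the disk, and members of \<open>H2\<close> vanish off it.\<close>

lemma inj_toeplitz_op_unimodular:
  assumes a: "a \<in> Hinf" "outer a"
  shows "inj (toeplitz_op (\<lambda>\<zeta>. boundary a \<zeta> / cnj (boundary a \<zeta>)))"
proof -
  define \<phi> where "\<phi> \<zeta> = boundary a \<zeta> / cnj (boundary a \<zeta>)" for \<zeta>
  have \<phi>: "bounded_symbol \<phi>" unfolding \<phi>_def by (rule bounded_symbol_unimodular[OF a(1)])
  have "f = g" if "toeplitz_op \<phi> f = toeplitz_op \<phi> g" for f g
  proof -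
    have "Toeplitz \<phi> (disk_fun f) = Toeplitz \<phi> (disk_fun g)"
      using that by (metis disk_fun_toeplitz_op[OF \<phi>])
    then have "(\<lambda>z. a z * disk_fun f z) = (\<lambda>z. a z * disk_fun g z)"
      using T_conj_Toeplitz_unimodular[OF a disk_fun_H2, of f] T_conj_Toeplitz_unimodular[OF a disk_fun_H2, of g]
      unfolding \<phi>_def by simp
    then have eq: "a z * disk_fun f z = a z * disk_fun g z" for z by (rule fun_cong)
    have "disk_fun f z = disk_fun g z" for z
      using eq[of z] outer_nonzero[OF a(2), of z] H2_off_disk[OF disk_fun_H2, of z]
      by (cases "cmod z < 1") auto
    then show ?thesis by (simp add: disk_fun_inject[symmetric] fun_eq_iff)
  qed
  then show ?thesis unfolding \<phi>_def inj_def by blast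
qed

theorem proposition5p9:
  fixes a :: "complex \<Rightarrow> complex"
  assumes "a \<in> Hinf" and "outer a"
  shows "(closed_subspace (M_co a) (M_co_norm a) (M_an a) \<longleftrightarrow>
            closed_subspace H2 H2_norm (Toeplitz (\<lambda>\<zeta>. boundary a \<zeta> / cnj (boundary a \<zeta>)) ` H2)) \<and>
         (closed_subspace H2 H2_norm (Toeplitz (\<lambda>\<zeta>. boundary a \<zeta> / cnj (boundary a \<zeta>)) ` H2) \<longleftrightarrow>
            left_invertible_H2 (Toeplitz (\<lambda>\<zeta>. boundary a \<zeta> / cnj (boundary a \<zeta>)))) \<and>
         (left_invertible_H2 (Toeplitz (\<lambda>\<zeta>. boundary a \<zeta> / cnj (boundary a \<zeta>))) \<longleftrightarrow>
            Toeplitz (\<lambda>\<zeta>. cnj (boundary a \<zeta>) / boundary a \<zeta>) ` H2 = H2)"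
proof -
  define \<phi> where "\<phi> \<zeta> = boundary a \<zeta> / cnj (boundary a \<zeta>)" for \<zeta>
  have \<phi>: "bounded_symbol \<phi>" unfolding \<phi>_def by (rule bounded_symbol_unimodular[OF assms(1)])
  define U V where "U = toeplitz_op \<phi>" and "V = toeplitz_op (\<lambda>\<zeta>. cnj (\<phi> \<zeta>))"
  have U: "bounded_linear U" and V: "bounded_linear V"
    unfolding U_def V_def by (intro bounded_linear_toeplitz_op bounded_symbol_cnj \<phi>)+
  have adj: "U f \<bullet> h = f \<bullet> V h" for f h unfolding U_def V_def by (rule toeplitz_op_adjoint[OF \<phi>])
  have inj: "inj U" unfolding U_def \<phi>_def[abs_def] by (rule inj_toeplitz_op_unimodular[OF assms])
  have i_ii: "closed_subspace (M_co a) (M_co_norm a) (M_an a) \<longleftrightarrow> closed_subspace H2 H2_norm (Toeplitz \<phi> ` H2)"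
    unfolding closed_subspace_Toeplitz_range_iff[OF \<phi>]
    unfolding \<phi>_def[abs_def] by (rule closed_subspace_M_an_iff[OF assms])
  have ii: "closed_subspace H2 H2_norm (Toeplitz \<phi> ` H2) \<longleftrightarrow> closed (range U)"
    unfolding closed_subspace_Toeplitz_range_iff[OF \<phi>]
    by (simp only: Toeplitz_image_H2[OF \<phi>] closedin_H2_iff U_def)
  have iii: "left_invertible_H2 (Toeplitz \<phi>) \<longleftrightarrow> (\<exists>C>0. \<forall>f. norm f \<le> C * norm (U f))"
    unfolding U_def by (rule left_invertible_H2_iff[OF \<phi>])
  have iv: "Toeplitz (\<lambda>\<zeta>. cnj (boundary a \<zeta>) / boundary a \<zeta>) ` H2 = H2 \<longleftrightarrow> surj V"
  proof -
    \<comment> \<open>An equality at every point, zeros of \<open>boundary a\<close> included, since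
      division by zero gives zero on both sides.\<close>
    have "(\<lambda>\<zeta>. cnj (boundary a \<zeta>) / boundary a \<zeta>) = (\<lambda>\<zeta>. cnj (\<phi> \<zeta>))" by (simp add: \<phi>_def)
    then have "Toeplitz (\<lambda>\<zeta>. cnj (boundary a \<zeta>) / boundary a \<zeta>) ` H2 = disk_fun ` range V"
      unfolding V_def by (simp only: Toeplitz_image_H2[OF bounded_symbol_cnj[OF \<phi>]])
    moreover have "inj disk_fun" by (intro injI) (simp add: disk_fun_inject)
    then have "disk_fun ` range V = range disk_fun \<longleftrightarrow> surj V" by (rule inj_image_eq_iff)
    ultimately show ?thesis by (simp only: range_disk_fun)
  qed
  have below_closed: "closed (range U)" if C: "C > 0" "\<forall>f. norm f \<le> C * norm (U f)" for C
    by (rule bounded_below_imp_closed_range[OF U C(1) C(2)[rule_format]])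
  have below_surj: "surj V" if C: "C > 0" "\<forall>f. norm f \<le> C * norm (U f)" for C
  proof -
    obtain S where "bounded_linear S" "\<And>x. S (U x) = x"
      using bounded_below_imp_left_inverse[OF U C(1) C(2)[rule_format]] by metis
    then show ?thesis by (rule left_inverse_imp_surj_adjoint[OF _ _ adj])
  qed
  \<comment> \<open>The lower bound on \<open>U\<close> is the hub: closed range and surjectivity of
    \<open>V\<close> are each shown equivalent to it, as left invertibility was in
    \<open>iii\<close>.\<close>
  have "closed (range U) \<longleftrightarrow> (\<exists>C>0. \<forall>f. norm f \<le> C * norm (U f))"
    using closed_range_imp_bounded_below[OF U V adj inj] below_closed by metis
  moreover have "(\<exists>C>0. \<forall>f. norm f \<le> C * norm (U f)) \<longleftrightarrow> surj V"
    using surj_adjoint_imp_bounded_below[OF U adj] below_surj by metis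
  ultimately show ?thesis
    using i_ii ii iii iv unfolding \<phi>_def[abs_def] by blast
qed

end
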